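(* Assume that $f(t,\cdot,\cdot,\cdot)$ (for every $t\in\mathcal T$) and $g$ are continuous, that $(x,a)\mapsto\mathbb P_t^0(x,a,\cdot)$ is weakly continuous for every $t\in\mathcal T$, and that the policy class is regular (see context). Suppose that for every $\theta\in\mathrm{int}(\Theta)$ and every $r\in\mathbb R^{d_\theta}$ there is $h_0>0$ such that for every $s\in\bar{\mathcal T}$ the family $\{x\mapsto (V_s^{\theta+hr}(x)-V_s^\theta(x))/h:\ 0<|h|\le h_0,\ \theta+hr\in\Theta\}$ is equicontinuous on $\mathcal X$, and for every $s\in\mathcal T$ the family $\{(x,a,\lambda)\mapsto (F_s^{\theta+hr}(\lambda;x,a)-F_s^\theta(\lambda;x,a))/h:\ 0<|h|\le h_0,\ \theta+hr\in\Theta\}$ is equicontinuous on $\mathcal X\times A\times[0,\Lambda]$. Assume that for all $t\in\mathcal T$, $x\in\mathcal X$, $a\in A$, $\theta\in\Theta$, $\Lambda_t^{*,\theta}(x,a)=\{\lambda_t^\star(x,a,\theta)\}$ is a singleton and, for every $x'\in\mathcal X$, $Y^*_{t,\theta,\lambda_t^\star(x,a,\theta)}(x,a;x')=\{y_t^\star(x,a,x',\theta)\}$ is a singleton. Let $\mathbb P^{*,\theta}$ be the worst-case path measure with initial distribution $\mu_0$ (see context). Then, for $\theta\in\mathrm{int}(\Theta)$, $$\nabla_\theta J(\theta)=\mathbb E^{\mathbb P^{*,\theta}}\Big[\sum_{t=0}^{T-1}G_t^\theta(X_t,a_t)\,\nabla_\theta\log\pi_t^\theta(X_t,a_t)\B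ig].$$
   Context: Model. $\mathcal X\subset\mathbb R^d$, $A\subset\mathbb R^m$ are nonempty compact sets, $T\ge1$ an integer, $\mathcal T=\{0,\dots,T-1\}$, $\bar{\mathcal T}=\{0,\dots,T\}$, $q\ge1$ an integer, $\varepsilon>0$, $c(x,y)=\|x-y\|^q$ (Euclidean norm). $\mathcal P(\mathcal X)$ is the set of Borel probability measures on $\mathcal X$ and $W_q$ the $q$-Wasserstein distance for the Euclidean metric. Rewards: Borel $f:\mathcal T\times\mathcal X\times A\times\mathcal X\to\mathbb R$, $g:\mathcal X\to\mathbb R$. For $t\in\mathcal T$, $\mathbb P_t^0$ is a Borel (nominal) transition kernel from $\mathcal X\times A$ to $\mathcal X$, and $\mathbb B_t(x,a)=\{\mathbb P\in\mathcal P(\mathcal X):W_q(\mathbb P,\mathbb P_t^0(x,a,\cdot))\le\varepsilon\}$. $\mu_0\in\mathcal P(\mathcal X)$ is the initial distribution. Policies. $\Theta\subset\mathbb R^{d_\theta}$ is compact, $\nu$ is a reference measure on $A$, and for $\theta\in\Theta$, $\pi_t^\theta(x,da)=\pi_t^\theta(x,a)\,\nu(da)$ is a probability measure on $A$ for each $(t,x)\in\mathcal T\times\mathcal X$. The policy class is regular if for each $t$: $(\theta,x)\mapsto\pi_t^\theta(x,\cdot)$ is weakly continuous on $\Theta\times\mathcal X$; for every $\varphi\in C(A)$, $\theta\mapsto\int_A\varphi(a)\pi_t^\theta(x,da)$ is $C^1$ on $\Theta$ with derivative continuous in $(\theta,x)$; and the score $\nabla_\theta\log\pi_t^\theta(x,a)$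 exists with $\sup_{\theta,t,x,a}\|\nabla_\theta\log\pi_t^\theta(x,a)\|<\infty$. Value functions. $V_t^\theta(x)=\inf\mathbb E\big[\sum_{l=t}^{T-1}f(l,X_l,a_l,X_{l+1})+g(X_T)\big]$, the infimum being over path laws $\delta_x(dx_t)\prod_{l=t}^{T-1}\pi_l^\theta(x_l,da_l)\mathbb P_l(x_l,a_l,dx_{l+1})$ with Borel kernels $\mathbb P_l$ such that $\mathbb P_l(x',a',\cdot)\in\mathbb B_l(x',a')$ for all $(x',a')$. $J(\theta)=\int_{\mathcal X}V_0^\theta(x)\,\mu_0(dx)$. Dual objects. For $\lambda\ge0$, $$F_t^\theta(\lambda;x,a)=\int_{\mathcal X}\inf_{y\in\mathcal X}\{f(t,x,a,y)+V_{t+1}^\theta(y)+\lambda c(x',y)\}\,\mathbb P_t^0(x,a,dx')-\varepsilon^q\lambda,$$ $Y_{t,\theta,\lambda}^*(x,a;x')=\arg\min_{y\in\mathcal X}\{f(t,x,a,y)+V_{t+1}^\theta(y)+\lambda c(x',y)\}$, $\Lambda_t^{*,\theta}(x,a)=\arg\max_{\lambda\ge0}F_t^\theta(\lambda;x,a)$, and $G_t^\theta(x,a)=\sup_{\lambda\ge0}F_t^\theta(\lambda;x,a)$, which by Wasserstein duality equals $\inf_{\mathbb P\in\mathbb B_t(x,a)}\int(f(t,x,a,y)+V_{t+1}^\theta(y))\mathbb P(dy)$. The dynamic programming recursion is $V_T^\theta=g$, $V_t^\theta(x)=\int_AG_t^\theta(x,a)\pi_t^\theta(x,da)$. $\Lambda<\infty$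 is a fixed constant, independent of $(t,\theta,x,a)$, with $\Lambda_t^{*,\theta}(x,a)=\arg\max_{\lambda\in[0,\Lambda]}F_t^\theta(\lambda;x,a)$ for all $(t,\theta,x,a)$ (such a constant exists). Worst-case path measure. For each $t$, $\mathbb P_t^{*,\theta}$ is a Borel selector with $\mathbb P_t^{*,\theta}(x,a,\cdot)\in\arg\min_{\mathbb P\in\mathbb B_t(x,a)}\int(f(t,x,a,y)+V_{t+1}^\theta(y))\mathbb P(dy)$ for all $(x,a)$, and $\mathbb P^{*,\theta}(d\omega)=\mu_0(dx_0)\prod_{t=0}^{T-1}\pi_t^\theta(x_t,da_t)\prod_{t=0}^{T-1}\mathbb P_t^{*,\theta}(x_t,a_t,dx_{t+1})$ on $(\mathcal X\times A)^T\times\mathcal X$, with coordinate maps $X_t,a_t$. Gradient. $\nabla_\theta J(\theta)$ is the vector representing the (two-sided, linear in $r$) directional derivative $r\mapsto\lim_{h\to0}(J(\theta+hr)-J(\theta))/h$. *)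

theory Defs
  imports "HOL-Probability.Probability"
begin

section \<open>Weak continuity, equicontinuity, gradients\<close>

text \<open>Test functions need no boundedness condition, since this is only used with \<open>S\<close> compact
  and measures living on \<open>S\<close>.\<close>

definition weakly_continuous_on ::
    "'b::topological_space set \<Rightarrow> ('b \<Rightarrow> 'c::topological_space measure) \<Rightarrow> 'c set \<Rightarrow> bool" where
  "weakly_continuous_on U K S \<longleftrightarrow>
     (\<forall>\<phi> :: 'c \<Rightarrow> real. continuous_on S \<phi> \<longrightarrow> continuous_on U (\<lambda>u. \<integral>y. \<phi> y \<partial>K u))"

definition equicontinuous_on :: "'b::metric_space set \<Rightarrow> ('b \<Rightarrow> real) set \<Rightarrow> bool" where
  "equicontinuous_on S \<F> \<longleftrightarrow>
     (\<forall>x\<in>S. \<forall>e>0. \<exists>d>0. \<forall>y\<in>S. dist y x < d \<longrightarrow> (\<forall>u\<in>\<F>. \<bar>u y - u x\<bar> < e))"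

text \<open>\<open>v\<close> represents the directional derivatives of \<open>F\<close> at \<open>\<theta>\<close>. For \<open>\<theta>\<close> in the interior of \<open>S\<close>
  the limit is the ordinary two-sided one; at other points only \<open>h\<close> with \<open>\<theta> + h r \<in> S\<close> count.\<close>

definition has_gradient_within ::
    "('p::euclidean_space \<Rightarrow> real) \<Rightarrow> 'p \<Rightarrow> 'p \<Rightarrow> 'p set \<Rightarrow> bool" where
  "has_gradient_within F v \<theta> S \<longleftrightarrow>
     (\<forall>r. ((\<lambda>h. (F (\<theta> + h *\<^sub>R r) - F \<theta>) / h) \<longlongrightarrow> v \<bullet> r) (at 0 within {h. \<theta> + h *\<^sub>R r \<in> S}))"

section \<open>Wasserstein distance\<close>

definition couplings :: "'x measure \<Rightarrow> 'x measure \<Rightarrow> ('x \<times> 'x) measure set" where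
  "couplings P Q = {\<gamma>. sets \<gamma> = sets (P \<Otimes>\<^sub>M Q) \<and> distr \<gamma> P fst = P \<and> distr \<gamma> Q snd = Q}"

text \<open>Only used for probability measures on a compact set, where the cost is bounded and hence
  every transport cost is finite.\<close>

definition wasserstein :: "nat \<Rightarrow> 'x::euclidean_space measure \<Rightarrow> 'x measure \<Rightarrow> real" where
  "wasserstein q P Q = root q (INF \<gamma>\<in>couplings P Q. \<integral>(x, y). norm (x - y) ^ q \<partial>\<gamma>)"

section \<open>Path laws\<close>

text \<open>Paths over the times \<open>t, \<dots>, t + n\<close>: the states at these times paired with the actions at
  \<open>t, \<dots>, t + n - 1\<close>.\<close>

definition path_space ::
    "'x measure \<Rightarrow> 'a measure \<Rightarrow> nat \<Rightarrow> nat \<Rightarrow> ((nat \<Rightarrow> 'x) \<times> (nat \<Rightarrow> 'a)) measure" where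
  "path_space MX MA t n = (\<Pi>\<^sub>M i\<in>{t..t + n}. MX) \<Otimes>\<^sub>M (\<Pi>\<^sub>M i\<in>{t..<t + n}. MA)"

text \<open>The law \<open>\<delta>\<^sub>x(dx\<^sub>t) \<Prod>\<^sub>l \<pi>\<^sub>l(x\<^sub>l, da\<^sub>l) K\<^sub>l(x\<^sub>l, a\<^sub>l, dx\<^sub>l\<^sub>+\<^sub>1)\<close> for \<open>l\<close> in \<open>t, \<dots>, t + n - 1\<close>,
  built from the back: draw the action and the next state, then the remaining path.\<close>

primrec path_law ::
    "'x measure \<Rightarrow> 'a measure \<Rightarrow> (nat \<Rightarrow> 'x \<Rightarrow> 'a measure) \<Rightarrow> (nat \<Rightarrow> 'x \<times> 'a \<Rightarrow> 'x measure) \<Rightarrow>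
     nat \<Rightarrow> nat \<Rightarrow> 'x \<Rightarrow> ((nat \<Rightarrow> 'x) \<times> (nat \<Rightarrow> 'a)) measure" where
  "path_law MX MA \<pi> K 0 t x =
     return (path_space MX MA t 0) (\<lambda>i\<in>{t}. x, \<lambda>i. undefined)"
| "path_law MX MA \<pi> K (Suc n) t x =
     \<pi> t x \<bind> (\<lambda>a. K t (x, a) \<bind> (\<lambda>y.
       distr (path_law MX MA \<pi> K n (Suc t) y) (path_space MX MA t (Suc n))
         (\<lambda>(\<omega>, \<alpha>). (fun_upd \<omega> t x, fun_upd \<alpha> t a))))"

section \<open>The robust control problem\<close>

record ('x, 'a, 'p) robust_mdp =
  states :: "'x set"
  actions :: "'a set"
  horizon :: nat
  expo :: nat
  radius :: real
  reward :: "nat \<Rightarrow> 'x \<Rightarrow> 'a \<Rightarrow> 'x \<Rightarrow> real"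
  terminal :: "'x \<Rightarrow> real"
  nominal :: "nat \<Rightarrow> 'x \<times> 'a \<Rightarrow> 'x measure"
  init :: "'x measure"
  params :: "'p set"
  refm :: "'a measure"
  dens :: "nat \<Rightarrow> 'p \<Rightarrow> 'x \<Rightarrow> 'a \<Rightarrow> real"

abbreviation state_space :: "('x::euclidean_space, 'a, 'p) robust_mdp \<Rightarrow> 'x measure" where
  "state_space M \<equiv> restrict_space borel (states M)"

abbreviation action_space :: "('x, 'a::euclidean_space, 'p) robust_mdp \<Rightarrow> 'a measure" where
  "action_space M \<equiv> restrict_space borel (actions M)"

definition transition_kernel ::
    "('x::euclidean_space, 'a::euclidean_space, 'p) robust_mdp \<Rightarrow> ('x \<times> 'a \<Rightarrow> 'x measure) \<Rightarrow> bool" where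
  "transition_kernel M K \<longleftrightarrow>
     K \<in> (state_space M \<Otimes>\<^sub>M action_space M) \<rightarrow>\<^sub>M prob_algebra (state_space M)"

definition policy ::
    "('x, 'a, 'p) robust_mdp \<Rightarrow> 'p \<Rightarrow> nat \<Rightarrow> 'x \<Rightarrow> 'a measure" where
  "policy M \<theta> t x = density (refm M) (\<lambda>a. ennreal (dens M t \<theta> x a))"

definition ambiguity_set ::
    "('x::euclidean_space, 'a, 'p) robust_mdp \<Rightarrow> nat \<Rightarrow> 'x \<Rightarrow> 'a \<Rightarrow> 'x measure set" where
  "ambiguity_set M t x a =
     {P \<in> space (prob_algebra (state_space M)).
        wasserstein (expo M) P (nominal M t (x, a)) \<le> radius M}"

text \<open>Continuity of the rewards is a separate hypothesis of the results and subsumes their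
  measurability. The score is only defined where the densities are positive, and joint
  measurability of the densities is what makes functions of the score random variables.\<close>

definition robust_control_model ::
    "('x::euclidean_space, 'a::euclidean_space, 'p::euclidean_space) robust_mdp \<Rightarrow> bool" where
  "robust_control_model M \<longleftrightarrow>
     compact (states M) \<and> states M \<noteq> {} \<and> compact (actions M) \<and> actions M \<noteq> {} \<and>
     horizon M \<ge> 1 \<and> expo M \<ge> 1 \<and> radius M > 0 \<and>
     (\<forall>t<horizon M. transition_kernel M (nominal M t)) \<and>
     init M \<in> space (prob_algebra (state_space M)) \<and>
     compact (params M) \<and>
     sets (refm M) = sets (action_space M) \<and>
     (\<forall>t<horizon M. \<forall>\<theta>\<in>params M.
        (\<lambda>(x, a). dens M t \<theta> x a) \<in> borel_measurable (state_space M \<Otimes>\<^sub>M action_space M) \<and>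
        (\<forall>x\<in>states M. (\<forall>a\<in>actions M. dens M t \<theta> x a \<ge> 0) \<and> prob_space (policy M \<theta> t x)))"

definition regular_policy_class ::
    "('x::euclidean_space, 'a::euclidean_space, 'p::euclidean_space) robust_mdp \<Rightarrow>
     (nat \<Rightarrow> 'p \<Rightarrow> 'x \<Rightarrow> 'a \<Rightarrow> 'p) \<Rightarrow> bool" where
  "regular_policy_class M score \<longleftrightarrow>
     (\<forall>t<horizon M.
        weakly_continuous_on (params M \<times> states M) (\<lambda>(\<theta>, x). policy M \<theta> t x) (actions M) \<and>
        (\<forall>\<phi> :: 'a \<Rightarrow> real. continuous_on (actions M) \<phi> \<longrightarrow>
           (\<exists>D. continuous_on (params M \<times> states M) (\<lambda>(\<theta>, x). D \<theta> x) \<and>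
              (\<forall>\<theta>\<in>params M. \<forall>x\<in>states M.
                 ((\<lambda>\<theta>'. \<integral>a. \<phi> a \<partial>policy M \<theta>' t x) has_derivative (\<lambda>r. D \<theta> x \<bullet> r))
                   (at \<theta> within params M)))) \<and>
        (\<forall>\<theta>\<in>params M. \<forall>x\<in>states M. \<forall>a\<in>actions M.
           dens M t \<theta> x a > 0 \<and>
           has_gradient_within (\<lambda>\<theta>'. ln (dens M t \<theta>' x a)) (score t \<theta> x a) \<theta> (params M))) \<and>
     (\<exists>C. \<forall>t<horizon M. \<forall>\<theta>\<in>params M. \<forall>x\<in>states M. \<forall>a\<in>actions M. norm (score t \<theta> x a) \<le> C)"

section \<open>Value functions and dual objects\<close>

definition admissible_kernels ::
    "('x::euclidean_space, 'a::euclidean_space, 'p) robust_mdp \<Rightarrow> nat \<Rightarrow>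
     (nat \<Rightarrow> 'x \<times> 'a \<Rightarrow> 'x measure) set" where
  "admissible_kernels M t =
     {K. \<forall>l\<in>{t..<horizon M}. transition_kernel M (K l) \<and>
           (\<forall>x\<in>states M. \<forall>a\<in>actions M. K l (x, a) \<in> ambiguity_set M l x a)}"

definition value_fun ::
    "('x::euclidean_space, 'a::euclidean_space, 'p) robust_mdp \<Rightarrow> nat \<Rightarrow> 'p \<Rightarrow> 'x \<Rightarrow> real" where
  "value_fun M t \<theta> x =
     (INF K\<in>admissible_kernels M t.
        \<integral>(\<omega>, \<alpha>). (\<Sum>l=t..<horizon M. reward M l (\<omega> l) (\<alpha> l) (\<omega> (Suc l))) + terminal M (\<omega> (horizon M))
          \<partial>path_law (state_space M) (action_space M) (policy M \<theta>) K (horizon M - t) t x)"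

definition objective ::
    "('x::euclidean_space, 'a::euclidean_space, 'p) robust_mdp \<Rightarrow> 'p \<Rightarrow> real" where
  "objective M \<theta> = (\<integral>x. value_fun M 0 \<theta> x \<partial>init M)"

definition cont_value ::
    "('x::euclidean_space, 'a::euclidean_space, 'p) robust_mdp \<Rightarrow> nat \<Rightarrow> 'p \<Rightarrow> 'x \<Rightarrow> 'a \<Rightarrow> 'x \<Rightarrow> real" where
  "cont_value M t \<theta> x a y = reward M t x a y + value_fun M (Suc t) \<theta> y"

definition penalized ::
    "('x::euclidean_space, 'a::euclidean_space, 'p) robust_mdp \<Rightarrow>
     nat \<Rightarrow> 'p \<Rightarrow> real \<Rightarrow> 'x \<Rightarrow> 'a \<Rightarrow> 'x \<Rightarrow> 'x \<Rightarrow> real" where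
  "penalized M t \<theta> lam x a x' y = cont_value M t \<theta> x a y + lam * norm (x' - y) ^ expo M"

definition dual_fun ::
    "('x::euclidean_space, 'a::euclidean_space, 'p) robust_mdp \<Rightarrow>
     nat \<Rightarrow> 'p \<Rightarrow> real \<Rightarrow> 'x \<Rightarrow> 'a \<Rightarrow> real" where
  "dual_fun M t \<theta> lam x a =
     (\<integral>x'. (INF y\<in>states M. penalized M t \<theta> lam x a x' y) \<partial>nominal M t (x, a)) - radius M ^ expo M * lam"

definition dual_value ::
    "('x::euclidean_space, 'a::euclidean_space, 'p) robust_mdp \<Rightarrow> nat \<Rightarrow> 'p \<Rightarrow> 'x \<Rightarrow> 'a \<Rightarrow> real" where
  "dual_value M t \<theta> x a = (SUP lam\<in>{0..}. dual_fun M t \<theta> lam x a)"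

definition dual_maximizers ::
    "('x::euclidean_space, 'a::euclidean_space, 'p) robust_mdp \<Rightarrow>
     real set \<Rightarrow> nat \<Rightarrow> 'p \<Rightarrow> 'x \<Rightarrow> 'a \<Rightarrow> real set" where
  "dual_maximizers M L t \<theta> x a =
     {lam. is_arg_max (\<lambda>lam. dual_fun M t \<theta> lam x a) (\<lambda>lam. lam \<in> L) lam}"

definition inner_minimizers ::
    "('x::euclidean_space, 'a::euclidean_space, 'p) robust_mdp \<Rightarrow>
     nat \<Rightarrow> 'p \<Rightarrow> real \<Rightarrow> 'x \<Rightarrow> 'a \<Rightarrow> 'x \<Rightarrow> 'x set" where
  "inner_minimizers M t \<theta> lam x a x' =
     {y. is_arg_min (penalized M t \<theta> lam x a x') (\<lambda>y. y \<in> states M) y}"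

section \<open>Worst-case path measure\<close>

definition worst_case_selector ::
    "('x::euclidean_space, 'a::euclidean_space, 'p) robust_mdp \<Rightarrow>
     'p \<Rightarrow> (nat \<Rightarrow> 'x \<times> 'a \<Rightarrow> 'x measure) \<Rightarrow> bool" where
  "worst_case_selector M \<theta> K \<longleftrightarrow>
     (\<forall>t<horizon M. transition_kernel M (K t) \<and>
        (\<forall>x\<in>states M. \<forall>a\<in>actions M.
           is_arg_min (\<lambda>P. \<integral>y. cont_value M t \<theta> x a y \<partial>P) (\<lambda>P. P \<in> ambiguity_set M t x a) (K t (x, a))))"

definition path_measure ::
    "('x::euclidean_space, 'a::euclidean_space, 'p) robust_mdp \<Rightarrow>
     'p \<Rightarrow> (nat \<Rightarrow> 'x \<times> 'a \<Rightarrow> 'x measure) \<Rightarrow> ((nat \<Rightarrow> 'x) \<times> (nat \<Rightarrow> 'a)) measure" where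
  "path_measure M \<theta> K =
     init M \<bind> path_law (state_space M) (action_space M) (policy M \<theta>) K (horizon M) 0"

end

theory Submission
  imports Defs
begin

text \<open>Uniqueness of the dual multiplier and of the inner minimizer makes Wasserstein duality explicit:
  the first-order condition at the optimal multiplier says that transporting the nominal law along the
  inner minimizer is feasible and attains the dual value. The optimizers depend continuously on
  \<open>(x, a)\<close>, so these worst-case laws form a kernel and the Bellman recursion holds with
  continuous value functions. Uniqueness also makes every nearly optimal law weakly close to the
  worst-case one, so Danskin's theorem yields the derivative of \<open>G\<close> from that of the
  next value function. The difference quotient of the value function then converges pointwise
  by dominated convergence, as the bounded score controls the ratios of the policy densities, and
  equicontinuity upgrades this to the uniform convergence that the next backward step needs. Unrolling
  the recursion for the derivative along the worst-case path law gives the gradient.\<close>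

section \<open>Compactness and integration\<close>

text \<open>No primal minimizer is available when duality is proved, so strong duality has to be
  extracted from the optimality of the multiplier alone. The tool is a compactness modulus: for each
  continuous test function and each error \<eta> there is a constant \<open>C\<close> such that a
  deviation from \<open>ystar\<close> is paid for by \<open>C\<close> times the dual excess, up to
  \<eta>. Applied to perturbed multipliers it differentiates the dual function; applied to nearly
  optimal couplings it compares laws, without extracting convergent subsequences of measures. Only
  integrals of continuous functions are ever compared, so an arbitrary worst-case selector can be
  handled without identifying it with the push-forward kernel. Continuity of the optimizers rests on
  closed graphs in compact sets; for the multiplier this is what \<Lambda> provides. Danskin's
  argument works because the ambiguity sets do not depend on the parameter: a law optimal at one
  parameter is feasible at the other, with an optimality gap of order \<open>h\<close>. The change
  of policy is moved into a density ratio under one fixed policy, so the derivative of the value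
  function is a product rule with one term from \<open>G\<close> and one from the score.\<close>

lemma INF_compact_attained:
  fixes f :: "'b::topological_space \<Rightarrow> real"
  assumes "compact K" "K \<noteq> {}" "continuous_on K f"
  obtains y where "y \<in> K" "(INF y\<in>K. f y) = f y" "\<And>z. z \<in> K \<Longrightarrow> f y \<le> f z"
proof -
  obtain y where y: "y \<in> K" "\<And>z. z \<in> K \<Longrightarrow> f y \<le> f z"
    using continuous_attains_inf[OF assms] by blast
  have "(INF y\<in>K. f y) = f y"
    by (rule cInf_eq_minimum) (use y in auto)
  with y that show ?thesis by blast
qed

lemma compact_continuous_bounded:
  fixes f :: "'b::topological_space \<Rightarrow> real"
  assumes "compact K" "continuous_on K f"
  obtains B where "B \<ge> 0" "\<And>x. x \<in> K \<Longrightarrow> \<bar>f x\<bar> \<le> B"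
proof -
  have "bounded (f ` K)"
    using assms compact_continuous_image compact_imp_bounded by blast
  then obtain B where B: "\<And>x. x \<in> K \<Longrightarrow> \<bar>f x\<bar> \<le> B"
    unfolding bounded_iff by auto
  show ?thesis
    by (rule that[of "max 0 B"]) (use B in \<open>auto simp: le_max_iff_disj\<close>)
qed

lemma continuous_on_section:
  assumes "continuous_on (U \<times> K) f" "u \<in> U"
  shows "continuous_on K (\<lambda>y. f (u, y))"
  by (rule continuous_on_compose2[OF assms(1)]) (use assms(2) in \<open>auto intro!: continuous_intros\<close>)

lemma uniform_in_second_variable:
  fixes f :: "'b::metric_space \<times> 'c::metric_space \<Rightarrow> real"
  assumes "compact U" "compact K" "continuous_on (U \<times> K) f" "e > 0"
  obtains d where "d > 0"
    "\<And>u u' y. u \<in> U \<Longrightarrow> u' \<in> U \<Longrightarrow> y \<in> K \<Longrightarrow> dist u' u < d \<Longrightarrow> \<bar>f (u', y) - f (u, y)\<bar> < e"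
proof -
  have "uniformly_continuous_on (U \<times> K) f"
    using assms by (intro compact_uniformly_continuous compact_Times)
  then obtain d where "d > 0" and d:
    "\<And>p p'. p \<in> U \<times> K \<Longrightarrow> p' \<in> U \<times> K \<Longrightarrow> dist p' p < d \<Longrightarrow> dist (f p') (f p) < e"
    unfolding uniformly_continuous_on_def using \<open>e > 0\<close> by blast
  show ?thesis
    by (rule that[OF \<open>d > 0\<close>]) (use d in \<open>force simp: dist_Pair_Pair dist_real_def\<close>)
qed

text \<open>A minimizer for \<open>u'\<close> is a competitor for \<open>u\<close>, so the infima
  inherit the modulus that holds uniformly in \<open>y\<close>. The estimate is one-sided;
  exchanging \<open>u\<close> and \<open>u'\<close> gives the other side.\<close>

lemma continuous_on_INF_compact:
  fixes f :: "'b::metric_space \<times> 'c::metric_space \<Rightarrow> real"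
  assumes U: "compact U" and K: "compact K" "K \<noteq> {}" and f: "continuous_on (U \<times> K) f"
  shows "continuous_on U (\<lambda>u. INF y\<in>K. f (u, y))"
  unfolding continuous_on_iff
proof (intro ballI allI impI)
  fix e :: real and u0 assume "u0 \<in> U" "(0::real) < e"
  obtain d where "d > 0" and d: "\<And>u u' y. u \<in> U \<Longrightarrow> u' \<in> U \<Longrightarrow> y \<in> K \<Longrightarrow> dist u' u < d \<Longrightarrow>
      \<bar>f (u', y) - f (u, y)\<bar> < e"
    using uniform_in_second_variable[OF U K(1) f \<open>0 < e\<close>] by blast
  have *: "(INF y\<in>K. f (u, y)) < (INF y\<in>K. f (u', y)) + e"
    if "u \<in> U" "u' \<in> U" "dist u' u < d" for u u'
  proof -
    obtain y where y: "y \<in> K" "(INF y\<in>K. f (u', y)) = f (u', y)"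
      using INF_compact_attained[OF K continuous_on_section[OF f \<open>u' \<in> U\<close>]] by blast
    obtain z where z: "z \<in> K" "(INF y\<in>K. f (u, y)) = f (u, z)" "\<And>w. w \<in> K \<Longrightarrow> f (u, z) \<le> f (u, w)"
      using INF_compact_attained[OF K continuous_on_section[OF f \<open>u \<in> U\<close>]] by blast
    show ?thesis
      using d[OF that(1,2) y(1) that(3)] z(3)[OF y(1)] y(2) z(2) by linarith
  qed
  show "\<exists>d>0. \<forall>u\<in>U. dist u u0 < d \<longrightarrow> dist (INF y\<in>K. f (u, y)) (INF y\<in>K. f (u0, y)) < e"
    by (rule exI[of _ d]) (use * \<open>u0 \<in> U\<close> \<open>d > 0\<close> in \<open>force simp: dist_real_def dist_commute abs_less_iff\<close>)
qed

text \<open>The minimal value \<open>m\<close> is continuous, so the set where \<open>f\<close>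
  equals \<open>m\<close> is closed. By uniqueness this set is the graph of \<open>y\<close>, and a
  closed graph in a compact target makes \<open>y\<close> continuous.\<close>

lemma continuous_on_argmin:
  fixes f :: "'b::euclidean_space \<times> 'c::euclidean_space \<Rightarrow> real"
  assumes U: "compact U" and K: "compact K" and f: "continuous_on (U \<times> K) f"
    and y: "\<And>u. u \<in> U \<Longrightarrow> y u \<in> K"
    and min: "\<And>u z. u \<in> U \<Longrightarrow> z \<in> K \<Longrightarrow> f (u, y u) \<le> f (u, z)"
    and unique: "\<And>u z. u \<in> U \<Longrightarrow> z \<in> K \<Longrightarrow> f (u, z) \<le> f (u, y u) \<Longrightarrow> z = y u"
  shows "continuous_on U y"
proof (cases "K = {}")
  case True
  then show ?thesis using y by (metis empty_iff continuous_on_empty equals0I)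
next
  case False
  define m where "m u = (INF z\<in>K. f (u, z))" for u
  have m: "m u = f (u, y u)" if "u \<in> U" for u
    unfolding m_def by (rule cInf_eq_minimum) (use y min that in auto)
  have "continuous_on U m"
    unfolding m_def by (rule continuous_on_INF_compact[OF U K False f])
  then have "continuous_on (U \<times> K) (\<lambda>p. f p - m (fst p))"
    by (intro continuous_intros f continuous_on_compose2[OF \<open>continuous_on U m\<close>]) auto
  then have "closed ((U \<times> K) \<inter> (\<lambda>p. f p - m (fst p)) -` {0})"
    by (intro continuous_closed_preimage) (use U K in \<open>auto intro: closed_Times compact_imp_closed\<close>)
  also have "(U \<times> K) \<inter> (\<lambda>p. f p - m (fst p)) -` {0} = (\<lambda>u. (u, y u)) ` U"
    using y m unique by fastforce
  finally show ?thesis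
    by (intro continuous_from_closed_graph[OF K]) (use y in auto)
qed

text \<open>The limit inherits the modulus of the family. Each point is compared with a nearby
  centre of a finite cover, where convergence is pointwise; three errors of \<open>e / 4\<close>
  leave room for the non-strict one coming from the limit.\<close>

lemma equicontinuous_pointwise_imp_uniform_limit:
  fixes D :: "nat \<Rightarrow> 'b::metric_space \<Rightarrow> real"
  assumes S: "compact S" and equi: "equicontinuous_on S (range D)"
    and lim: "\<And>x. x \<in> S \<Longrightarrow> (\<lambda>n. D n x) \<longlonglongrightarrow> w x"
  shows "uniform_limit S D w sequentially" and "continuous_on S w"
proof -
  have eq: "\<exists>d>0. \<forall>y\<in>S. dist y x < d \<longrightarrow> (\<forall>n. \<bar>D n y - D n x\<bar> < e)" if "x \<in> S" "e > 0" for x e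
    using equi that unfolding equicontinuous_on_def by simp
  have w: "\<bar>w y - w x\<bar> \<le> e" if "x \<in> S" "y \<in> S" "\<And>n. \<bar>D n y - D n x\<bar> < e" for x y e
    by (rule Lim_bounded[where M = 0 and f = "\<lambda>n. \<bar>D n y - D n x\<bar>"])
       (use that in \<open>auto intro!: tendsto_intros lim less_imp_le\<close>)
  show "continuous_on S w"
    unfolding continuous_on_iff
  proof (intro ballI allI impI)
    fix x and e :: real assume x: "x \<in> S" and "0 < e"
    then obtain d where "d > 0" and d: "\<And>y n. y \<in> S \<Longrightarrow> dist y x < d \<Longrightarrow> \<bar>D n y - D n x\<bar> < e / 2"
      using eq[OF x, of "e / 2"] by auto
    have "dist (w y) (w x) < e" if "y \<in> S" "dist y x < d" for y
      using w[OF x \<open>y \<in> S\<close> d[OF that]] \<open>e > 0\<close> by (simp add: dist_real_def)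
    then show "\<exists>d>0. \<forall>x'\<in>S. dist x' x < d \<longrightarrow> dist (w x') (w x) < e"
      using \<open>d > 0\<close> by blast
  qed
  show "uniform_limit S D w sequentially"
    unfolding uniform_limit_iff
  proof (intro allI impI)
    fix e :: real assume "0 < e"
    then have "\<forall>x\<in>S. \<exists>d>0. \<forall>y\<in>S. dist y x < d \<longrightarrow> (\<forall>n. \<bar>D n y - D n x\<bar> < e / 4)"
      by (intro ballI eq) auto
    then obtain d where d0: "\<And>x. x \<in> S \<Longrightarrow> d x > 0"
      and d: "\<And>x y n. x \<in> S \<Longrightarrow> y \<in> S \<Longrightarrow> dist y x < d x \<Longrightarrow> \<bar>D n y - D n x\<bar> < e / 4"
      by metis
    have "S \<subseteq> (\<Union>x\<in>S. ball x (d x))" using d0 by force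
    then obtain C where C: "C \<subseteq> S" "finite C" "S \<subseteq> (\<Union>x\<in>C. ball x (d x))"
      using compactE_image[OF S, of S "\<lambda>x. ball x (d x)"] by auto
    have "\<forall>\<^sub>F n in sequentially. \<forall>x\<in>C. dist (D n x) (w x) < e / 4"
      using C \<open>0 < e\<close> by (intro eventually_ball_finite ballI tendstoD lim) auto
    then show "\<forall>\<^sub>F n in sequentially. \<forall>y\<in>S. dist (D n y) (w y) < e"
    proof (eventually_elim, intro ballI)
      fix n y assume n: "\<forall>x\<in>C. dist (D n x) (w x) < e / 4" and y: "y \<in> S"
      then obtain x where x: "x \<in> C" "dist y x < d x" using C by (force simp: dist_commute)
      then have xS: "x \<in> S" using C by auto
      have "\<bar>w y - w x\<bar> \<le> e / 4" using w[OF xS y] d[OF xS y x(2)] by blast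
      moreover have "\<bar>D n y - D n x\<bar> < e / 4" using d[OF xS y x(2)] .
      moreover have "\<bar>D n x - w x\<bar> < e / 4" using n x by (auto simp: dist_real_def)
      ultimately show "dist (D n y) (w y) < e" unfolding dist_real_def by linarith
    qed
  qed
qed

section \<open>Measurability and integrals for laws on a compact set\<close>

lemma measurable_continuous_on_compose:
  fixes f :: "'b::topological_space \<Rightarrow> 'c::topological_space"
  assumes "continuous_on S f" "g \<in> N \<rightarrow>\<^sub>M borel" "\<And>x. x \<in> space N \<Longrightarrow> g x \<in> S"
  shows "(\<lambda>x. f (g x)) \<in> N \<rightarrow>\<^sub>M borel"
proof -
  have "g \<in> N \<rightarrow>\<^sub>M restrict_space borel S"
    using assms(2,3) by (intro measurable_restrict_space2) auto
  from measurable_compose[OF this borel_measurable_continuous_on_restrict[OF assms(1)]]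
  show ?thesis .
qed

lemma measurable_restrict_borel_id [measurable]: "(\<lambda>x. x) \<in> restrict_space borel S \<rightarrow>\<^sub>M borel"
  by (intro measurable_restrict_space1) simp

lemma measurable_fst_restrict_borel [measurable]:
  "fst \<in> restrict_space borel S \<Otimes>\<^sub>M N \<rightarrow>\<^sub>M borel"
  by (rule measurable_compose[OF measurable_fst measurable_restrict_borel_id])

lemma measurable_snd_restrict_borel [measurable]:
  "snd \<in> N \<Otimes>\<^sub>M restrict_space borel S \<rightarrow>\<^sub>M borel"
  by (rule measurable_compose[OF measurable_snd measurable_restrict_borel_id])

definition probs_on :: "'b::topological_space set \<Rightarrow> 'b measure set" where
  "probs_on S = space (prob_algebra (restrict_space borel S))"

lemma probs_onD:
  assumes "P \<in> probs_on S"
  shows "prob_space P" "sets P = sets (restrict_space borel S)" "space P = S"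
  using assms sets_eq_imp_space_eq[of P "restrict_space borel S"]
  by (auto simp: probs_on_def space_prob_algebra space_restrict_space)

lemma integrable_bounded_probs_on:
  fixes f :: "'b::topological_space \<Rightarrow> real"
  assumes P: "P \<in> probs_on S" and "f \<in> borel_measurable (restrict_space borel S)"
    and "\<And>x. x \<in> S \<Longrightarrow> \<bar>f x\<bar> \<le> B"
  shows "integrable P f"
proof -
  interpret prob_space P using probs_onD[OF P] by simp
  show ?thesis
    by (rule integrable_const_bound[where B = B])
       (use probs_onD[OF P] assms in \<open>auto cong: measurable_cong_sets\<close>)
qed

lemma integrable_continuous_probs_on:
  fixes f :: "'b::topological_space \<Rightarrow> real"
  assumes "compact S" "P \<in> probs_on S" "continuous_on S f"
  shows "integrable P f"
proof -
  obtain B where "\<And>x. x \<in> S \<Longrightarrow> \<bar>f x\<bar> \<le> B"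
    using compact_continuous_bounded[OF assms(1,3)] by blast
  then show ?thesis
    using integrable_bounded_probs_on[OF assms(2)] borel_measurable_continuous_on_restrict[OF assms(3)]
    by blast
qed

lemma abs_integral_diff_le:
  fixes f g :: "'b \<Rightarrow> real"
  assumes "prob_space P" "integrable P f" "integrable P g"
    and "\<And>x. x \<in> space P \<Longrightarrow> \<bar>f x - g x\<bar> \<le> B"
  shows "\<bar>(\<integral>x. f x \<partial>P) - (\<integral>x. g x \<partial>P)\<bar> \<le> B"
proof -
  interpret prob_space P by fact
  have "\<bar>\<integral>x. f x - g x \<partial>P\<bar> \<le> (\<integral>x. \<bar>f x - g x\<bar> \<partial>P)"
    by (rule integral_abs_bound)
  also have "\<dots> \<le> B"
    by (rule integral_le_const) (use assms in auto)
  finally show ?thesis using assms by simp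
qed

text \<open>The integrand and the measure move together, so the change is split: replacing the
  integrand is controlled uniformly in \<open>y\<close> by compactness, and moving the measure under
  a frozen integrand is weak continuity.\<close>

lemma continuous_on_integral_weakly_continuous:
  fixes f :: "'b::metric_space \<times> 'c::metric_space \<Rightarrow> real"
  assumes U: "compact U" and S: "compact S"
    and K: "weakly_continuous_on U K S" "\<And>u. u \<in> U \<Longrightarrow> K u \<in> probs_on S"
    and f: "continuous_on (U \<times> S) f"
  shows "continuous_on U (\<lambda>u. \<integral>y. f (u, y) \<partial>K u)"
  unfolding continuous_on_iff
proof (intro ballI allI impI)
  fix u and e :: real assume u: "u \<in> U" and "0 < e"
  obtain d1 where "d1 > 0" and d1: "\<And>u u' y. u \<in> U \<Longrightarrow> u' \<in> U \<Longrightarrow> y \<in> S \<Longrightarrow> dist u' u < d1 \<Longrightarrow>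
      \<bar>f (u', y) - f (u, y)\<bar> < e / 2"
    using uniform_in_second_variable[OF U S f, of "e / 2"] \<open>0 < e\<close> by auto
  have "continuous_on U (\<lambda>u'. \<integral>y. f (u, y) \<partial>K u')"
    using K(1) continuous_on_section[OF f u] unfolding weakly_continuous_on_def by blast
  then obtain d2 where "d2 > 0" and d2: "\<And>u'. u' \<in> U \<Longrightarrow> dist u' u < d2 \<Longrightarrow>
      dist (\<integral>y. f (u, y) \<partial>K u') (\<integral>y. f (u, y) \<partial>K u) < e / 2"
    unfolding continuous_on_iff using u \<open>0 < e\<close> by (meson half_gt_zero)
  have "dist (\<integral>y. f (u', y) \<partial>K u') (\<integral>y. f (u, y) \<partial>K u) < e"
    if u': "u' \<in> U" "dist u' u < min d1 d2" for u'
  proof -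
    have "\<bar>(\<integral>y. f (u', y) \<partial>K u') - (\<integral>y. f (u, y) \<partial>K u')\<bar> \<le> e / 2"
      using d1[OF u u'(1)] u' probs_onD[OF K(2)[OF u'(1)]]
      by (intro abs_integral_diff_le integrable_continuous_probs_on[OF S K(2)[OF u'(1)]]
            continuous_on_section[OF f] u less_imp_le) auto
    moreover have "\<bar>(\<integral>y. f (u, y) \<partial>K u') - (\<integral>y. f (u, y) \<partial>K u)\<bar> < e / 2"
      using d2[of u'] u' by (simp add: dist_real_def)
    ultimately show ?thesis unfolding dist_real_def by linarith
  qed
  then show "\<exists>d>0. \<forall>x'\<in>U. dist x' u < d \<longrightarrow>
      dist (\<integral>y. f (x', y) \<partial>K x') (\<integral>y. f (u, y) \<partial>K u) < e"
    using \<open>d1 > 0\<close> \<open>d2 > 0\<close> by (intro exI[of _ "min d1 d2"]) auto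
qed

section \<open>Wasserstein duality with unique optimizers\<close>

lemma coupling_integral:
  fixes h :: "'x::euclidean_space \<Rightarrow> real"
  assumes \<gamma>: "\<gamma> \<in> couplings P Q" and "P \<in> probs_on S" "Q \<in> probs_on S"
  shows "prob_space \<gamma>" and "space \<gamma> = S \<times> S"
    and "sets \<gamma> = sets (restrict_space borel S \<Otimes>\<^sub>M restrict_space borel S)"
    and "h \<in> borel_measurable (restrict_space borel S) \<Longrightarrow> (\<integral>p. h (fst p) \<partial>\<gamma>) = (\<integral>y. h y \<partial>P)"
    and "h \<in> borel_measurable (restrict_space borel S) \<Longrightarrow> (\<integral>p. h (snd p) \<partial>\<gamma>) = (\<integral>y. h y \<partial>Q)"
proof -
  note P = probs_onD[OF assms(2)] and Q = probs_onD[OF assms(3)]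
  show sets: "sets \<gamma> = sets (restrict_space borel S \<Otimes>\<^sub>M restrict_space borel S)"
    using \<gamma> sets_pair_measure_cong[OF P(2) Q(2)] by (auto simp: couplings_def)
  then show "space \<gamma> = S \<times> S"
    by (subst sets_eq_imp_space_eq[OF sets]) (simp add: space_pair_measure space_restrict_space)
  have fst: "fst \<in> \<gamma> \<rightarrow>\<^sub>M P" and snd: "snd \<in> \<gamma> \<rightarrow>\<^sub>M Q"
    using P(2) Q(2) by (simp_all add: measurable_cong_sets[OF sets P(2)] measurable_cong_sets[OF sets Q(2)])
  have eq: "distr \<gamma> P fst = P" "distr \<gamma> Q snd = Q"
    using \<gamma> by (auto simp: couplings_def)
  \<comment> \<open>Membership in \<open>couplings\<close> prescribes only the sigma-algebra and the
    marginals; total mass 1 is inherited from the marginal \<open>P\<close>.\<close>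
  show "prob_space \<gamma>"
    using prob_space_distrD[OF fst] eq P(1) by simp
  show "(\<integral>p. h (fst p) \<partial>\<gamma>) = (\<integral>y. h y \<partial>P)" if "h \<in> borel_measurable (restrict_space borel S)"
    using integral_distr[OF fst, of h] that eq by (simp add: measurable_cong_sets[OF P(2)])
  show "(\<integral>p. h (snd p) \<partial>\<gamma>) = (\<integral>y. h y \<partial>Q)" if "h \<in> borel_measurable (restrict_space borel S)"
    using integral_distr[OF snd, of h] that eq by (simp add: measurable_cong_sets[OF Q(2)])
qed

lemma coupling_integrable:
  fixes h :: "'x::euclidean_space \<times> 'x \<Rightarrow> real"
  assumes "\<gamma> \<in> couplings P Q" "P \<in> probs_on S" "Q \<in> probs_on S" "compact S" "continuous_on (S \<times> S) h"
  shows "integrable \<gamma> h"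
proof -
  note \<gamma> = coupling_integral(1-3)[OF assms(1-3)]
  interpret prob_space \<gamma> by (rule \<gamma>)
  obtain B where B: "\<And>p. p \<in> S \<times> S \<Longrightarrow> \<bar>h p\<bar> \<le> B"
    using compact_continuous_bounded[OF compact_Times[OF assms(4,4)] assms(5)] by blast
  have "(\<lambda>p. h (fst p, snd p)) \<in> borel_measurable (restrict_space borel S \<Otimes>\<^sub>M restrict_space borel S)"
  proof (rule measurable_continuous_on_compose[OF assms(5)])
    show "(\<lambda>p. (fst p, snd p)) \<in> borel_measurable (restrict_space borel S \<Otimes>\<^sub>M restrict_space borel S)"
      by (intro borel_measurable_Pair measurable_fst_restrict_borel measurable_snd_restrict_borel)
  qed (auto simp: space_pair_measure space_restrict_space)
  then have "h \<in> borel_measurable \<gamma>"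
    by (simp cong: measurable_cong_sets add: measurable_cong_sets[OF \<gamma>(3)])
  then show ?thesis
    by (intro integrable_const_bound[where B = B]) (use B \<gamma>(2) in auto)
qed

text \<open>Guarantees that the infimum in \<open>wasserstein\<close> runs over a nonempty set,
  hence is a genuine infimum from which nearly optimal couplings can be picked.\<close>

lemma couplings_nonempty:
  assumes "P \<in> probs_on S" "Q \<in> probs_on S"
  shows "P \<Otimes>\<^sub>M Q \<in> couplings P Q"
proof -
  interpret P: prob_space P by (rule probs_onD(1)[OF assms(1)])
  interpret Q: prob_space Q by (rule probs_onD(1)[OF assms(2)])
  have "distr (P \<Otimes>\<^sub>M Q) Q snd = Q"
  proof (rule measure_eqI)
    fix A assume "A \<in> sets (distr (P \<Otimes>\<^sub>M Q) Q snd)"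
    then have A: "A \<in> sets Q" by simp
    then have "snd -` A \<inter> space (P \<Otimes>\<^sub>M Q) = space P \<times> A"
      by (auto simp: space_pair_measure dest: sets.sets_into_space)
    with A show "emeasure (distr (P \<Otimes>\<^sub>M Q) Q snd) A = emeasure Q A"
      by (simp add: emeasure_distr Q.emeasure_pair_measure_Times P.emeasure_space_1)
  qed simp
  then show ?thesis unfolding couplings_def by (intro CollectI conjI refl Q.distr_pair_fst)
qed

text \<open>The dual problem at one time, parameter and state-action pair: \<open>Q\<close> is the
  nominal law and \<open>v\<close> the continuation value. The multiplier is maximal over the whole
  half-line, so it may be perturbed upwards always and downwards whenever it is positive.\<close>

locale wasserstein_dual =
  fixes S :: "'x::euclidean_space set" and Q :: "'x measure" and v :: "'x \<Rightarrow> real"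
    and q :: nat and eps :: real and lam :: real and ystar :: "'x \<Rightarrow> 'x"
  assumes S: "compact S" "S \<noteq> {}" and Q: "Q \<in> probs_on S" and v: "continuous_on S v"
    and q: "q \<ge> 1" and eps: "eps > 0"
    and lam: "is_arg_max (\<lambda>l. (\<integral>x'. (INF y\<in>S. v y + l * norm (x' - y) ^ q) \<partial>Q) - eps ^ q * l)
      (\<lambda>l. l \<in> {0..}) lam"
    and argmin: "\<And>x'. x' \<in> S \<Longrightarrow>
      {y. is_arg_min (\<lambda>y. v y + lam * norm (x' - y) ^ q) (\<lambda>y. y \<in> S) y} = {ystar x'}"
begin

text \<open>The c-transform of \<open>v\<close> for the cost \<open>l * norm (x' - y) ^ q\<close>;
  for \<open>q = 2\<close> a Moreau envelope.\<close>

definition env :: "real \<Rightarrow> 'x \<Rightarrow> real" where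
  "env l x' = (INF y\<in>S. v y + l * norm (x' - y) ^ q)"

definition dual :: "real \<Rightarrow> real" where
  "dual l = (\<integral>x'. env l x' \<partial>Q) - eps ^ q * l"

definition wball :: "'x measure set" where
  "wball = {P \<in> probs_on S. wasserstein q P Q \<le> eps}"

text \<open>The slack in the dual constraint at the optimal multiplier. It is nonnegative, and by
  uniqueness it vanishes for \<open>x'\<close> in \<open>S\<close> exactly at
  \<open>y = ystar x'\<close>.\<close>

definition excess :: "'x \<Rightarrow> 'x \<Rightarrow> real" where
  "excess x' y = v y + lam * norm (x' - y) ^ q - env lam x'"

definition worst :: "'x measure" where
  "worst = distr Q (restrict_space borel S) ystar"

lemma lam_nonneg: "lam \<ge> 0" and dual_le: "l \<ge> 0 \<Longrightarrow> dual l \<le> dual lam"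
  using lam unfolding is_arg_max_linorder dual_def env_def by auto

lemma continuous_on_penalty:
  "continuous_on (S \<times> S) (\<lambda>p. v (snd p) + l * norm (fst p - snd p) ^ q)"
  by (intro continuous_intros continuous_on_compose2[OF v]) auto

lemma continuous_on_penalty': "continuous_on S (\<lambda>y. v y + l * norm (x' - y) ^ q)"
  by (intro continuous_intros v)

lemma continuous_on_env: "continuous_on S (env l)"
  using continuous_on_INF_compact[OF S(1) S continuous_on_penalty] by (simp add: env_def)

lemma env_attained:
  obtains y where "y \<in> S" "env l x' = v y + l * norm (x' - y) ^ q"
    "\<And>z. z \<in> S \<Longrightarrow> env l x' \<le> v z + l * norm (x' - z) ^ q"
proof -
  obtain y where "y \<in> S" "env l x' = v y + l * norm (x' - y) ^ q"
    "\<And>z. z \<in> S \<Longrightarrow> v y + l * norm (x' - y) ^ q \<le> v z + l * norm (x' - z) ^ q"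
    using INF_compact_attained[OF S continuous_on_penalty'[of l x']] unfolding env_def by blast
  with that show ?thesis by simp
qed

lemma env_le: "y \<in> S \<Longrightarrow> env l x' \<le> v y + l * norm (x' - y) ^ q"
  by (rule env_attained[of l x']) blast

lemma ystar:
  assumes "x' \<in> S"
  shows ystar_in: "ystar x' \<in> S" and env_ystar: "env lam x' = v (ystar x') + lam * norm (x' - ystar x') ^ q"
    and ystar_unique: "y \<in> S \<Longrightarrow> v y + lam * norm (x' - y) ^ q \<le> env lam x' \<Longrightarrow> y = ystar x'"
proof -
  have arg: "is_arg_min (\<lambda>y. v y + lam * norm (x' - y) ^ q) (\<lambda>y. y \<in> S) y \<longleftrightarrow> y = ystar x'" for y
    using argmin[OF assms] by blast
  then show *: "ystar x' \<in> S" unfolding is_arg_min_linorder by blast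
  have le: "v (ystar x') + lam * norm (x' - ystar x') ^ q \<le> v y + lam * norm (x' - y) ^ q"
    if "y \<in> S" for y
    using arg[of "ystar x'"] that unfolding is_arg_min_linorder by blast
  show **: "env lam x' = v (ystar x') + lam * norm (x' - ystar x') ^ q"
    by (rule env_attained[of lam x']) (use le env_le[OF *, of lam x'] in force)
  show "y = ystar x'" if "y \<in> S" "v y + lam * norm (x' - y) ^ q \<le> env lam x'"
    unfolding arg[symmetric] is_arg_min_linorder using that ** le by fastforce
qed

lemma continuous_on_ystar: "continuous_on S ystar"
proof (rule continuous_on_argmin[OF S(1) S(1) continuous_on_penalty[of lam]])
  show "ystar u \<in> S" if "u \<in> S" for u using ystar_in[OF that] .
  show "v (snd (u, ystar u)) + lam * norm (fst (u, ystar u) - snd (u, ystar u)) ^ q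
      \<le> v (snd (u, z)) + lam * norm (fst (u, z) - snd (u, z)) ^ q" if "u \<in> S" "z \<in> S" for u z
    using env_ystar[OF that(1)] env_le[OF that(2), of lam u] by simp
  show "z = ystar u" if "u \<in> S" "z \<in> S" "v (snd (u, z)) + lam * norm (fst (u, z) - snd (u, z)) ^ q
      \<le> v (snd (u, ystar u)) + lam * norm (fst (u, ystar u) - snd (u, ystar u)) ^ q" for u z
    using that env_ystar[OF that(1)] by (intro ystar_unique) simp_all
qed

lemma measurable_ystar: "ystar \<in> restrict_space borel S \<rightarrow>\<^sub>M restrict_space borel S"
  by (intro measurable_restrict_space2 borel_measurable_continuous_on_restrict continuous_on_ystar)
     (auto simp: space_restrict_space ystar_in)

lemma continuous_on_excess: "continuous_on (S \<times> S) (\<lambda>p. excess (fst p) (snd p))"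
  unfolding excess_def
  by (intro continuous_intros continuous_on_compose2[OF v] continuous_on_compose2[OF continuous_on_env]) auto

lemma excess_nonneg: "y \<in> S \<Longrightarrow> excess x' y \<ge> 0"
  using env_le[of y lam x'] by (simp add: excess_def)

lemma excess_eq_0: "x' \<in> S \<Longrightarrow> y \<in> S \<Longrightarrow> excess x' y \<le> 0 \<Longrightarrow> y = ystar x'"
  by (rule ystar_unique) (auto simp: excess_def)

text \<open>Since the minimizer is unique, a small excess forces \<open>y\<close> close to \<open>ystar x'\<close>, uniformly in \<open>x'\<close>.\<close>

lemma excess_controls_distance:
  assumes \<phi>: "continuous_on (S \<times> S) \<phi>" and "\<eta> > 0"
  obtains C :: real where "C \<ge> 0"
    "\<And>x' y. x' \<in> S \<Longrightarrow> y \<in> S \<Longrightarrow> \<bar>\<phi> (x', y) - \<phi> (x', ystar x')\<bar> \<le> \<eta> + C * excess x' y"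
proof -
  define d :: "'x \<times> 'x \<Rightarrow> real" where "d p = \<bar>\<phi> p - \<phi> (fst p, ystar (fst p))\<bar>" for p
  have d: "continuous_on (S \<times> S) d"
    unfolding d_def
    by (intro continuous_intros \<phi> continuous_on_compose2[OF \<phi>] continuous_on_compose2[OF continuous_on_ystar])
       (auto simp: ystar_in)
  obtain B where B: "B \<ge> 0" "\<And>p. p \<in> S \<times> S \<Longrightarrow> \<bar>d p\<bar> \<le> B"
    using compact_continuous_bounded[OF compact_Times[OF S(1) S(1)] d] by blast
  \<comment> \<open>The deviation \<open>d\<close> reaches \<eta> only on the compact set
    \<open>E\<close>, where uniqueness forces the excess to have a positive minimum
    \<open>m\<close>. With \<open>B\<close> bounding \<open>d\<close>, the constant is
    \<open>B / m\<close>; if \<open>E\<close> is empty it is 0.\<close>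
  define E where "E = (S \<times> S) \<inter> d -` {\<eta>..}"
  have "closed E"
    unfolding E_def using compact_imp_closed[OF S(1)] d by (intro continuous_closed_preimage closed_Times closed_atLeast) auto
  then have E: "compact E"
    using compact_Int_closed[OF compact_Times[OF S(1) S(1)]] by (metis E_def inf.absorb_iff2 inf_le1)
  have "\<exists>C\<ge>0. \<forall>x'\<in>S. \<forall>y\<in>S. d (x', y) \<le> \<eta> + C * excess x' y"
  proof (cases "E = {}")
    case True
    then show ?thesis
      by (intro exI[of _ 0]) (force simp: E_def not_le[symmetric] intro: less_imp_le)
  next
    case False
    obtain p where p: "p \<in> E" "\<And>p'. p' \<in> E \<Longrightarrow> excess (fst p) (snd p) \<le> excess (fst p') (snd p')"
      using continuous_attains_inf[OF E False continuous_on_subset[OF continuous_on_excess]]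
      unfolding E_def by blast
    define m where "m = excess (fst p) (snd p)"
    have "m > 0"
    proof (rule ccontr)
      assume "\<not> m > 0"
      then have "snd p = ystar (fst p)"
        using p(1) by (intro excess_eq_0) (auto simp: m_def E_def)
      then have "(fst p, ystar (fst p)) = p" by (simp add: prod_eq_iff)
      then have "d p = 0" by (simp add: d_def)
      then show False using p(1) \<open>\<eta> > 0\<close> by (auto simp: E_def)
    qed
    have "d (x', y) \<le> \<eta> + B / m * excess x' y" if xy: "x' \<in> S" "y \<in> S" for x' y
    proof (cases "d (x', y) < \<eta>")
      case True
      have "0 \<le> B / m * excess x' y" using excess_nonneg[OF xy(2)] \<open>m > 0\<close> B by simp
      with True show ?thesis by linarith
    next
      case False
      then have "(x', y) \<in> E" using xy by (simp add: E_def)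
      then have "m \<le> excess x' y" using p(2)[of "(x', y)"] by (simp add: m_def)
      then have "B * m \<le> B * excess x' y" using B(1) by (rule mult_left_mono)
      then have "B \<le> B / m * excess x' y" using \<open>m > 0\<close> by (simp add: field_simps)
      moreover have "d (x', y) \<le> B" using B(2)[of "(x', y)"] xy by auto
      ultimately show ?thesis using \<open>\<eta> > 0\<close> by linarith
    qed
    then show ?thesis using B \<open>m > 0\<close> by (intro exI[of _ "B / m"]) auto
  qed
  then show ?thesis using that unfolding d_def by auto
qed

section \<open>Weak duality and stability of nearly optimal laws\<close>

lemma near_optimal_coupling:
  assumes P: "P \<in> wball" and "\<delta> > 0"
  obtains \<gamma> where "\<gamma> \<in> couplings P Q"
    "(\<integral>p. excess (snd p) (fst p) \<partial>\<gamma>) \<le> (\<integral>y. v y \<partial>P) - dual lam + lam * \<delta>"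
proof -
  have PS: "P \<in> probs_on S" and le: "wasserstein q P Q \<le> eps" using P by (auto simp: wball_def)
  define z where "z = (INF \<gamma>\<in>couplings P Q. \<integral>(x, y). norm (x - y) ^ q \<partial>\<gamma>)"
  have "z \<ge> 0"
    unfolding z_def using couplings_nonempty[OF PS Q]
    by (intro cINF_greatest) (auto intro!: integral_nonneg_AE)
  then have "z = root q z ^ q" using q by (simp add: real_root_pow_pos2)
  also have "\<dots> \<le> eps ^ q"
    using le \<open>z \<ge> 0\<close> q by (intro power_mono) (auto simp: wasserstein_def z_def)
  finally have "z < eps ^ q + \<delta>" using \<open>\<delta> > 0\<close> by simp
  then obtain \<gamma> where \<gamma>: "\<gamma> \<in> couplings P Q" and
    c: "(\<integral>(x, y). norm (x - y) ^ q \<partial>\<gamma>) < eps ^ q + \<delta>"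
    unfolding z_def using couplings_nonempty[OF PS Q] by (auto dest!: cInf_lessD[rotated])
  note int = coupling_integrable[OF \<gamma> PS Q S(1)]
  have "(\<integral>p. excess (snd p) (fst p) \<partial>\<gamma>)
      = (\<integral>p. v (fst p) + lam * norm (fst p - snd p) ^ q - env lam (snd p) \<partial>\<gamma>)"
    by (simp add: excess_def norm_minus_commute)
  also have "\<dots> = (\<integral>p. v (fst p) \<partial>\<gamma>) + lam * (\<integral>p. norm (fst p - snd p) ^ q \<partial>\<gamma>) - (\<integral>p. env lam (snd p) \<partial>\<gamma>)"
  proof -
    have "integrable \<gamma> (\<lambda>p. v (fst p))" "integrable \<gamma> (\<lambda>p. norm (fst p - snd p) ^ q)"
      "integrable \<gamma> (\<lambda>p. env lam (snd p))"
      by (intro int continuous_intros continuous_on_compose2[OF v] continuous_on_compose2[OF continuous_on_env]; auto)+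
    then show ?thesis by simp
  qed
  also have "\<dots> \<le> (\<integral>y. v y \<partial>P) + lam * (eps ^ q + \<delta>) - (dual lam + eps ^ q * lam)"
    using mult_left_mono[OF less_imp_le[OF c] lam_nonneg]
      coupling_integral(4)[OF \<gamma> PS Q borel_measurable_continuous_on_restrict[OF v]]
      coupling_integral(5)[OF \<gamma> PS Q borel_measurable_continuous_on_restrict[OF continuous_on_env[of lam]]]
    by (simp add: dual_def split_beta')
  finally show ?thesis using that[OF \<gamma>] by (simp add: algebra_simps)
qed

text \<open>The excess is nonnegative, so the bound of \<open>near_optimal_coupling\<close> already
  contains the inequality once the slack \<delta> is sent to 0.\<close>

lemma weak_duality:
  assumes P: "P \<in> wball"
  shows "dual lam \<le> (\<integral>y. v y \<partial>P)"
proof (rule field_le_epsilon)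
  fix e :: real assume "e > 0"
  \<comment> \<open>The slack is chosen so that \<open>lam\<close> times it is at most
    \<open>e\<close>; the summand 1 covers \<open>lam = 0\<close>.\<close>
  then have "e / (lam + 1) > 0" using lam_nonneg by simp
  then obtain \<gamma> where \<gamma>: "\<gamma> \<in> couplings P Q"
    and le: "(\<integral>p. excess (snd p) (fst p) \<partial>\<gamma>) \<le> (\<integral>y. v y \<partial>P) - dual lam + lam * (e / (lam + 1))"
    using near_optimal_coupling[OF P] by blast
  have "space \<gamma> = S \<times> S" using coupling_integral(2)[OF \<gamma> _ Q] P by (auto simp: wball_def)
  then have "0 \<le> (\<integral>p. excess (snd p) (fst p) \<partial>\<gamma>)"
    by (intro Bochner_Integration.integral_nonneg) (auto intro: excess_nonneg)
  moreover have "lam * (e / (lam + 1)) \<le> e" using lam_nonneg \<open>e > 0\<close> by (simp add: field_simps)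
  ultimately show "dual lam \<le> (\<integral>y. v y \<partial>P) + e" using le by linarith
qed

text \<open>\<open>excess_controls_distance\<close> is integrated against a nearly optimal coupling,
  whose total excess is at most the primal optimality gap of \<open>P\<close> plus a slack. The
  constant depends on the test function and on \<eta>, but not on \<open>P\<close>; a law with small
  gap therefore integrates \<phi> almost like the push-forward of \<open>Q\<close> under
  \<open>ystar\<close>.\<close>

lemma stability:
  assumes \<phi>: "continuous_on S \<phi>" and "\<eta> > 0"
  obtains C :: real where "C \<ge> 0" "\<And>P. P \<in> wball \<Longrightarrow>
    \<bar>(\<integral>y. \<phi> y \<partial>P) - (\<integral>x'. \<phi> (ystar x') \<partial>Q)\<bar> \<le> \<eta> + C * ((\<integral>y. v y \<partial>P) - dual lam)"
proof -
  have "continuous_on (S \<times> S) (\<lambda>p. \<phi> (snd p))"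
    by (intro continuous_on_compose2[OF \<phi>] continuous_intros) auto
  then obtain C where C: "C \<ge> 0"
    "\<And>x' y. x' \<in> S \<Longrightarrow> y \<in> S \<Longrightarrow> \<bar>\<phi> y - \<phi> (ystar x')\<bar> \<le> \<eta> + C * excess x' y"
    using excess_controls_distance[OF _ \<open>\<eta> > 0\<close>, of "\<lambda>p. \<phi> (snd p)"] by auto
  have \<phi>y: "continuous_on S (\<lambda>x'. \<phi> (ystar x'))"
    by (intro continuous_on_compose2[OF \<phi>] continuous_on_ystar) (auto simp: ystar_in)
  show ?thesis
  proof (rule that[OF C(1)])
    fix P assume P: "P \<in> wball"
    then have PS: "P \<in> probs_on S" by (auto simp: wball_def)
    show "\<bar>(\<integral>y. \<phi> y \<partial>P) - (\<integral>x'. \<phi> (ystar x') \<partial>Q)\<bar> \<le> \<eta> + C * ((\<integral>y. v y \<partial>P) - dual lam)"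
    proof (rule field_le_epsilon)
      fix e :: real assume "e > 0"
      \<comment> \<open>The coupling slack \<open>e / (C * lam + 1)\<close> is what keeps its
        contribution, multiplied by \<open>C * lam\<close>, below \<open>e\<close>.\<close>
      have pos: "C * lam + 1 > 0" using C(1) lam_nonneg by (simp add: add_nonneg_pos)
      then obtain \<gamma> where \<gamma>: "\<gamma> \<in> couplings P Q"
        and le: "(\<integral>p. excess (snd p) (fst p) \<partial>\<gamma>) \<le> (\<integral>y. v y \<partial>P) - dual lam + lam * (e / (C * lam + 1))"
        using near_optimal_coupling[OF P, of "e / (C * lam + 1)"] \<open>e > 0\<close> by auto
      note sp = coupling_integral[OF \<gamma> PS Q] and int = coupling_integrable[OF \<gamma> PS Q S(1)]
      interpret prob_space \<gamma> by (rule sp)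
      have i1: "integrable \<gamma> (\<lambda>p. \<phi> (fst p) - \<phi> (ystar (snd p)))"
        by (intro int continuous_intros continuous_on_compose2[OF \<phi>] continuous_on_compose2[OF \<phi>y]) auto
      have i2: "integrable \<gamma> (\<lambda>p. excess (snd p) (fst p))"
        by (intro int continuous_on_compose2[OF continuous_on_excess, where f = prod.swap, simplified]
              continuous_on_swap) auto
      have "(\<integral>y. \<phi> y \<partial>P) - (\<integral>x'. \<phi> (ystar x') \<partial>Q) = (\<integral>p. \<phi> (fst p) - \<phi> (ystar (snd p)) \<partial>\<gamma>)"
      proof -
        have "integrable \<gamma> (\<lambda>p. \<phi> (fst p))" "integrable \<gamma> (\<lambda>p. \<phi> (ystar (snd p)))"
          by (intro int continuous_on_compose2[OF \<phi>] continuous_on_compose2[OF \<phi>y] continuous_intros; auto)+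
        then show ?thesis
          using sp(4)[OF borel_measurable_continuous_on_restrict[OF \<phi>]]
            sp(5)[OF borel_measurable_continuous_on_restrict[OF \<phi>y]] by simp
      qed
      then have "\<bar>(\<integral>y. \<phi> y \<partial>P) - (\<integral>x'. \<phi> (ystar x') \<partial>Q)\<bar> \<le> (\<integral>p. \<bar>\<phi> (fst p) - \<phi> (ystar (snd p))\<bar> \<partial>\<gamma>)"
        by (simp add: integral_abs_bound)
      also have "\<dots> \<le> (\<integral>p. \<eta> + C * excess (snd p) (fst p) \<partial>\<gamma>)"
        using i1 i2 sp(2) C(2) by (intro integral_mono) auto
      also have "\<dots> = \<eta> + C * (\<integral>p. excess (snd p) (fst p) \<partial>\<gamma>)"
        using i2 by (simp add: prob_space)
      also have "\<dots> \<le> \<eta> + C * ((\<integral>y. v y \<partial>P) - dual lam + lam * (e / (C * lam + 1)))"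
        using le C(1) by (intro add_left_mono mult_left_mono)
      also have "\<dots> \<le> \<eta> + C * ((\<integral>y. v y \<partial>P) - dual lam) + e"
      proof -
        have "C * (lam * (e / (C * lam + 1))) \<le> e" using pos \<open>e > 0\<close> by (simp add: field_simps)
        then show ?thesis by (simp add: distrib_left)
      qed
      finally show "\<bar>(\<integral>y. \<phi> y \<partial>P) - (\<integral>x'. \<phi> (ystar x') \<partial>Q)\<bar>
          \<le> \<eta> + C * ((\<integral>y. v y \<partial>P) - dual lam) + e" .
    qed
  qed
qed

section \<open>First-order condition and absence of a duality gap\<close>

lemma integrable_cost_ystar: "integrable Q (\<lambda>x'. norm (x' - ystar x') ^ q)"
  by (rule integrable_continuous_probs_on[OF S(1) Q])
     (intro continuous_on_power continuous_on_norm continuous_on_diff continuous_on_id continuous_on_ystar)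

text \<open>Envelope theorem for \<open>dual\<close> at its maximizer: the transport cost of \<open>ystar\<close> is the derivative
  of the integrated envelope, uniformly in \<open>x'\<close>.\<close>

lemma cost_optimality:
  "(\<integral>x'. norm (x' - ystar x') ^ q \<partial>Q) \<le> eps ^ q"
  "lam * ((\<integral>x'. norm (x' - ystar x') ^ q \<partial>Q) - eps ^ q) = 0"
proof -
  let ?c = "\<integral>x'. norm (x' - ystar x') ^ q \<partial>Q"
  interpret Q: prob_space Q by (rule probs_onD(1)[OF Q])
  have cont: "continuous_on (S \<times> S) (\<lambda>p. norm (fst p - snd p) ^ q)"
    by (intro continuous_intros)
  obtain B where B: "B \<ge> 0" and *: "\<And>p. p \<in> S \<times> S \<Longrightarrow> \<bar>norm (fst p - snd p) ^ q\<bar> \<le> B"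
    using compact_continuous_bounded[OF compact_Times[OF S(1) S(1)] cont] by blast
  have cost_le: "norm (x' - y) ^ q \<le> B" if "x' \<in> S" "y \<in> S" for x' y
    using *[of "(x', y)"] that by simp
  \<comment> \<open>First-order expansion of \<open>dual\<close> at \<open>lam\<close> with
    perturbation \<open>s\<close> of either sign: \<eta> is arbitrary and
    \<open>A * \<bar>s\<bar>\<close> is small, so the right-hand side is of lower order than
    \<open>s\<close>.\<close>
  have key: "\<exists>A\<ge>0. \<forall>s. lam + s \<ge> 0 \<longrightarrow> s * (?c - eps ^ q) \<le> \<bar>s\<bar> * (\<eta> + A * \<bar>s\<bar>)"
    if "\<eta> > 0" for \<eta>
  proof -
    obtain C where C: "C \<ge> 0" "\<And>x' y. x' \<in> S \<Longrightarrow> y \<in> S \<Longrightarrow>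
        \<bar>norm (x' - y) ^ q - norm (x' - ystar x') ^ q\<bar> \<le> \<eta> + C * excess x' y"
      using excess_controls_distance[OF cont \<open>\<eta> > 0\<close>] by auto
    have "s * (?c - eps ^ q) \<le> \<bar>s\<bar> * (\<eta> + C * B * \<bar>s\<bar>)" if s: "lam + s \<ge> 0" for s
    proof -
      let ?R = "\<bar>s\<bar> * (\<eta> + C * B * \<bar>s\<bar>)"
      \<comment> \<open>Take the minimizer \<open>y\<close> for the perturbed multiplier. Because
        \<open>ystar x'\<close> competes with it, the excess of \<open>y\<close> at
        \<open>lam\<close> is at most \<open>B\<close> times the size of \<open>s\<close>. The
        modulus then says that the costs of \<open>y\<close> and \<open>ystar x'\<close> differ by
        at most \<open>\<eta> + C * B * \<bar>s\<bar>\<close>, so exchanging the one for the other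
        changes the linear term by at most \<open>?R\<close>.\<close>
      have "env lam x' + s * norm (x' - ystar x') ^ q - ?R \<le> env (lam + s) x'" if x': "x' \<in> S" for x'
      proof -
        obtain y where y: "y \<in> S" "env (lam + s) x' = v y + (lam + s) * norm (x' - y) ^ q"
          using env_attained by blast
        note ys = ystar_in[OF x'] env_ystar[OF x']
        let ?a = "norm (x' - y) ^ q" and ?b = "norm (x' - ystar x') ^ q"
        have "excess x' y = env (lam + s) x' - env lam x' - s * ?a"
          using y by (simp add: excess_def algebra_simps)
        also have "\<dots> \<le> s * (?b - ?a)"
          using env_le[OF ys(1), of "lam + s" x'] ys(2) by (simp add: algebra_simps)
        also have "\<dots> \<le> \<bar>s\<bar> * \<bar>?b - ?a\<bar>" by (metis abs_ge_self abs_mult)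
        also have "\<dots> \<le> \<bar>s\<bar> * B"
        proof (rule mult_left_mono)
          have "0 \<le> ?a" "0 \<le> ?b" "?a \<le> B" "?b \<le> B" using cost_le x' y ys by auto
          then show "\<bar>?b - ?a\<bar> \<le> B" by linarith
        qed simp
        finally have "C * excess x' y \<le> C * (\<bar>s\<bar> * B)" using C(1) by (rule mult_left_mono)
        with C(2)[OF x' y(1)] have "\<bar>?b - ?a\<bar> \<le> \<eta> + C * B * \<bar>s\<bar>" by (simp add: mult_ac abs_minus_commute)
        then have "\<bar>s\<bar> * \<bar>?b - ?a\<bar> \<le> ?R" by (intro mult_left_mono) auto
        then have "s * (?b - ?a) \<le> ?R" by (metis abs_ge_self abs_mult order_trans)
        moreover have "env lam x' \<le> v y + lam * ?a" using env_le[OF y(1)] .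
        ultimately show ?thesis using y(2) by (simp add: algebra_simps)
      qed
      then have "(\<integral>x'. env lam x' + s * norm (x' - ystar x') ^ q - ?R \<partial>Q) \<le> (\<integral>x'. env (lam + s) x' \<partial>Q)"
        using probs_onD[OF Q] integrable_cost_ystar integrable_continuous_probs_on[OF S(1) Q continuous_on_env]
        by (intro integral_mono) auto
      then have "(\<integral>x'. env lam x' \<partial>Q) + s * ?c - ?R \<le> (\<integral>x'. env (lam + s) x' \<partial>Q)"
        using integrable_cost_ystar integrable_continuous_probs_on[OF S(1) Q continuous_on_env]
        by (simp add: Q.prob_space)
      with dual_le[OF s] show ?thesis by (simp add: dual_def algebra_simps)
    qed
    then show ?thesis using C(1) B by (intro exI[of _ "C * B"]) auto
  qed
  \<comment> \<open>\<sigma> is the direction of the perturbation. Moving down is admissible only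
    for a positive multiplier, which is why one gets an inequality in general and equality when
    \<open>lam > 0\<close>.\<close>
  have le: "\<sigma> * (?c - eps ^ q) \<le> 0" if \<sigma>: "\<bar>\<sigma>\<bar> = 1" "\<sigma> < 0 \<Longrightarrow> lam > 0" for \<sigma>
  proof (rule field_le_epsilon)
    fix e :: real assume "e > 0"
    then obtain A where A: "A \<ge> 0"
      "\<And>s. lam + s \<ge> 0 \<Longrightarrow> s * (?c - eps ^ q) \<le> \<bar>s\<bar> * (e / 2 + A * \<bar>s\<bar>)"
      using key[of "e / 2"] by auto
    \<comment> \<open>The step size makes \<open>A * t\<close> at most \<open>e / 2\<close>; in the
      downward direction it is also capped by \<open>lam\<close> so that the perturbed multiplier
      stays nonnegative.\<close>
    define t where "t = (if \<sigma> < 0 then min lam (e / (2 * (A + 1))) else e / (2 * (A + 1)))"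
    have t: "t > 0" "t \<le> e / (2 * (A + 1))" "\<sigma> < 0 \<Longrightarrow> t \<le> lam"
      using \<sigma> A(1) \<open>e > 0\<close> by (auto simp: t_def)
    have "lam + t * \<sigma> \<ge> 0"
      using t \<sigma>(1) lam_nonneg by (cases "\<sigma> < 0") (auto simp: abs_if)
    from A(2)[OF this] have "t * (\<sigma> * (?c - eps ^ q)) \<le> t * (e / 2 + A * t)"
      using t(1) \<sigma>(1) by (simp add: abs_mult mult_ac)
    then have "\<sigma> * (?c - eps ^ q) \<le> e / 2 + A * t" using t(1) by simp
    also have "A * t \<le> A * (e / (2 * (A + 1)))" using t(2) A(1) by (rule mult_left_mono)
    also have "\<dots> \<le> e / 2" using A(1) \<open>e > 0\<close> by (simp add: field_simps)
    finally show "\<sigma> * (?c - eps ^ q) \<le> 0 + e" by simp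
  qed
  show 1: "?c \<le> eps ^ q" using le[of 1] by simp
  show "lam * (?c - eps ^ q) = 0" using le[of "-1"] 1 lam_nonneg by (cases "lam > 0") auto
qed

lemma integral_worst:
  fixes h :: "'x \<Rightarrow> real"
  assumes "h \<in> borel_measurable (restrict_space borel S)"
  shows "(\<integral>y. h y \<partial>worst) = (\<integral>x'. h (ystar x') \<partial>Q)"
  unfolding worst_def
  by (rule integral_distr) (use assms measurable_ystar probs_onD[OF Q] in \<open>auto cong: measurable_cong_sets\<close>)

text \<open>The deterministic coupling \<open>(ystar x', x')\<close> witnesses membership: by the
  first-order condition its cost is at most \<open>eps ^ q\<close>.\<close>

lemma worst_in_wball: "worst \<in> wball"
proof -
  interpret Q: prob_space Q by (rule probs_onD(1)[OF Q])
  let ?R = "restrict_space borel S"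
  note [measurable] = measurable_ystar
  have [measurable_cong]: "sets Q = sets ?R" using probs_onD[OF Q] by simp
  have worst: "worst \<in> probs_on S"
    unfolding worst_def probs_on_def space_prob_algebra by (auto intro!: Q.prob_space_distr)
  define \<gamma> where "\<gamma> = distr Q (?R \<Otimes>\<^sub>M ?R) (\<lambda>x'. (ystar x', x'))"
  have cong: "sets worst = sets ?R" by (simp add: worst_def)
  have "distr \<gamma> worst fst = worst"
    unfolding \<gamma>_def by (subst distr_distr) (auto simp: worst_def comp_def intro!: distr_cong)
  moreover have "distr \<gamma> Q snd = Q"
    unfolding \<gamma>_def by (subst distr_distr) (auto simp: comp_def intro!: distr_id2)
  moreover have "sets \<gamma> = sets (worst \<Otimes>\<^sub>M Q)"
    unfolding \<gamma>_def using sets_pair_measure_cong[OF cong probs_onD(2)[OF Q]] by simp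
  ultimately have \<gamma>: "\<gamma> \<in> couplings worst Q" by (simp add: couplings_def)
  have "(\<integral>(x, y). norm (x - y) ^ q \<partial>\<gamma>) = (\<integral>x'. norm (x' - ystar x') ^ q \<partial>Q)"
    unfolding \<gamma>_def split_beta'
    by (subst integral_distr) (auto simp: norm_minus_commute)
  then have "(INF \<gamma>\<in>couplings worst Q. \<integral>(x, y). norm (x - y) ^ q \<partial>\<gamma>) \<le> eps ^ q"
    using cost_optimality(1)
    by (intro cINF_lower2[OF _ \<gamma>]) (auto intro!: bdd_belowI[of _ 0] integral_nonneg_AE)
  then have "wasserstein q worst Q \<le> root q (eps ^ q)"
    unfolding wasserstein_def using q by simp
  also have "\<dots> = eps" using q eps by (simp add: real_root_power_cancel)
  finally show ?thesis using worst by (simp add: wball_def)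
qed

text \<open>Complementary slackness, the second part of \<open>cost_optimality\<close>, replaces the
  transport cost by \<open>eps ^ q\<close> in the term carrying \<open>lam\<close>. With
  \<open>weak_duality\<close> and \<open>worst_in_wball\<close> this closes the duality gap.\<close>

lemma integral_v_worst: "(\<integral>y. v y \<partial>worst) = dual lam"
proof -
  have "(\<integral>y. v y \<partial>worst) = (\<integral>x'. v (ystar x') \<partial>Q)"
    by (rule integral_worst[OF borel_measurable_continuous_on_restrict[OF v]])
  also have "\<dots> = (\<integral>x'. env lam x' - lam * norm (x' - ystar x') ^ q \<partial>Q)"
    using probs_onD[OF Q] env_ystar by (intro Bochner_Integration.integral_cong) auto
  also have "\<dots> = (\<integral>x'. env lam x' \<partial>Q) - lam * (\<integral>x'. norm (x' - ystar x') ^ q \<partial>Q)"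
    using integrable_cost_ystar integrable_continuous_probs_on[OF S(1) Q continuous_on_env] by simp
  also have "\<dots> = dual lam"
    using cost_optimality(2) by (auto simp: dual_def)
  finally show ?thesis .
qed

end

section \<open>Path laws\<close>

lemma prob_algebraD:
  assumes "P \<in> space (prob_algebra M)"
  shows "prob_space P" "sets P = sets M" "space P = space M"
  using assms sets_eq_imp_space_eq[of P M] by (auto simp: space_prob_algebra)

lemma integrable_bounded_prob_algebra:
  fixes f :: "'b \<Rightarrow> real"
  assumes P: "P \<in> space (prob_algebra M)" and f: "f \<in> borel_measurable M"
    and B: "\<And>x. x \<in> space M \<Longrightarrow> \<bar>f x\<bar> \<le> B"
  shows "integrable P f" and "\<bar>\<integral>x. f x \<partial>P\<bar> \<le> B"
proof -
  note P = prob_algebraD[OF P]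
  interpret prob_space P by (rule P)
  have [measurable]: "f \<in> borel_measurable P" using f P(2) by (simp cong: measurable_cong_sets)
  show int: "integrable P f"
    by (rule integrable_const_bound[where B = B]) (use P(3) B in auto)
  have "\<bar>\<integral>x. f x \<partial>P\<bar> \<le> (\<integral>x. \<bar>f x\<bar> \<partial>P)" by (rule integral_abs_bound)
  also have "\<dots> \<le> B" by (rule integral_le_const) (use int P(3) B in auto)
  finally show "\<bar>\<integral>x. f x \<partial>P\<bar> \<le> B" .
qed

lemma integral_bind_prob_algebra:
  fixes f :: "'c \<Rightarrow> real"
  assumes P: "P \<in> space (prob_algebra M)" and N: "N \<in> M \<rightarrow>\<^sub>M prob_algebra K"
    and f: "f \<in> borel_measurable K" "\<And>x. x \<in> space K \<Longrightarrow> \<bar>f x\<bar> \<le> B"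
  shows "(\<integral>x. f x \<partial>(P \<bind> N)) = (\<integral>x. (\<integral>y. f y \<partial>N x) \<partial>P)"
proof (rule integral_bind[where B' = 1, OF f])
  note P = prob_algebraD[OF P]
  interpret prob_space P by (rule P)
  show "N \<in> P \<rightarrow>\<^sub>M subprob_algebra K"
    using measurable_prob_algebraD[OF N] P(2) by (simp cong: measurable_cong_sets)
  show "finite_measure P" by unfold_locales
  show "AE x in P. emeasure (N x) (space (N x)) \<le> ennreal 1"
  proof (rule AE_I2)
    fix x assume "x \<in> space P"
    then have "prob_space (N x)" using measurable_space[OF N] P(3) by (auto simp: space_prob_algebra)
    then show "emeasure (N x) (space (N x)) \<le> ennreal 1" by (simp add: prob_space.emeasure_space_1)
  qed
qed

text \<open>Pushing \<open>K x\<close> forward to the law of the pair \<open>(x, y)\<close> removes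
  the outer dependence of the integrand, leaving the integral of one fixed function against a
  kernel.\<close>

lemma measurable_integral_kernel:
  fixes h :: "'b \<times> 'c \<Rightarrow> real"
  assumes K: "K \<in> M \<rightarrow>\<^sub>M prob_algebra N" and h: "h \<in> borel_measurable (M \<Otimes>\<^sub>M N)"
  shows "(\<lambda>x. \<integral>y. h (x, y) \<partial>K x) \<in> borel_measurable M"
proof -
  have "(\<lambda>x. distr (K x) (M \<Otimes>\<^sub>M N) (\<lambda>y. (x, y))) \<in> M \<rightarrow>\<^sub>M prob_algebra (M \<Otimes>\<^sub>M N)"
    by (rule measurable_distr_prob_space2[OF K]) simp
  from measurable_compose[OF measurable_prob_algebraD[OF this] integral_measurable_subprob_algebra[OF h]]
  have "(\<lambda>x. \<integral>p. h p \<partial>distr (K x) (M \<Otimes>\<^sub>M N) (\<lambda>y. (x, y))) \<in> borel_measurable M" .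
  then show ?thesis
  proof (rule measurable_cong[THEN iffD1, rotated])
    fix x assume x: "x \<in> space M"
    have "sets (K x) = sets N" using measurable_space[OF K x] by (simp add: space_prob_algebra)
    then have "(\<lambda>y. (x, y)) \<in> K x \<rightarrow>\<^sub>M M \<Otimes>\<^sub>M N" using x by (simp cong: measurable_cong_sets)
    then show "(\<integral>p. h p \<partial>distr (K x) (M \<Otimes>\<^sub>M N) (\<lambda>y. (x, y))) = (\<integral>y. h (x, y) \<partial>K x)"
      by (rule integral_distr) (rule h)
  qed
qed

section \<open>One-step decomposition of path functionals\<close>

definition path_update :: "nat \<Rightarrow> 'x \<Rightarrow> 'a \<Rightarrow> (nat \<Rightarrow> 'x) \<times> (nat \<Rightarrow> 'a) \<Rightarrow> (nat \<Rightarrow> 'x) \<times> (nat \<Rightarrow> 'a)" where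
  "path_update t x a p = ((fst p)(t := x), (snd p)(t := a))"

definition path_return ::
    "(nat \<Rightarrow> 'x \<Rightarrow> 'a \<Rightarrow> 'x \<Rightarrow> real) \<Rightarrow> ('x \<Rightarrow> real) \<Rightarrow> nat \<Rightarrow> nat \<Rightarrow> (nat \<Rightarrow> 'x) \<times> (nat \<Rightarrow> 'a) \<Rightarrow> real" where
  "path_return f g n t p =
     (\<Sum>l=t..<t + n. f l (fst p l) (snd p l) (fst p (Suc l))) + g (fst p (t + n))"

text \<open>Generic in the running and terminal rewards because it is used twice: with the rewards
  of the model for dynamic programming, and with directional gradient terms and terminal reward 0
  for the policy gradient.\<close>

definition expected_return ::
    "'x measure \<Rightarrow> 'a measure \<Rightarrow> (nat \<Rightarrow> 'x \<Rightarrow> 'a measure) \<Rightarrow> (nat \<Rightarrow> 'x \<times> 'a \<Rightarrow> 'x measure) \<Rightarrow>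
     (nat \<Rightarrow> 'x \<Rightarrow> 'a \<Rightarrow> 'x \<Rightarrow> real) \<Rightarrow> ('x \<Rightarrow> real) \<Rightarrow> nat \<Rightarrow> nat \<Rightarrow> 'x \<Rightarrow> real" where
  "expected_return MX MA \<pi> K f g n t x = (\<integral>p. path_return f g n t p \<partial>path_law MX MA \<pi> K n t x)"

text \<open>Allows a kernel to be replaced at time \<open>t\<close> while keeping the laws started
  at \<open>Suc t\<close>, as needed when an optimal first step is pasted in front of an optimal
  continuation.\<close>

lemma path_law_cong:
  assumes "\<And>l. l \<in> {t..<t + n} \<Longrightarrow> K l = K' l"
  shows "path_law MX MA \<pi> K n t x = path_law MX MA \<pi> K' n t x"
  using assms
proof (induction n arbitrary: t x)
  case (Suc n)
  have "path_law MX MA \<pi> K n (Suc t) = path_law MX MA \<pi> K' n (Suc t)"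
    using Suc by (intro ext Suc.IH) auto
  moreover have "K t = K' t" using Suc.prems by simp
  ultimately show ?case by simp
qed simp

lemma path_return_update:
  "path_return f g (Suc n) t (path_update t x a p)
     = f t x a (fst p (Suc t)) + path_return f g n (Suc t) p"
proof -
  have "(\<Sum>l=t..<t + Suc n. f l (fst (path_update t x a p) l) (snd (path_update t x a p) l)
          (fst (path_update t x a p) (Suc l)))
      = f t x a (fst p (Suc t)) + (\<Sum>l=Suc t..<t + Suc n. f l (fst p l) (snd p l) (fst p (Suc l)))"
    by (subst sum.atLeast_Suc_lessThan) (auto simp: path_update_def intro!: sum.cong)
  then show ?thesis by (simp add: path_return_def path_update_def)
qed

text \<open>The time window reflects that admissible kernels are only constrained from their starting time on.\<close>

locale path_kernels =
  fixes MX :: "'x measure" and MA :: "'a measure"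
    and \<pi> :: "nat \<Rightarrow> 'x \<Rightarrow> 'a measure" and K :: "nat \<Rightarrow> 'x \<times> 'a \<Rightarrow> 'x measure" and t0 T :: nat
  assumes \<pi>: "\<And>t. t0 \<le> t \<Longrightarrow> t < T \<Longrightarrow> \<pi> t \<in> MX \<rightarrow>\<^sub>M prob_algebra MA"
    and K: "\<And>t. t0 \<le> t \<Longrightarrow> t < T \<Longrightarrow> K t \<in> MX \<Otimes>\<^sub>M MA \<rightarrow>\<^sub>M prob_algebra MX"
begin

abbreviation "law \<equiv> path_law MX MA \<pi> K"
abbreviation "paths \<equiv> path_space MX MA"

lemma measurable_path_update:
  assumes "f \<in> N \<rightarrow>\<^sub>M MX" "g \<in> N \<rightarrow>\<^sub>M MA" "h \<in> N \<rightarrow>\<^sub>M paths (Suc t) n"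
  shows "(\<lambda>z. path_update t (f z) (g z) (h z)) \<in> N \<rightarrow>\<^sub>M paths t (Suc n)"
proof -
  have I: "{t..t + Suc n} = {Suc t..Suc t + n} \<union> {t}" "{t..<t + Suc n} = {Suc t..<Suc t + n} \<union> {t}"
    by auto
  show ?thesis
    unfolding path_update_def path_space_def
    by (intro measurable_Pair measurable_fun_upd[OF I(1)] measurable_fun_upd[OF I(2)] assms(1,2)
          measurable_compose[OF assms(3)[unfolded path_space_def] measurable_fst]
          measurable_compose[OF assms(3)[unfolded path_space_def] measurable_snd])
qed

lemma law_Suc:
  "law (Suc n) t x = \<pi> t x \<bind> (\<lambda>a. K t (x, a) \<bind> (\<lambda>y.
     distr (law n (Suc t) y) (paths t (Suc n)) (path_update t x a)))"
  by (simp add: path_update_def split_beta' cong: distr_cong)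

text \<open>The two nested kernels of one recursion step. They are recorded separately because both
  the measurability and the integral of the law peel off one \<open>bind\<close> at a time.\<close>

lemma measurable_law_step:
  assumes n: "t0 \<le> t" "t < T" and IH: "law n (Suc t) \<in> MX \<rightarrow>\<^sub>M prob_algebra (paths (Suc t) n)"
  shows "(\<lambda>(p, y). distr (law n (Suc t) y) (paths t (Suc n)) (path_update t (fst p) (snd p)))
      \<in> (MX \<Otimes>\<^sub>M MA) \<Otimes>\<^sub>M MX \<rightarrow>\<^sub>M prob_algebra (paths t (Suc n))"
    and "(\<lambda>(x, a). K t (x, a) \<bind> (\<lambda>y. distr (law n (Suc t) y) (paths t (Suc n)) (path_update t x a)))
      \<in> MX \<Otimes>\<^sub>M MA \<rightarrow>\<^sub>M prob_algebra (paths t (Suc n))"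
proof -
  show 1: "(\<lambda>(p, y). distr (law n (Suc t) y) (paths t (Suc n)) (path_update t (fst p) (snd p)))
      \<in> (MX \<Otimes>\<^sub>M MA) \<Otimes>\<^sub>M MX \<rightarrow>\<^sub>M prob_algebra (paths t (Suc n))"
    unfolding split_beta'
  proof (rule measurable_distr_prob_space2)
    show "(\<lambda>q. law n (Suc t) (snd q)) \<in> (MX \<Otimes>\<^sub>M MA) \<Otimes>\<^sub>M MX \<rightarrow>\<^sub>M prob_algebra (paths (Suc t) n)"
      by (rule measurable_compose[OF measurable_snd IH])
    show "(\<lambda>(q, w). path_update t (fst (fst q)) (snd (fst q)) w)
        \<in> ((MX \<Otimes>\<^sub>M MA) \<Otimes>\<^sub>M MX) \<Otimes>\<^sub>M paths (Suc t) n \<rightarrow>\<^sub>M paths t (Suc n)"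
      unfolding split_beta' by (intro measurable_path_update) auto
  qed
  show "(\<lambda>(x, a). K t (x, a) \<bind> (\<lambda>y. distr (law n (Suc t) y) (paths t (Suc n)) (path_update t x a)))
      \<in> MX \<Otimes>\<^sub>M MA \<rightarrow>\<^sub>M prob_algebra (paths t (Suc n))"
    using measurable_bind_prob_space2[OF K[OF n] 1] by (simp add: split_beta')
qed

lemma measurable_law:
  assumes "t0 \<le> t" "t + n \<le> T"
  shows "law n t \<in> MX \<rightarrow>\<^sub>M prob_algebra (paths t n)"
  using assms
proof (induction n arbitrary: t)
  case 0
  \<comment> \<open>With no steps left the action component lives in an empty product, whose only
    point is the function constantly \<open>undefined\<close>.\<close>
  have "(\<lambda>x. (\<lambda>i\<in>{t}. x, \<lambda>i. undefined)) \<in> MX \<rightarrow>\<^sub>M paths t 0"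
    unfolding path_space_def
    by (intro measurable_Pair measurable_restrict measurable_const) (auto simp: space_PiM)
  from measurable_compose[OF this measurable_return_prob_space] show ?case by simp
next
  case (Suc n)
  have IH: "law n (Suc t) \<in> MX \<rightarrow>\<^sub>M prob_algebra (paths (Suc t) n)"
    using Suc by auto
  have t: "t < T" using Suc.prems by simp
  show ?case
    unfolding law_Suc
    by (rule measurable_bind_prob_space2[OF \<pi>[OF Suc.prems(1) t] measurable_law_step(2)[OF Suc.prems(1) t IH]])
qed

lemma law_in_space:
  assumes "t0 \<le> t" "t + n \<le> T" "x \<in> space MX"
  shows "law n t x \<in> space (prob_algebra (paths t n))"
  using measurable_space[OF measurable_law[OF assms(1,2)] assms(3)] .

lemma integral_law_Suc:
  fixes H :: "_ \<Rightarrow> real"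
  assumes t: "t0 \<le> t" "t + Suc n \<le> T" and x: "x \<in> space MX"
    and H: "H \<in> borel_measurable (paths t (Suc n))" "\<And>p. p \<in> space (paths t (Suc n)) \<Longrightarrow> \<bar>H p\<bar> \<le> B"
  shows "(\<integral>p. H p \<partial>law (Suc n) t x)
    = (\<integral>a. (\<integral>y. (\<integral>p. H (path_update t x a p) \<partial>law n (Suc t) y) \<partial>K t (x, a)) \<partial>\<pi> t x)"
proof -
  have tT: "t < T" using t by simp
  have IH: "law n (Suc t) \<in> MX \<rightarrow>\<^sub>M prob_algebra (paths (Suc t) n)"
    using t by (intro measurable_law) auto
  note step = measurable_law_step[OF t(1) tT IH]
  have pi: "\<pi> t x \<in> space (prob_algebra MA)"
    using measurable_space[OF \<pi>[OF t(1) tT] x] .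
  have "(\<integral>p. H p \<partial>law (Suc n) t x) = (\<integral>a. (\<integral>p. H p \<partial>(K t (x, a) \<bind> (\<lambda>y.
     distr (law n (Suc t) y) (paths t (Suc n)) (path_update t x a)))) \<partial>\<pi> t x)"
    unfolding law_Suc
    by (rule integral_bind_prob_algebra[OF pi _ H])
       (use measurable_compose[OF measurable_Pair1'[OF x] step(2)] in simp)
  also have "\<dots> = (\<integral>a. (\<integral>y. (\<integral>p. H (path_update t x a p) \<partial>law n (Suc t) y) \<partial>K t (x, a)) \<partial>\<pi> t x)"
  proof (rule Bochner_Integration.integral_cong[OF refl])
    fix a assume "a \<in> space (\<pi> t x)"
    then have a: "a \<in> space MA" using prob_algebraD(3)[OF pi] by simp
    then have xa: "(x, a) \<in> space (MX \<Otimes>\<^sub>M MA)" using x by (simp add: space_pair_measure)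
    have Kxa: "K t (x, a) \<in> space (prob_algebra MX)"
      using measurable_space[OF K[OF t(1) tT] xa] .
    have "(\<integral>p. H p \<partial>(K t (x, a) \<bind> (\<lambda>y. distr (law n (Suc t) y) (paths t (Suc n)) (path_update t x a))))
      = (\<integral>y. (\<integral>p. H p \<partial>distr (law n (Suc t) y) (paths t (Suc n)) (path_update t x a)) \<partial>K t (x, a))"
      by (rule integral_bind_prob_algebra[OF Kxa _ H])
         (use measurable_compose[OF measurable_Pair1'[OF xa] step(1)] in simp)
    also have "\<dots> = (\<integral>y. (\<integral>p. H (path_update t x a p) \<partial>law n (Suc t) y) \<partial>K t (x, a))"
    proof (rule Bochner_Integration.integral_cong[OF refl])
      fix y assume "y \<in> space (K t (x, a))"
      then have "y \<in> space MX" using prob_algebraD(3)[OF Kxa] by simp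
      then have sets: "sets (law n (Suc t) y) = sets (paths (Suc t) n)"
        using measurable_space[OF IH] by (auto simp: space_prob_algebra)
      have "path_update t x a \<in> paths (Suc t) n \<rightarrow>\<^sub>M paths t (Suc n)"
        using measurable_path_update[OF measurable_const[OF x] measurable_const[OF a] measurable_ident] by simp
      then have "path_update t x a \<in> law n (Suc t) y \<rightarrow>\<^sub>M paths t (Suc n)"
        using sets by (simp cong: measurable_cong_sets)
      then show "(\<integral>p. H p \<partial>distr (law n (Suc t) y) (paths t (Suc n)) (path_update t x a))
          = (\<integral>p. H (path_update t x a p) \<partial>law n (Suc t) y)"
        by (rule integral_distr) (rule H)
    qed
    finally show "(\<integral>p. H p \<partial>(K t (x, a) \<bind> (\<lambda>y. distr (law n (Suc t) y) (paths t (Suc n)) (path_update t x a))))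
      = (\<integral>y. (\<integral>p. H (path_update t x a p) \<partial>law n (Suc t) y) \<partial>K t (x, a))" .
  qed
  finally show ?thesis .
qed

text \<open>The path starts at \<open>x\<close>, expressed through an integral instead of an almost-sure statement, so
  that singletons need not be measurable.\<close>

lemma integral_law_start:
  fixes H :: "_ \<Rightarrow> real"
  assumes t: "t0 \<le> t" "t + n \<le> T" and x: "x \<in> space MX"
    and H: "H \<in> borel_measurable (paths t n)" "\<And>p. p \<in> space (paths t n) \<Longrightarrow> \<bar>H p\<bar> \<le> B"
  shows "(\<integral>p. H p \<partial>law n t x) = (\<integral>p. H ((fst p)(t := x), snd p) \<partial>law n t x)"
proof -
  have "(\<lambda>p. (fst p)(t := x)) \<in> (\<Pi>\<^sub>M i\<in>{t..t + n}. MX) \<Otimes>\<^sub>M (\<Pi>\<^sub>M i\<in>{t..<t + n}. MA) \<rightarrow>\<^sub>M (\<Pi>\<^sub>M i\<in>{t..t + n}. MX)"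
    by (rule measurable_fun_upd[where J = "{t..t + n}"]) (use x in auto)
  then have upd: "(\<lambda>p. ((fst p)(t := x), snd p)) \<in> paths t n \<rightarrow>\<^sub>M paths t n"
    unfolding path_space_def by (intro measurable_Pair) auto
  have H': "(\<lambda>p. H ((fst p)(t := x), snd p)) \<in> borel_measurable (paths t n)"
    by (rule measurable_compose[OF upd H(1)])
  have B': "\<bar>H ((fst p)(t := x), snd p)\<bar> \<le> B" if "p \<in> space (paths t n)" for p
    using H(2)[OF measurable_space[OF upd that]] .
  show ?thesis
  proof (cases n)
    case 0
    have "(\<lambda>i\<in>{t}. x, \<lambda>i. undefined) \<in> space (paths t 0)"
      using x by (auto simp: path_space_def space_pair_measure space_PiM)
    moreover have "(\<lambda>i\<in>{t}. x)(t := x) = (\<lambda>i\<in>{t}. x)" by auto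
    ultimately show ?thesis
      using H(1) H' 0 by (simp add: integral_return)
  next
    case (Suc m)
    \<comment> \<open>After a recursion step coordinate \<open>t\<close> is already
      \<open>x\<close>, so overwriting it again changes nothing and both integrals unfold to the
      same expression.\<close>
    have upd: "((fst (path_update t x a p))(t := x), snd (path_update t x a p)) = path_update t x a p" for a p
      by (simp add: path_update_def)
    have "(\<integral>p. H ((fst p)(t := x), snd p) \<partial>law (Suc m) t x)
      = (\<integral>a. (\<integral>y. (\<integral>p. H (path_update t x a p) \<partial>law m (Suc t) y) \<partial>K t (x, a)) \<partial>\<pi> t x)"
      by (rule integral_law_Suc[OF t[unfolded Suc] x H'[unfolded Suc] B'[unfolded Suc], unfolded upd])
    also have "\<dots> = (\<integral>p. H p \<partial>law (Suc m) t x)"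
      by (rule integral_law_Suc[OF t[unfolded Suc] x H[unfolded Suc], symmetric])
    finally show ?thesis using Suc by simp
  qed
qed

end

text \<open>Inheritance renames the type variables: here \<open>'a\<close> is the state type and
  \<open>'b\<close> the action type. One constant bounds both rewards, so that all path functionals
  are bounded and the iterated-integral formulas apply.\<close>

locale path_rewards = path_kernels +
  fixes f :: "nat \<Rightarrow> 'a \<Rightarrow> 'b \<Rightarrow> 'a \<Rightarrow> real" and g :: "'a \<Rightarrow> real" and B :: real
  assumes f: "\<And>t. t0 \<le> t \<Longrightarrow> t < T \<Longrightarrow> (\<lambda>(x, a, y). f t x a y) \<in> borel_measurable (MX \<Otimes>\<^sub>M MA \<Otimes>\<^sub>M MX)"
    and g: "g \<in> borel_measurable MX"
    and fB: "\<And>t x a y. t0 \<le> t \<Longrightarrow> t < T \<Longrightarrow> x \<in> space MX \<Longrightarrow> a \<in> space MA \<Longrightarrow> y \<in> space MX \<Longrightarrow>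
      \<bar>f t x a y\<bar> \<le> B"
    and gB: "\<And>x. x \<in> space MX \<Longrightarrow> \<bar>g x\<bar> \<le> B"
begin

abbreviation "ret \<equiv> expected_return MX MA \<pi> K f g"

lemma state_measurable: "t \<le> i \<Longrightarrow> i \<le> t + n \<Longrightarrow> (\<lambda>p. fst p i) \<in> paths t n \<rightarrow>\<^sub>M MX"
  and action_measurable: "t \<le> i \<Longrightarrow> i < t + n \<Longrightarrow> (\<lambda>p. snd p i) \<in> paths t n \<rightarrow>\<^sub>M MA"
  unfolding path_space_def
  by (auto intro!: measurable_compose[OF measurable_fst] measurable_compose[OF measurable_snd]
      measurable_component_singleton)

lemma path_return_measurable:
  assumes "t0 \<le> t" "t + n \<le> T"
  shows "path_return f g n t \<in> borel_measurable (paths t n)"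
    and "p \<in> space (paths t n) \<Longrightarrow> \<bar>path_return f g n t p\<bar> \<le> (real n + 1) * B"
proof -
  have f': "(\<lambda>p. f l (fst p l) (snd p l) (fst p (Suc l))) \<in> borel_measurable (paths t n)"
    if "l \<in> {t..<t + n}" for l
  proof -
    have "(\<lambda>p. (fst p l, snd p l, fst p (Suc l))) \<in> paths t n \<rightarrow>\<^sub>M MX \<Otimes>\<^sub>M MA \<Otimes>\<^sub>M MX"
      using that by (intro measurable_Pair state_measurable action_measurable) auto
    from measurable_compose[OF this f[of l]] show ?thesis using that assms by simp
  qed
  have "(\<lambda>p. (\<Sum>l=t..<t + n. f l (fst p l) (snd p l) (fst p (Suc l))) + g (fst p (t + n)))
      \<in> borel_measurable (paths t n)"
    by (intro borel_measurable_add borel_measurable_sum f' measurable_compose[OF state_measurable g]) auto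
  then show "path_return f g n t \<in> borel_measurable (paths t n)"
    unfolding path_return_def .
  assume p: "p \<in> space (paths t n)"
  have st: "fst p i \<in> space MX" if "t \<le> i" "i \<le> t + n" for i
    using measurable_space[OF state_measurable[OF that] p] .
  have ac: "snd p i \<in> space MA" if "t \<le> i" "i < t + n" for i
    using measurable_space[OF action_measurable[OF that] p] .
  have "\<bar>path_return f g n t p\<bar>
      \<le> \<bar>\<Sum>l=t..<t + n. f l (fst p l) (snd p l) (fst p (Suc l))\<bar> + \<bar>g (fst p (t + n))\<bar>"
    unfolding path_return_def by (rule abs_triangle_ineq)
  also have "\<dots> \<le> (\<Sum>l=t..<t + n. B) + B"
    using assms st ac by (intro add_mono order_trans[OF sum_abs] sum_mono fB gB) auto
  finally show "\<bar>path_return f g n t p\<bar> \<le> (real n + 1) * B" by (simp add: algebra_simps)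
qed

lemma expected_return_measurable:
  assumes "t0 \<le> t" "t + n \<le> T"
  shows "ret n t \<in> borel_measurable MX"
    and "x \<in> space MX \<Longrightarrow> \<bar>ret n t x\<bar> \<le> (real n + 1) * B"
proof -
  show "ret n t \<in> borel_measurable MX"
    unfolding expected_return_def
    by (rule measurable_compose[OF measurable_prob_algebraD[OF measurable_law[OF assms]]
          integral_measurable_subprob_algebra[OF path_return_measurable(1)[OF assms]]])
  show "\<bar>ret n t x\<bar> \<le> (real n + 1) * B" if "x \<in> space MX"
    unfolding expected_return_def
    using integrable_bounded_prob_algebra(2)[OF law_in_space[OF assms that] path_return_measurable[OF assms]] .
qed

lemma expected_return_0:
  assumes "t0 \<le> t" "t \<le> T" "x \<in> space MX"
  shows "ret 0 t x = g x"
proof -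
  have "(\<lambda>i\<in>{t}. x, \<lambda>i. undefined) \<in> space (paths t 0)"
    using assms by (auto simp: path_space_def space_pair_measure space_PiM)
  then show ?thesis
    using path_return_measurable(1)[of t 0] assms
    by (simp add: expected_return_def integral_return) (simp add: path_return_def)
qed

text \<open>Policy evaluation for fixed kernels. The first reward depends on the next state, which
  is a coordinate of the remaining path; the starting-point lemma turns that coordinate into the
  integration variable \<open>y\<close>.\<close>

lemma expected_return_Suc:
  assumes t: "t0 \<le> t" "t + Suc n \<le> T" and x: "x \<in> space MX"
  shows "ret (Suc n) t x
    = (\<integral>a. (\<integral>y. f t x a y + ret n (Suc t) y \<partial>K t (x, a)) \<partial>\<pi> t x)"
proof -
  have tT: "t < T" and t': "t0 \<le> Suc t" "Suc t + n \<le> T" using t by auto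
  have pi: "\<pi> t x \<in> space (prob_algebra MA)"
    using measurable_space[OF \<pi>[OF t(1) tT] x] .
  have "ret (Suc n) t x
    = (\<integral>a. (\<integral>y. (\<integral>p. path_return f g (Suc n) t (path_update t x a p) \<partial>law n (Suc t) y) \<partial>K t (x, a)) \<partial>\<pi> t x)"
    unfolding expected_return_def
    by (rule integral_law_Suc[OF t x path_return_measurable[OF t]])
  also have "\<dots> = (\<integral>a. (\<integral>y. f t x a y + ret n (Suc t) y \<partial>K t (x, a)) \<partial>\<pi> t x)"
  proof (intro Bochner_Integration.integral_cong[OF refl])
    fix a y assume "a \<in> space (\<pi> t x)" and y: "y \<in> space (K t (x, a))"
    then have a: "a \<in> space MA" using prob_algebraD(3)[OF pi] by simp
    then have xa: "(x, a) \<in> space (MX \<Otimes>\<^sub>M MA)" using x by (simp add: space_pair_measure)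
    have y: "y \<in> space MX"
      using y prob_algebraD(3)[OF measurable_space[OF K[OF t(1) tT] xa]] by simp
    have st: "(\<lambda>p. fst p (Suc t)) \<in> paths (Suc t) n \<rightarrow>\<^sub>M MX" by (rule state_measurable) auto
    have "(\<lambda>y. (x, a, y)) \<in> MX \<rightarrow>\<^sub>M MX \<Otimes>\<^sub>M MA \<Otimes>\<^sub>M MX"
      using x a by (intro measurable_Pair) auto
    from measurable_compose[OF this f[OF t(1) tT]] have "f t x a \<in> borel_measurable MX" by simp
    from measurable_compose[OF st this]
    have H: "(\<lambda>p. f t x a (fst p (Suc t))) \<in> borel_measurable (paths (Suc t) n)" .
    have HB: "\<bar>f t x a (fst p (Suc t))\<bar> \<le> B" if "p \<in> space (paths (Suc t) n)" for p
      using measurable_space[OF st that] x a t by (intro fB) auto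
    note ly = law_in_space[OF t' y]
    interpret prob_space "law n (Suc t) y" using prob_algebraD[OF ly] by simp
    have "(\<integral>p. path_return f g (Suc n) t (path_update t x a p) \<partial>law n (Suc t) y)
        = (\<integral>p. f t x a (fst p (Suc t)) \<partial>law n (Suc t) y) + ret n (Suc t) y"
      unfolding path_return_update expected_return_def
      by (rule Bochner_Integration.integral_add[OF integrable_bounded_prob_algebra(1)[OF ly H HB]
            integrable_bounded_prob_algebra(1)[OF ly path_return_measurable[OF t']]])
    \<comment> \<open>Setting coordinate \<open>Suc t\<close> to \<open>y\<close> makes the
      integrand constant under a probability law.\<close>
    also have "(\<integral>p. f t x a (fst p (Suc t)) \<partial>law n (Suc t) y) = f t x a y"
      using integral_law_start[OF t' y H HB] by (simp add: prob_space)
    finally show "(\<integral>p. path_return f g (Suc n) t (path_update t x a p) \<partial>law n (Suc t) y)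
        = f t x a y + ret n (Suc t) y" .
  qed
  finally show ?thesis .
qed

end

section \<open>The dual problem of a robust control model\<close>

locale unique_robust_mdp =
  fixes M :: "('x::euclidean_space, 'a::euclidean_space, 'p::euclidean_space) robust_mdp"
    and score :: "nat \<Rightarrow> 'p \<Rightarrow> 'x \<Rightarrow> 'a \<Rightarrow> 'p" and \<Lambda> :: real
  assumes model: "robust_control_model M"
    and reward_cont: "\<And>t. t < horizon M \<Longrightarrow>
          continuous_on (states M \<times> actions M \<times> states M) (\<lambda>(x, a, y). reward M t x a y)"
    and terminal_cont: "continuous_on (states M) (terminal M)"
    and nominal_cont: "\<And>t. t < horizon M \<Longrightarrow>
          weakly_continuous_on (states M \<times> actions M) (nominal M t) (states M)"
    and regular: "regular_policy_class M score"
    and dual_bound: "\<And>t \<theta> x a. t < horizon M \<Longrightarrow> \<theta> \<in> params M \<Longrightarrow> x \<in> states M \<Longrightarrow> a \<in> actions M \<Longrightarrow>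
          dual_maximizers M {0..} t \<theta> x a = dual_maximizers M {0..\<Lambda>} t \<theta> x a"
    and unique: "\<And>t \<theta> x a. t < horizon M \<Longrightarrow> \<theta> \<in> params M \<Longrightarrow> x \<in> states M \<Longrightarrow> a \<in> actions M \<Longrightarrow>
          \<exists>lam. dual_maximizers M {0..} t \<theta> x a = {lam} \<and>
            (\<forall>x'\<in>states M. \<exists>ys. inner_minimizers M t \<theta> lam x a x' = {ys})"
begin

abbreviation "X \<equiv> states M"
abbreviation "A \<equiv> actions M"
abbreviation "T \<equiv> horizon M"
abbreviation "MX \<equiv> state_space M"
abbreviation "MA \<equiv> action_space M"

lemma X: "compact X" "X \<noteq> {}" and A: "compact A" "A \<noteq> {}"
  and expo: "expo M \<ge> 1" and radius: "radius M > 0"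
  and nominal: "t < T \<Longrightarrow> nominal M t \<in> MX \<Otimes>\<^sub>M MA \<rightarrow>\<^sub>M prob_algebra MX"
  and init: "init M \<in> space (prob_algebra MX)"
  and refm: "sets (refm M) = sets MA"
  and dens_measurable: "t < T \<Longrightarrow> \<theta> \<in> params M \<Longrightarrow>
    (\<lambda>(x, a). dens M t \<theta> x a) \<in> borel_measurable (MX \<Otimes>\<^sub>M MA)"
  and policy_prob: "t < T \<Longrightarrow> \<theta> \<in> params M \<Longrightarrow> x \<in> X \<Longrightarrow> prob_space (policy M \<theta> t x)"
  using model by (auto simp: robust_control_model_def transition_kernel_def)

lemma space_MX [simp]: "space MX = X" and space_MA [simp]: "space MA = A"
  by (auto simp: space_restrict_space)

lemma dens_pos: "t < T \<Longrightarrow> \<theta> \<in> params M \<Longrightarrow> x \<in> X \<Longrightarrow> a \<in> A \<Longrightarrow> dens M t \<theta> x a > 0"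
  using regular by (auto simp: regular_policy_class_def)

lemma nominal_probs: "t < T \<Longrightarrow> u \<in> X \<times> A \<Longrightarrow> nominal M t u \<in> probs_on X"
  using measurable_space[OF nominal, of t u] by (auto simp: probs_on_def space_pair_measure)

lemma policy_probs: "t < T \<Longrightarrow> \<theta> \<in> params M \<Longrightarrow> x \<in> X \<Longrightarrow> policy M \<theta> t x \<in> probs_on A"
  using policy_prob[of t \<theta> x] refm by (auto simp: probs_on_def space_prob_algebra policy_def)

lemma dens_section_measurable:
  assumes "t < T" "\<theta> \<in> params M" "x \<in> X"
  shows "dens M t \<theta> x \<in> borel_measurable MA"
proof -
  have "Pair x \<in> MA \<rightarrow>\<^sub>M MX \<Otimes>\<^sub>M MA" using assms(3) by simp
  from measurable_compose[OF this dens_measurable[OF assms(1,2)]] show ?thesis by simp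
qed

text \<open>Strict positivity makes all policies at time \<open>t\<close> mutually absolutely
  continuous, so one can divide by any of the densities.\<close>

lemma policy_density:
  assumes "t < T" "\<theta> \<in> params M" "x \<in> X" "\<theta>' \<in> params M" "x' \<in> X"
  shows "policy M \<theta>' t x' = density (policy M \<theta> t x) (\<lambda>a. ennreal (dens M t \<theta>' x' a / dens M t \<theta> x a))"
proof -
  have [measurable_cong]: "sets (refm M) = sets MA" by (rule refm)
  note [measurable] = dens_section_measurable[OF assms(1,2,3)] dens_section_measurable[OF assms(1,4,5)]
  have "space (refm M) = A" using sets_eq_imp_space_eq[OF refm] by simp
  then have eq: "ennreal (dens M t \<theta>' x' a) = ennreal (dens M t \<theta> x a) * ennreal (dens M t \<theta>' x' a / dens M t \<theta> x a)"
    if "a \<in> space (refm M)" for a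
    using that dens_pos[OF assms(1-3), of a] dens_pos[OF assms(1,4,5), of a]
    by (simp flip: ennreal_mult')
  show ?thesis
    unfolding policy_def
    by (subst density_density_eq) (auto intro!: density_cong simp: eq)
qed

text \<open>Importance weighting: the dependence on the parameter moves from the measure into the
  integrand, so that limits in the parameter can be taken under one fixed law.\<close>

lemma integral_policy:
  fixes \<psi> :: "'a \<Rightarrow> real"
  assumes "t < T" "\<theta> \<in> params M" "x \<in> X" "\<theta>' \<in> params M" "x' \<in> X" "\<psi> \<in> borel_measurable MA"
  shows "(\<integral>a. \<psi> a \<partial>policy M \<theta>' t x') = (\<integral>a. dens M t \<theta>' x' a / dens M t \<theta> x a * \<psi> a \<partial>policy M \<theta> t x)"
proof -
  have [measurable_cong]: "sets (policy M \<theta> t x) = sets MA"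
    using probs_onD(2)[OF policy_probs[OF assms(1-3)]] .
  note [measurable] = dens_section_measurable[OF assms(1,2,3)] dens_section_measurable[OF assms(1,4,5)] assms(6)
  show ?thesis
    unfolding policy_density[OF assms(1-5)]
  proof (subst integral_density)
    show "AE a in policy M \<theta> t x. 0 \<le> dens M t \<theta>' x' a / dens M t \<theta> x a"
      using probs_onD(3)[OF policy_probs[OF assms(1-3)]] dens_pos[OF assms(1-3)] dens_pos[OF assms(1,4,5)]
      by (intro AE_I2) (auto intro!: divide_nonneg_nonneg less_imp_le)
  qed auto
qed

text \<open>All policies have densities with respect to one of them, which supplies the \<open>\<sigma>\<close>-finite base
  measure that Tonelli's theorem requires.\<close>

lemma policy_kernel:
  assumes t: "t < T" and \<theta>: "\<theta> \<in> params M"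
  shows "policy M \<theta> t \<in> MX \<rightarrow>\<^sub>M prob_algebra MA"
proof (rule measurable_prob_algebraI)
  show "prob_space (policy M \<theta> t x)" if "x \<in> space MX" for x
    using policy_prob[OF t \<theta>] that by simp
  obtain x0 where x0: "x0 \<in> X" using X by blast
  interpret P: prob_space "policy M \<theta> t x0" by (rule policy_prob[OF t \<theta> x0])
  have [measurable_cong]: "sets (policy M \<theta> t x0) = sets MA"
    using probs_onD(2)[OF policy_probs[OF t \<theta> x0]] .
  note [measurable] = dens_section_measurable[OF t \<theta> x0] dens_measurable[OF t \<theta>]
  show "policy M \<theta> t \<in> MX \<rightarrow>\<^sub>M subprob_algebra MA"
  proof (rule measurable_subprob_algebra)
    fix x assume "x \<in> space MX"
    then show "subprob_space (policy M \<theta> t x)" "sets (policy M \<theta> t x) = sets MA"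
      using policy_probs[OF t \<theta>] by (auto dest: probs_onD intro: prob_space_imp_subprob_space)
  next
    fix B assume B [measurable]: "B \<in> sets MA"
    have "(\<lambda>x. \<integral>\<^sup>+a. ennreal (dens M t \<theta> x a / dens M t \<theta> x0 a) * indicator B a \<partial>policy M \<theta> t x0)
        \<in> borel_measurable MX"
      by (rule P.borel_measurable_nn_integral) measurable
    then show "(\<lambda>x. emeasure (policy M \<theta> t x) B) \<in> borel_measurable MX"
    proof (rule measurable_cong[THEN iffD1, rotated])
      fix x assume "x \<in> space MX"
      then have x: "x \<in> X" by simp
      note [measurable] = dens_section_measurable[OF t \<theta> x]
      show "(\<integral>\<^sup>+a. ennreal (dens M t \<theta> x a / dens M t \<theta> x0 a) * indicator B a \<partial>policy M \<theta> t x0)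
          = emeasure (policy M \<theta> t x) B"
        unfolding policy_density[OF t \<theta> x0 \<theta> x] by (subst emeasure_density) auto
    qed
  qed
qed

lemma reward_measurable:
  assumes "t < T"
  shows "(\<lambda>(x, a, y). reward M t x a y) \<in> borel_measurable (MX \<Otimes>\<^sub>M MA \<Otimes>\<^sub>M MX)"
proof -
  have "(\<lambda>p. (\<lambda>(x, a, y). reward M t x a y) (fst p, fst (snd p), snd (snd p)))
      \<in> borel_measurable (MX \<Otimes>\<^sub>M MA \<Otimes>\<^sub>M MX)"
  proof (rule measurable_continuous_on_compose[OF reward_cont[OF assms]])
    show "(\<lambda>p. (fst p, fst (snd p), snd (snd p))) \<in> borel_measurable (MX \<Otimes>\<^sub>M MA \<Otimes>\<^sub>M MX)"
      by (intro borel_measurable_Pair measurable_fst_restrict_borel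
          measurable_compose[OF measurable_snd measurable_fst_restrict_borel]
          measurable_compose[OF measurable_snd measurable_snd_restrict_borel])
  qed (auto simp: space_pair_measure)
  then show ?thesis by (simp add: split_beta')
qed

lemma reward_bounded:
  obtains B where "\<And>t x a y. t < T \<Longrightarrow> x \<in> X \<Longrightarrow> a \<in> A \<Longrightarrow> y \<in> X \<Longrightarrow> \<bar>reward M t x a y\<bar> \<le> B"
    "\<And>x. x \<in> X \<Longrightarrow> \<bar>terminal M x\<bar> \<le> B"
proof -
  have "\<exists>b\<ge>0. \<forall>x\<in>X. \<forall>a\<in>A. \<forall>y\<in>X. \<bar>reward M t x a y\<bar> \<le> b" if tT: "t < T" for t
  proof -
    obtain b where "b \<ge> 0" and
      b: "\<And>p. p \<in> X \<times> A \<times> X \<Longrightarrow> \<bar>(\<lambda>(x, a, y). reward M t x a y) p\<bar> \<le> b"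
      using compact_continuous_bounded[OF compact_Times[OF X(1) compact_Times[OF A(1) X(1)]] reward_cont[OF tT]]
      by blast
    have "\<bar>reward M t x a y\<bar> \<le> b" if "x \<in> X" "a \<in> A" "y \<in> X" for x a y
      using b[of "(x, a, y)"] that by simp
    with \<open>b \<ge> 0\<close> show ?thesis by blast
  qed
  then obtain b where b0: "\<And>t. t < T \<Longrightarrow> b t \<ge> (0::real)" and
    b: "\<And>t x a y. t < T \<Longrightarrow> x \<in> X \<Longrightarrow> a \<in> A \<Longrightarrow> y \<in> X \<Longrightarrow> \<bar>reward M t x a y\<bar> \<le> b t"
    by metis
  obtain c where c: "c \<ge> 0" "\<And>x. x \<in> X \<Longrightarrow> \<bar>terminal M x\<bar> \<le> c"
    using compact_continuous_bounded[OF X(1) terminal_cont] by blast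
  have "b t \<le> sum b {..<T}" if "t < T" for t
    by (rule member_le_sum) (use b0 that in auto)
  moreover have "sum b {..<T} \<ge> 0" using b0 by (intro sum_nonneg) auto
  ultimately show ?thesis
    using that[of "sum b {..<T} + c"] b c by (smt (verit))
qed

section \<open>The unique optimizers and the worst-case kernel\<close>

definition lam_star :: "nat \<Rightarrow> 'p \<Rightarrow> 'x \<times> 'a \<Rightarrow> real" where
  "lam_star t \<theta> u = (THE lam. dual_maximizers M {0..} t \<theta> (fst u) (snd u) = {lam})"

definition y_star :: "nat \<Rightarrow> 'p \<Rightarrow> 'x \<times> 'a \<Rightarrow> 'x \<Rightarrow> 'x" where
  "y_star t \<theta> u x' = (THE y. inner_minimizers M t \<theta> (lam_star t \<theta> u) (fst u) (snd u) x' = {y})"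

definition worst_kernel :: "nat \<Rightarrow> 'p \<Rightarrow> 'x \<times> 'a \<Rightarrow> 'x measure" where
  "worst_kernel t \<theta> u = distr (nominal M t u) MX (y_star t \<theta> u)"

lemma lam_star:
  assumes "t < T" "\<theta> \<in> params M" "u \<in> X \<times> A"
  shows "dual_maximizers M {0..} t \<theta> (fst u) (snd u) = {lam_star t \<theta> u}"
    and "x' \<in> X \<Longrightarrow> inner_minimizers M t \<theta> (lam_star t \<theta> u) (fst u) (snd u) x' = {y_star t \<theta> u x'}"
proof -
  obtain lam where lam: "dual_maximizers M {0..} t \<theta> (fst u) (snd u) = {lam}"
    "\<forall>x'\<in>X. \<exists>ys. inner_minimizers M t \<theta> lam (fst u) (snd u) x' = {ys}"
    using unique[of t \<theta> "fst u" "snd u"] assms by auto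
  then have eq: "lam_star t \<theta> u = lam" by (simp add: lam_star_def)
  then show "dual_maximizers M {0..} t \<theta> (fst u) (snd u) = {lam_star t \<theta> u}" using lam by simp
  assume "x' \<in> X"
  then obtain ys where ys: "inner_minimizers M t \<theta> lam (fst u) (snd u) x' = {ys}" using lam by blast
  then have "y_star t \<theta> u x' = ys" by (simp add: y_star_def eq)
  with ys show "inner_minimizers M t \<theta> (lam_star t \<theta> u) (fst u) (snd u) x' = {y_star t \<theta> u x'}"
    by (simp add: eq)
qed

end

text \<open>Continuity of the next value function is an assumption here because it becomes available
  only along the backward induction; one step of the duality theory in turn yields continuity at
  time \<open>t\<close>.\<close>

locale dual_step = unique_robust_mdp M score \<Lambda>
  for M :: "('x::euclidean_space, 'a::euclidean_space, 'p::euclidean_space) robust_mdp"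
    and score \<Lambda> +
  fixes t :: nat and \<theta> :: 'p
  assumes t: "t < horizon M" and \<theta>: "\<theta> \<in> params M"
    and next_cont: "continuous_on (states M) (value_fun M (Suc t) \<theta>)"
begin

abbreviation "cv u y \<equiv> cont_value M t \<theta> (fst u) (snd u) y"
abbreviation "G u \<equiv> dual_value M t \<theta> (fst u) (snd u)"

lemma continuous_on_cont_value: "continuous_on ((X \<times> A) \<times> X) (\<lambda>p. cv (fst p) (snd p))"
proof -
  have "continuous_on ((X \<times> A) \<times> X) (\<lambda>p. (\<lambda>(x, a, y). reward M t x a y) (fst (fst p), snd (fst p), snd p))"
    by (rule continuous_on_compose2[OF reward_cont[OF t]]) (auto intro!: continuous_intros)
  moreover have "continuous_on ((X \<times> A) \<times> X) (\<lambda>p. value_fun M (Suc t) \<theta> (snd p))"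
    by (rule continuous_on_compose2[OF next_cont]) (auto intro!: continuous_intros)
  ultimately show ?thesis unfolding cont_value_def by (auto intro: continuous_on_add)
qed

lemma continuous_on_cv: "u \<in> X \<times> A \<Longrightarrow> continuous_on X (cv u)"
  using continuous_on_section[OF continuous_on_cont_value] by simp

lemma dual:
  assumes "u \<in> X \<times> A"
  shows "wasserstein_dual X (nominal M t u) (cv u) (expo M) (radius M) (lam_star t \<theta> u) (y_star t \<theta> u)"
proof (unfold_locales; (rule X nominal_probs[OF t assms] continuous_on_cv[OF assms] expo radius)?)
  have "lam_star t \<theta> u \<in> dual_maximizers M {0..} t \<theta> (fst u) (snd u)"
    using lam_star(1)[OF t \<theta> assms] by simp
  then show "is_arg_max (\<lambda>l. (\<integral>x'. (INF y\<in>X. cv u y + l * norm (x' - y) ^ expo M) \<partial>nominal M t u) - radius M ^ expo M * l)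
     (\<lambda>l. l \<in> {0..}) (lam_star t \<theta> u)"
    by (simp add: dual_maximizers_def dual_fun_def[abs_def] penalized_def)
  fix x' assume "x' \<in> X"
  from lam_star(2)[OF t \<theta> assms this]
  show "{y. is_arg_min (\<lambda>y. cv u y + lam_star t \<theta> u * norm (x' - y) ^ expo M) (\<lambda>y. y \<in> X) y} = {y_star t \<theta> u x'}"
    by (simp add: inner_minimizers_def penalized_def[abs_def])
qed

lemma dual_fun_eq:
  assumes "u \<in> X \<times> A"
  shows "wasserstein_dual.dual X (nominal M t u) (cv u) (expo M) (radius M) l = dual_fun M t \<theta> l (fst u) (snd u)"
  by (simp add: wasserstein_dual.dual_def[OF dual[OF assms]] wasserstein_dual.env_def[OF dual[OF assms]]
      dual_fun_def penalized_def)

lemma dual_value_eq: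
  assumes "u \<in> X \<times> A"
  shows "G u = dual_fun M t \<theta> (lam_star t \<theta> u) (fst u) (snd u)"
proof -
  interpret d: wasserstein_dual X "nominal M t u" "cv u" "expo M" "radius M" "lam_star t \<theta> u" "y_star t \<theta> u"
    by (rule dual[OF assms])
  show ?thesis
    unfolding dual_value_def
    by (rule cSup_eq_maximum) (use d.lam_nonneg d.dual_le dual_fun_eq[OF assms] in auto)
qed

lemma wball_eq:
  assumes "u \<in> X \<times> A"
  shows "wasserstein_dual.wball X (nominal M t u) (expo M) (radius M) = ambiguity_set M t (fst u) (snd u)"
  by (auto simp: wasserstein_dual.wball_def[OF dual[OF assms]] ambiguity_set_def probs_on_def)

lemma dual_value_le:
  assumes "u \<in> X \<times> A" "P \<in> ambiguity_set M t (fst u) (snd u)"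
  shows "G u \<le> (\<integral>y. cv u y \<partial>P)"
  using wasserstein_dual.weak_duality[OF dual[OF assms(1)], of P] assms
  by (simp add: wball_eq dual_fun_eq dual_value_eq)

lemma worst_kernel_eq:
  assumes "u \<in> X \<times> A"
  shows "worst_kernel t \<theta> u = wasserstein_dual.worst X (nominal M t u) (y_star t \<theta> u)"
  by (simp add: worst_kernel_def wasserstein_dual.worst_def[OF dual[OF assms]])

lemma worst_kernel:
  assumes "u \<in> X \<times> A"
  shows "worst_kernel t \<theta> u \<in> ambiguity_set M t (fst u) (snd u)"
    and "(\<integral>y. cv u y \<partial>worst_kernel t \<theta> u) = G u"
  using wasserstein_dual.worst_in_wball[OF dual[OF assms]] wasserstein_dual.integral_v_worst[OF dual[OF assms]] assms
  by (simp_all add: wball_eq dual_fun_eq dual_value_eq worst_kernel_eq)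

lemma stability_bound:
  assumes u: "u \<in> X \<times> A" and \<phi>: "continuous_on X \<phi>" and "\<eta> > 0"
  obtains C :: real where "C \<ge> 0" "\<And>P. P \<in> ambiguity_set M t (fst u) (snd u) \<Longrightarrow>
    \<bar>(\<integral>y. \<phi> y \<partial>P) - (\<integral>x'. \<phi> (y_star t \<theta> u x') \<partial>nominal M t u)\<bar> \<le> \<eta> + C * ((\<integral>y. cv u y \<partial>P) - G u)"
  using wasserstein_dual.stability[OF dual[OF u] \<phi> \<open>\<eta> > 0\<close>] u
  by (simp add: wball_eq dual_fun_eq dual_value_eq) blast

text \<open>Adds a dummy coordinate, which later carries the multiplier, so that the general
  continuity lemma for integrals applies to integrands depending on it.\<close>

lemma nominal_weakly_continuous_fst:
  "weakly_continuous_on ((X \<times> A) \<times> W) (\<lambda>p. nominal M t (fst p)) X"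
  unfolding weakly_continuous_on_def
proof (intro allI impI)
  fix \<phi> :: "'x \<Rightarrow> real" assume "continuous_on X \<phi>"
  then have "continuous_on (X \<times> A) (\<lambda>u. \<integral>y. \<phi> y \<partial>nominal M t u)"
    using nominal_cont[OF t] unfolding weakly_continuous_on_def by blast
  then show "continuous_on ((X \<times> A) \<times> W) (\<lambda>p. \<integral>y. \<phi> y \<partial>nominal M t (fst p))"
    by (rule continuous_on_compose2) (auto intro!: continuous_intros)
qed

text \<open>Two layers: the inner infimum is continuous jointly in state-action pair, multiplier and
  nominal point, and integrating it against a weakly continuous kernel preserves continuity in the
  remaining variables.\<close>

lemma continuous_on_dual_fun:
  "continuous_on ((X \<times> A) \<times> {0..\<Lambda>}) (\<lambda>p. dual_fun M t \<theta> (snd p) (fst (fst p)) (snd (fst p)))"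
proof -
  let ?U = "(X \<times> A) \<times> {0..\<Lambda>}"
  have "compact ?U" using X A by (intro compact_Times compact_Icc)
  have "continuous_on ((?U \<times> X) \<times> X) (\<lambda>p. cv (fst (fst (fst p))) (snd p)
      + snd (fst (fst p)) * norm (snd (fst p) - snd p) ^ expo M)"
    by (intro continuous_intros continuous_on_compose2[OF continuous_on_cont_value,
          where f = "\<lambda>p. (fst (fst (fst p)), snd p)", simplified]) auto
  from continuous_on_INF_compact[OF compact_Times[OF \<open>compact ?U\<close> X(1)] X this]
  have inf: "continuous_on (?U \<times> X)
      (\<lambda>p. INF y\<in>X. penalized M t \<theta> (snd (fst p)) (fst (fst (fst p))) (snd (fst (fst p))) (snd p) y)"
    by (simp add: penalized_def)
  have "continuous_on ?U (\<lambda>p. (\<integral>x'. (INF y\<in>X. penalized M t \<theta> (snd p) (fst (fst p)) (snd (fst p)) x' y)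
      \<partial>nominal M t (fst p)))"
    using continuous_on_integral_weakly_continuous[OF \<open>compact ?U\<close> X(1) nominal_weakly_continuous_fst _ inf]
      nominal_probs[OF t] by force
  then show ?thesis
    unfolding dual_fun_def prod.collapse by (intro continuous_intros)
qed

lemma bounded_maximizers:
  assumes "u \<in> X \<times> A"
  shows "dual_maximizers M {0..\<Lambda>} t \<theta> (fst u) (snd u) = {lam_star t \<theta> u}"
proof -
  have "fst u \<in> X" "snd u \<in> A" using assms by auto
  from dual_bound[OF t \<theta> this] lam_star(1)[OF t \<theta> assms] show ?thesis by (rule trans[OF sym])
qed

text \<open>The argmin lemma for the negated dual function. Restricting the multipliers to the
  interval up to \<Lambda>, without changing the maximizer, supplies the compact target of the
  closed-graph argument.\<close>

lemma continuous_on_lam_star: "continuous_on (X \<times> A) (lam_star t \<theta>)"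
proof (rule continuous_on_argmin)
  show "compact (X \<times> A)" using X A by (intro compact_Times)
  show "compact {0..\<Lambda>}" by (rule compact_Icc)
  show "continuous_on ((X \<times> A) \<times> {0..\<Lambda>}) (\<lambda>p. - dual_fun M t \<theta> (snd p) (fst (fst p)) (snd (fst p)))"
    by (intro continuous_on_minus continuous_on_dual_fun)
  have eq: "is_arg_max (\<lambda>lam. dual_fun M t \<theta> lam (fst u) (snd u)) (\<lambda>lam. lam \<in> {0..\<Lambda>}) l \<longleftrightarrow> l = lam_star t \<theta> u"
    if "u \<in> X \<times> A" for u l
    using bounded_maximizers[OF that] unfolding dual_maximizers_def by blast
  show *: "lam_star t \<theta> u \<in> {0..\<Lambda>}" if "u \<in> X \<times> A" for u
    using eq[OF that, of "lam_star t \<theta> u"] unfolding is_arg_max_linorder by simp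
  have le: "dual_fun M t \<theta> z (fst u) (snd u) \<le> dual_fun M t \<theta> (lam_star t \<theta> u) (fst u) (snd u)"
    if "u \<in> X \<times> A" "z \<in> {0..\<Lambda>}" for u z
    using eq[OF that(1), of "lam_star t \<theta> u"] that(2) unfolding is_arg_max_linorder by simp
  show "- dual_fun M t \<theta> (snd (u, lam_star t \<theta> u)) (fst (fst (u, lam_star t \<theta> u))) (snd (fst (u, lam_star t \<theta> u)))
      \<le> - dual_fun M t \<theta> (snd (u, z)) (fst (fst (u, z))) (snd (fst (u, z)))"
    if "u \<in> X \<times> A" "z \<in> {0..\<Lambda>}" for u z
    using le[OF that] by simp
  show "z = lam_star t \<theta> u" if u: "u \<in> X \<times> A" and z: "z \<in> {0..\<Lambda>}"
    and "- dual_fun M t \<theta> (snd (u, z)) (fst (fst (u, z))) (snd (fst (u, z)))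
      \<le> - dual_fun M t \<theta> (snd (u, lam_star t \<theta> u)) (fst (fst (u, lam_star t \<theta> u))) (snd (fst (u, lam_star t \<theta> u)))" for u z
  proof -
    have "dual_fun M t \<theta> (lam_star t \<theta> u) (fst u) (snd u) \<le> dual_fun M t \<theta> z (fst u) (snd u)"
      using that(3) by simp
    then have "is_arg_max (\<lambda>lam. dual_fun M t \<theta> lam (fst u) (snd u)) (\<lambda>lam. lam \<in> {0..\<Lambda>}) z"
      unfolding is_arg_max_linorder using z le[OF u] by force
    then show ?thesis using eq[OF u] by blast
  qed
qed

lemma lam_star_in: "u \<in> X \<times> A \<Longrightarrow> lam_star t \<theta> u \<in> {0..\<Lambda>}"
  using bounded_maximizers[of u] unfolding dual_maximizers_def is_arg_max_linorder by blast

lemma continuous_on_dual_value: "continuous_on (X \<times> A) G"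
proof -
  have "continuous_on (X \<times> A) (\<lambda>u. dual_fun M t \<theta> (snd (u, lam_star t \<theta> u)) (fst (fst (u, lam_star t \<theta> u)))
      (snd (fst (u, lam_star t \<theta> u))))"
    by (rule continuous_on_compose2[OF continuous_on_dual_fun])
       (use lam_star_in in \<open>auto intro!: continuous_intros continuous_on_lam_star\<close>)
  then show ?thesis by (simp add: dual_value_eq cong: continuous_on_cong)
qed

text \<open>Joint continuity in the pair and the nominal point, possible because the multiplier is
  itself continuous in the pair. This joint form is what makes the push-forward laws a measurable
  kernel.\<close>

lemma continuous_on_y_star: "continuous_on ((X \<times> A) \<times> X) (\<lambda>p. y_star t \<theta> (fst p) (snd p))"
proof (rule continuous_on_argmin[OF _ X(1), where f = "\<lambda>p. cv (fst (fst p)) (snd p)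
      + lam_star t \<theta> (fst (fst p)) * norm (snd (fst p) - snd p) ^ expo M"])
  show "compact ((X \<times> A) \<times> X)" using X A by (intro compact_Times)
  show "continuous_on (((X \<times> A) \<times> X) \<times> X) (\<lambda>p. cv (fst (fst p)) (snd p)
      + lam_star t \<theta> (fst (fst p)) * norm (snd (fst p) - snd p) ^ expo M)"
    by (intro continuous_intros continuous_on_compose2[OF continuous_on_lam_star]
        continuous_on_compose2[OF continuous_on_cont_value, where f = "\<lambda>p. (fst (fst p), snd p)", simplified]) auto
  fix p assume p: "p \<in> (X \<times> A) \<times> X"
  interpret d: wasserstein_dual X "nominal M t (fst p)" "cv (fst p)" "expo M" "radius M"
    "lam_star t \<theta> (fst p)" "y_star t \<theta> (fst p)"
    using p by (intro dual) auto
  have x': "snd p \<in> X" using p by auto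
  show "y_star t \<theta> (fst p) (snd p) \<in> X" by (rule d.ystar_in[OF x'])
  fix z assume z: "z \<in> X"
  show "cv (fst (fst (p, y_star t \<theta> (fst p) (snd p)))) (snd (p, y_star t \<theta> (fst p) (snd p)))
      + lam_star t \<theta> (fst (fst (p, y_star t \<theta> (fst p) (snd p)))) *
        norm (snd (fst (p, y_star t \<theta> (fst p) (snd p))) - snd (p, y_star t \<theta> (fst p) (snd p))) ^ expo M
    \<le> cv (fst (fst (p, z))) (snd (p, z))
      + lam_star t \<theta> (fst (fst (p, z))) * norm (snd (fst (p, z)) - snd (p, z)) ^ expo M"
    using d.env_ystar[OF x'] d.env_le[OF z, of "lam_star t \<theta> (fst p)" "snd p"] by simp
  assume "cv (fst (fst (p, z))) (snd (p, z))
      + lam_star t \<theta> (fst (fst (p, z))) * norm (snd (fst (p, z)) - snd (p, z)) ^ expo M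
    \<le> cv (fst (fst (p, y_star t \<theta> (fst p) (snd p)))) (snd (p, y_star t \<theta> (fst p) (snd p)))
      + lam_star t \<theta> (fst (fst (p, y_star t \<theta> (fst p) (snd p)))) *
        norm (snd (fst (p, y_star t \<theta> (fst p) (snd p))) - snd (p, y_star t \<theta> (fst p) (snd p))) ^ expo M"
  then show "z = y_star t \<theta> (fst p) (snd p)"
    using d.env_ystar[OF x'] by (intro d.ystar_unique[OF x' z]) simp
qed

lemma worst_kernel_transition: "transition_kernel M (worst_kernel t \<theta>)"
  unfolding transition_kernel_def worst_kernel_def
proof (rule measurable_distr_prob_space2[OF nominal[OF t]])
  have "(\<lambda>p. (\<lambda>p. y_star t \<theta> (fst p) (snd p)) ((fst (fst p), snd (fst p)), snd p))
      \<in> borel_measurable ((MX \<Otimes>\<^sub>M MA) \<Otimes>\<^sub>M MX)"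
  proof (rule measurable_continuous_on_compose[OF continuous_on_y_star])
    show "(\<lambda>p. ((fst (fst p), snd (fst p)), snd p)) \<in> borel_measurable ((MX \<Otimes>\<^sub>M MA) \<Otimes>\<^sub>M MX)"
      by (intro borel_measurable_Pair measurable_snd_restrict_borel
          measurable_compose[OF measurable_fst measurable_fst_restrict_borel]
          measurable_compose[OF measurable_fst measurable_snd_restrict_borel])
  qed (auto simp: space_pair_measure)
  then show "(\<lambda>(u, y). y_star t \<theta> u y) \<in> (MX \<Otimes>\<^sub>M MA) \<Otimes>\<^sub>M MX \<rightarrow>\<^sub>M MX"
  proof (intro measurable_restrict_space2)
    show "(\<lambda>(u, y). y_star t \<theta> u y) \<in> space ((MX \<Otimes>\<^sub>M MA) \<Otimes>\<^sub>M MX) \<rightarrow> X"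
      using wasserstein_dual.ystar_in[OF dual] by (auto simp: space_pair_measure)
  qed (simp add: split_beta')
qed

lemma policy_weakly_continuous: "weakly_continuous_on X (policy M \<theta> t) A"
  unfolding weakly_continuous_on_def
proof (intro allI impI)
  fix \<phi> :: "'a \<Rightarrow> real" assume "continuous_on A \<phi>"
  then have "continuous_on (params M \<times> X) (\<lambda>u. \<integral>y. \<phi> y \<partial>(\<lambda>(\<theta>, x). policy M \<theta> t x) u)"
    using regular t unfolding regular_policy_class_def weakly_continuous_on_def by blast
  then have "continuous_on X (\<lambda>x. \<integral>y. \<phi> y \<partial>(\<lambda>(\<theta>, x). policy M \<theta> t x) (\<theta>, x))"
    by (rule continuous_on_compose2) (use \<theta> in \<open>auto intro!: continuous_intros\<close>)
  then show "continuous_on X (\<lambda>x. \<integral>y. \<phi> y \<partial>policy M \<theta> t x)" by simp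
qed

lemma continuous_on_policy_dual_value: "continuous_on X (\<lambda>x. \<integral>a. dual_value M t \<theta> x a \<partial>policy M \<theta> t x)"
  using continuous_on_integral_weakly_continuous[OF X(1) A(1) policy_weakly_continuous policy_probs[OF t \<theta>]
      continuous_on_dual_value] by simp

end

section \<open>Dynamic programming\<close>

context unique_robust_mdp
begin

abbreviation "val K \<theta> n t x \<equiv>
  expected_return MX MA (policy M \<theta>) K (reward M) (terminal M) n t x"

lemma value_fun_eq:
  assumes "t + n = T"
  shows "value_fun M t \<theta> x = (INF K\<in>admissible_kernels M t. val K \<theta> n t x)"
proof -
  have "T - t = n" using assms by simp
  with assms show ?thesis
    unfolding value_fun_def expected_return_def path_return_def split_beta' by simp
qed

lemma admissible_mono: "K \<in> admissible_kernels M t \<Longrightarrow> t \<le> s \<Longrightarrow> K \<in> admissible_kernels M s"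
  by (auto simp: admissible_kernels_def)

text \<open>The bound is uniform over the admissible kernels, which is what makes the infimum
  defining the value function bounded below.\<close>

lemma ex_return_bound:
  "\<exists>B. \<forall>\<theta>\<in>params M. \<forall>t. \<forall>K\<in>admissible_kernels M t.
    path_rewards MX MA (policy M \<theta>) K t T (reward M) (terminal M) B"
proof -
  obtain B where B: "\<And>t x a y. t < T \<Longrightarrow> x \<in> X \<Longrightarrow> a \<in> A \<Longrightarrow> y \<in> X \<Longrightarrow> \<bar>reward M t x a y\<bar> \<le> B"
    "\<And>x. x \<in> X \<Longrightarrow> \<bar>terminal M x\<bar> \<le> B"
    using reward_bounded by blast
  show ?thesis
  proof (intro exI[of _ B] ballI allI, unfold_locales)
    fix \<theta> t s K assume "\<theta> \<in> params M" and K: "K \<in> admissible_kernels M t" and s: "t \<le> s" "s < T"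
    then show "policy M \<theta> s \<in> MX \<rightarrow>\<^sub>M prob_algebra MA" by (intro policy_kernel)
    show "K s \<in> MX \<Otimes>\<^sub>M MA \<rightarrow>\<^sub>M prob_algebra MX"
      using K s by (auto simp: admissible_kernels_def transition_kernel_def)
    show "(\<lambda>(x, a, y). reward M s x a y) \<in> borel_measurable (MX \<Otimes>\<^sub>M MA \<Otimes>\<^sub>M MX)"
      by (rule reward_measurable[OF s(2)])
    show "\<bar>reward M s x a y\<bar> \<le> B" if "x \<in> space MX" "a \<in> space MA" "y \<in> space MX" for x a y
      using B(1)[OF s(2)] that by simp
  next
    show "terminal M \<in> borel_measurable MX"
      by (rule borel_measurable_continuous_on_restrict[OF terminal_cont])
    show "\<bar>terminal M x\<bar> \<le> B" if "x \<in> space MX" for x using B(2) that by simp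
  qed
qed

definition return_bound :: real where
  "return_bound = (SOME B. \<forall>\<theta>\<in>params M. \<forall>t. \<forall>K\<in>admissible_kernels M t.
    path_rewards MX MA (policy M \<theta>) K t T (reward M) (terminal M) B)"

lemma val_rewards:
  assumes "\<theta> \<in> params M" "K \<in> admissible_kernels M t"
  shows "path_rewards MX MA (policy M \<theta>) K t T (reward M) (terminal M) return_bound"
  using someI_ex[OF ex_return_bound] assms unfolding return_bound_def by blast

lemma value_fun_le:
  assumes "\<theta> \<in> params M" "t + n = T" "K \<in> admissible_kernels M t" "x \<in> X"
  shows "value_fun M t \<theta> x \<le> val K \<theta> n t x"
proof -
  have "- ((real n + 1) * return_bound) \<le> val K' \<theta> n t x" if "K' \<in> admissible_kernels M t" for K'
    using path_rewards.expected_return_measurable(2)[OF val_rewards[OF assms(1) that], of t n x] assms by simp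
  then show ?thesis
    unfolding value_fun_eq[OF assms(2)]
    by (intro cINF_lower assms(3) bdd_belowI2)
qed

text \<open>The two halves of the Bellman equation. For any kernel, weak duality at time
  \<open>t\<close> combines with the fact that its continuation is at least the next value function.
  Equality holds if the continuation is optimal and the kernel at time \<open>t\<close> is the
  worst-case push-forward.\<close>

lemma worst_kernel_optimal:
  assumes \<theta>: "\<theta> \<in> params M" and t: "t + Suc n = T" and x: "x \<in> X"
    and cont: "continuous_on X (value_fun M (Suc t) \<theta>)"
    and K: "K \<in> admissible_kernels M t"
  shows "(\<integral>a. dual_value M t \<theta> x a \<partial>policy M \<theta> t x) \<le> val K \<theta> (Suc n) t x"
    and "(\<And>y. y \<in> X \<Longrightarrow> val K \<theta> n (Suc t) y = value_fun M (Suc t) \<theta> y) \<Longrightarrow> K t = worst_kernel t \<theta> \<Longrightarrow>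
      val K \<theta> (Suc n) t x = (\<integral>a. dual_value M t \<theta> x a \<partial>policy M \<theta> t x)"
proof -
  have tT: "t < T" using t by simp
  interpret d: dual_step M score \<Lambda> t \<theta> by (intro dual_step.intro dual_step_axioms.intro unique_robust_mdp_axioms tT \<theta> cont)
  interpret r: path_rewards MX MA "policy M \<theta>" K t T "reward M" "terminal M" return_bound
    by (rule val_rewards[OF \<theta> K])
  note pol = policy_probs[OF tT \<theta> x]
  have Suc: "val K \<theta> (Suc n) t x
      = (\<integral>a. (\<integral>y. reward M t x a y + val K \<theta> n (Suc t) y \<partial>K t (x, a)) \<partial>policy M \<theta> t x)"
    by (rule r.expected_return_Suc) (use t x in auto)
  have Kt: "K t \<in> MX \<Otimes>\<^sub>M MA \<rightarrow>\<^sub>M prob_algebra MX" using tT by (intro r.K) auto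
  have Kp: "K t (x, a) \<in> probs_on X" and Ka: "K t (x, a) \<in> ambiguity_set M t x a" if "a \<in> A" for a
  proof -
    show "K t (x, a) \<in> ambiguity_set M t x a" using K tT x that by (auto simp: admissible_kernels_def)
    then show "K t (x, a) \<in> probs_on X" by (auto simp: ambiguity_set_def probs_on_def)
  qed
  have m: "(\<lambda>(a, y). reward M t x a y + val K \<theta> n (Suc t) y) \<in> borel_measurable (MA \<Otimes>\<^sub>M MX)"
  proof -
    have "(\<lambda>p. (x, p)) \<in> MA \<Otimes>\<^sub>M MX \<rightarrow>\<^sub>M MX \<Otimes>\<^sub>M MA \<Otimes>\<^sub>M MX" using x by simp
    from measurable_compose[OF this reward_measurable[OF tT]]
    have "(\<lambda>p. reward M t x (fst p) (snd p)) \<in> borel_measurable (MA \<Otimes>\<^sub>M MX)"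
      by (simp add: split_beta')
    moreover have "(\<lambda>p. val K \<theta> n (Suc t) (snd p)) \<in> borel_measurable (MA \<Otimes>\<^sub>M MX)"
      by (rule measurable_compose[OF measurable_snd r.expected_return_measurable(1)]) (use t in auto)
    ultimately show ?thesis unfolding split_beta' by (rule borel_measurable_add)
  qed
  have mi: "(\<lambda>y. reward M t x a y + val K \<theta> n (Suc t) y) \<in> borel_measurable MX" if "a \<in> A" for a
    using measurable_compose[OF measurable_Pair1' m, of a] that by simp
  define b where "b = return_bound + (real n + 1) * return_bound"
  have b: "\<bar>reward M t x a y + val K \<theta> n (Suc t) y\<bar> \<le> b" if "a \<in> A" "y \<in> X" for a y
    using r.fB[of t x a y] r.expected_return_measurable(2)[of "Suc t" n y] that x t tT
    unfolding b_def by (intro order_trans[OF abs_triangle_ineq] add_mono) auto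
  show "(\<integral>a. dual_value M t \<theta> x a \<partial>policy M \<theta> t x) \<le> val K \<theta> (Suc n) t x"
    unfolding Suc
  proof (rule integral_mono)
    show "integrable (policy M \<theta> t x) (\<lambda>a. dual_value M t \<theta> x a)"
      using continuous_on_section[OF d.continuous_on_dual_value x]
      by (intro integrable_continuous_probs_on[OF A(1) pol]) simp
    show "integrable (policy M \<theta> t x) (\<lambda>a. \<integral>y. reward M t x a y + val K \<theta> n (Suc t) y \<partial>K t (x, a))"
    proof (rule integrable_bounded_probs_on[OF pol])
      have "Pair x \<in> MA \<rightarrow>\<^sub>M MX \<Otimes>\<^sub>M MA" using x by simp
      from measurable_integral_kernel[OF measurable_compose[OF this Kt] m]
      show "(\<lambda>a. \<integral>y. reward M t x a y + val K \<theta> n (Suc t) y \<partial>K t (x, a)) \<in> borel_measurable MA"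
        by simp
      show "\<bar>\<integral>y. reward M t x a y + val K \<theta> n (Suc t) y \<partial>K t (x, a)\<bar> \<le> b" if "a \<in> A" for a
        by (rule integrable_bounded_prob_algebra(2)[OF Kp[OF that, unfolded probs_on_def] mi[OF that]])
           (use b that in auto)
    qed
    fix a assume "a \<in> space (policy M \<theta> t x)"
    then have a: "a \<in> A" using probs_onD(3)[OF pol] by simp
    have "dual_value M t \<theta> x a \<le> (\<integral>y. cont_value M t \<theta> x a y \<partial>K t (x, a))"
      using d.dual_value_le[of "(x, a)"] x a Ka[OF a] by simp
    also have "\<dots> \<le> (\<integral>y. reward M t x a y + val K \<theta> n (Suc t) y \<partial>K t (x, a))"
    proof (rule integral_mono)
      show "integrable (K t (x, a)) (\<lambda>y. cont_value M t \<theta> x a y)"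
        using d.continuous_on_cv[of "(x, a)"] x a by (intro integrable_continuous_probs_on[OF X(1) Kp[OF a]]) simp
      show "integrable (K t (x, a)) (\<lambda>y. reward M t x a y + val K \<theta> n (Suc t) y)"
        by (rule integrable_bounded_probs_on[OF Kp[OF a] mi[OF a] b[OF a]])
      fix y assume "y \<in> space (K t (x, a))"
      then have "y \<in> X" using probs_onD(3)[OF Kp[OF a]] by simp
      then show "cont_value M t \<theta> x a y \<le> reward M t x a y + val K \<theta> n (Suc t) y"
        unfolding cont_value_def
        using value_fun_le[OF \<theta> _ admissible_mono[OF K], of "Suc t" n y] t by simp
    qed
    finally show "dual_value M t \<theta> x a \<le> (\<integral>y. reward M t x a y + val K \<theta> n (Suc t) y \<partial>K t (x, a))" .
  qed
  assume eq: "\<And>y. y \<in> X \<Longrightarrow> val K \<theta> n (Suc t) y = value_fun M (Suc t) \<theta> y" and w: "K t = worst_kernel t \<theta>"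
  show "val K \<theta> (Suc n) t x = (\<integral>a. dual_value M t \<theta> x a \<partial>policy M \<theta> t x)"
    unfolding Suc
  proof (rule Bochner_Integration.integral_cong[OF refl])
    fix a assume "a \<in> space (policy M \<theta> t x)"
    then have a: "a \<in> A" using probs_onD(3)[OF pol] by simp
    have "(\<integral>y. reward M t x a y + val K \<theta> n (Suc t) y \<partial>K t (x, a)) = (\<integral>y. cont_value M t \<theta> x a y \<partial>K t (x, a))"
      using eq probs_onD(3)[OF Kp[OF a]]
      by (intro Bochner_Integration.integral_cong) (auto simp: cont_value_def)
    also have "\<dots> = dual_value M t \<theta> x a"
      using d.worst_kernel(2)[of "(x, a)"] x a w by simp
    finally show "(\<integral>y. reward M t x a y + val K \<theta> n (Suc t) y \<partial>K t (x, a)) = dual_value M t \<theta> x a" .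
  qed
qed

text \<open>The claims need one common induction: duality at time \<open>t\<close> requires
  continuity at \<open>Suc t\<close>, and attainment at \<open>t\<close> requires an optimal kernel
  from \<open>Suc t\<close> on. The guard \<open>n > 0\<close> excludes the horizon, where no action
  is taken.\<close>

lemma dynamic_programming_aux:
  assumes "\<theta> \<in> params M" "t + n = T"
  shows "continuous_on X (value_fun M t \<theta>) \<and>
    (\<exists>K\<in>admissible_kernels M t. \<forall>x\<in>X. value_fun M t \<theta> x = val K \<theta> n t x) \<and>
    (n > 0 \<longrightarrow> (\<forall>x\<in>X. value_fun M t \<theta> x = (\<integral>a. dual_value M t \<theta> x a \<partial>policy M \<theta> t x)))"
  using assms(2)
proof (induction n arbitrary: t)
  case 0
  \<comment> \<open>At the horizon the set of constrained times is empty, so any kernel family is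
    admissible.\<close>
  have K: "undefined \<in> admissible_kernels M t" using 0 by (auto simp: admissible_kernels_def)
  have val: "val K \<theta> 0 t x = terminal M x" if "K \<in> admissible_kernels M t" "x \<in> X" for K x
    using path_rewards.expected_return_0[OF val_rewards[OF assms(1) that(1)], of t x] that 0 by simp
  have V: "value_fun M t \<theta> x = terminal M x" if "x \<in> X" for x
  proof -
    have "value_fun M t \<theta> x = (INF K\<in>admissible_kernels M t. terminal M x)"
      unfolding value_fun_eq[OF 0] using val that by simp
    also have "\<dots> = terminal M x" using K by (intro cINF_const) auto
    finally show ?thesis .
  qed
  then have "continuous_on X (value_fun M t \<theta>)" using terminal_cont by (simp cong: continuous_on_cong)
  then show ?case using V val K by auto
next
  case (Suc n)
  from Suc.prems have "Suc t + n = T" by simp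
  from Suc.IH[OF this] obtain K where cont: "continuous_on X (value_fun M (Suc t) \<theta>)"
    and K: "K \<in> admissible_kernels M (Suc t)" "\<And>x. x \<in> X \<Longrightarrow> value_fun M (Suc t) \<theta> x = val K \<theta> n (Suc t) x"
    by blast
  have tT: "t < T" using Suc.prems by simp
  interpret d: dual_step M score \<Lambda> t \<theta> by (intro dual_step.intro dual_step_axioms.intro unique_robust_mdp_axioms tT assms(1) cont)
  \<comment> \<open>Worst-case push-forward at time \<open>t\<close>, followed by the optimal
    kernels of the induction hypothesis.\<close>
  define K' where "K' = K(t := worst_kernel t \<theta>)"
  have K': "K' \<in> admissible_kernels M t"
    unfolding admissible_kernels_def
  proof (intro CollectI ballI)
    fix l assume l: "l \<in> {t..<T}"
    show "transition_kernel M (K' l) \<and> (\<forall>x\<in>X. \<forall>a\<in>A. K' l (x, a) \<in> ambiguity_set M l x a)"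
    proof (cases "l = t")
      case True
      have "worst_kernel t \<theta> (x, a) \<in> ambiguity_set M t x a" if "x \<in> X" "a \<in> A" for x a
        using d.worst_kernel(1)[of "(x, a)"] that by simp
      then show ?thesis using d.worst_kernel_transition True by (simp add: K'_def)
    next
      case False
      then have "l \<in> {Suc t..<T}" using l by auto
      then show ?thesis using K(1) False by (simp add: K'_def admissible_kernels_def)
    qed
  qed
  have val_next: "val K' \<theta> n (Suc t) y = value_fun M (Suc t) \<theta> y" if "y \<in> X" for y
  proof -
    have "path_law MX MA (policy M \<theta>) K' n (Suc t) y = path_law MX MA (policy M \<theta>) K n (Suc t) y"
      by (rule path_law_cong) (simp add: K'_def)
    then show ?thesis using K(2)[OF that] by (simp add: expected_return_def)
  qed
  have val: "val K' \<theta> (Suc n) t x = (\<integral>a. dual_value M t \<theta> x a \<partial>policy M \<theta> t x)" if "x \<in> X" for x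
    by (rule worst_kernel_optimal(2)[OF assms(1) Suc.prems that cont K' val_next]) (simp_all add: K'_def)
  have V: "value_fun M t \<theta> x = (\<integral>a. dual_value M t \<theta> x a \<partial>policy M \<theta> t x)" if "x \<in> X" for x
  proof (rule order_antisym)
    show "value_fun M t \<theta> x \<le> (\<integral>a. dual_value M t \<theta> x a \<partial>policy M \<theta> t x)"
      using value_fun_le[OF assms(1) Suc.prems K' that] val[OF that] by simp
    show "(\<integral>a. dual_value M t \<theta> x a \<partial>policy M \<theta> t x) \<le> value_fun M t \<theta> x"
      unfolding value_fun_eq[OF Suc.prems]
      using K' worst_kernel_optimal(1)[OF assms(1) Suc.prems that cont] by (intro cINF_greatest) auto
  qed
  have "continuous_on X (value_fun M t \<theta>)"
    using d.continuous_on_policy_dual_value V by (simp cong: continuous_on_cong)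
  moreover have "\<forall>x\<in>X. value_fun M t \<theta> x = val K' \<theta> (Suc n) t x" using V val by simp
  ultimately show ?case using K' V by blast
qed

lemma continuous_on_value_fun:
  assumes "\<theta> \<in> params M" "t \<le> T"
  shows "continuous_on X (value_fun M t \<theta>)"
  using dynamic_programming_aux[OF assms(1), of t "T - t"] assms(2) by simp

text \<open>The continuity assumption of the locale is discharged by the induction, so the duality
  results now hold at every time and parameter.\<close>

lemma dual_step: "t < T \<Longrightarrow> \<theta> \<in> params M \<Longrightarrow> dual_step M score \<Lambda> t \<theta>"
  by (intro dual_step.intro dual_step_axioms.intro unique_robust_mdp_axioms continuous_on_value_fun) auto

lemma bellman:
  assumes "\<theta> \<in> params M" "t < T" "x \<in> X"
  shows "value_fun M t \<theta> x = (\<integral>a. dual_value M t \<theta> x a \<partial>policy M \<theta> t x)"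
  using dynamic_programming_aux[OF assms(1), of t "T - t"] assms(2,3) by simp

lemma value_fun_terminal:
  assumes "\<theta> \<in> params M" "x \<in> X"
  shows "value_fun M T \<theta> x = terminal M x"
proof -
  obtain K where K: "K \<in> admissible_kernels M T" "value_fun M T \<theta> x = val K \<theta> 0 T x"
    using dynamic_programming_aux[OF assms(1), of T 0] assms(2) by auto
  from path_rewards.expected_return_0[OF val_rewards[OF assms(1) K(1)], of T x] K assms show ?thesis by simp
qed

end

section \<open>Scores and density ratios\<close>

lemma abs_exp_minus_one_le: "\<bar>exp w - 1\<bar> \<le> \<bar>w\<bar> * exp \<bar>w\<bar>" for w :: real
proof (cases "w \<ge> 0")
  case True
  have "(1 - w) * exp w \<le> exp (- w) * exp w"
    using exp_ge_add_one_self[of "- w"] by (intro mult_right_mono) auto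
  then have "exp w - 1 \<le> w * exp w" by (simp add: algebra_simps flip: exp_add)
  then show ?thesis using True by simp
next
  case False
  then have "exp w \<le> 1" by simp
  with False have "\<bar>exp w - 1\<bar> \<le> \<bar>w\<bar> * 1" using exp_ge_add_one_self[of w] by linarith
  also have "\<dots> \<le> \<bar>w\<bar> * exp \<bar>w\<bar>" by (intro mult_left_mono) auto
  finally show ?thesis .
qed

text \<open>Provides the constant that dominates all difference quotients: eventually they are
  within 1 of the bounded limit, and the finitely many others are bounded by continuity.\<close>

lemma uniform_limit_uniformly_bounded:
  fixes D :: "nat \<Rightarrow> 'b::topological_space \<Rightarrow> real"
  assumes S: "compact S" and lim: "uniform_limit S D w sequentially"
    and w: "continuous_on S w" and D: "\<And>n. continuous_on S (D n)"
  obtains b where "\<And>n x. x \<in> S \<Longrightarrow> \<bar>D n x\<bar> \<le> b"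
proof -
  obtain c where c: "c \<ge> 0" "\<And>x. x \<in> S \<Longrightarrow> \<bar>w x\<bar> \<le> c"
    using compact_continuous_bounded[OF S w] by blast
  have "\<exists>d\<ge>0. \<forall>x\<in>S. \<bar>D n x\<bar> \<le> d" for n
    using compact_continuous_bounded[OF S D[of n]] by metis
  then obtain d where d: "\<And>n. d n \<ge> 0" "\<And>n x. x \<in> S \<Longrightarrow> \<bar>D n x\<bar> \<le> d n" by metis
  obtain N where N: "\<And>n x. n \<ge> N \<Longrightarrow> x \<in> S \<Longrightarrow> dist (D n x) (w x) < 1"
    using uniform_limitD[OF lim, of 1] unfolding eventually_sequentially by auto
  have "\<bar>D n x\<bar> \<le> c + 1 + sum d {..<N}" if "x \<in> S" for n x
  proof (cases "n < N")
    case True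
    then have "d n \<le> sum d {..<N}" by (intro member_le_sum) (use d in auto)
    with d(2)[OF that, of n] c(1) show ?thesis by linarith
  next
    case False
    then have "\<bar>D n x - w x\<bar> < 1" using N[of n x] that by (simp add: dist_real_def)
    moreover have "sum d {..<N} \<ge> 0" using d by (intro sum_nonneg) auto
    ultimately show ?thesis using c(2)[OF that] by linarith
  qed
  then show ?thesis using that by blast
qed

locale gradient_point = unique_robust_mdp M score \<Lambda>
  for M :: "('x::euclidean_space, 'a::euclidean_space, 'p::euclidean_space) robust_mdp"
    and score \<Lambda> +
  fixes \<theta> :: 'p and Pstar :: "nat \<Rightarrow> 'x \<times> 'a \<Rightarrow> 'x measure"
  assumes interior: "\<theta> \<in> interior (params M)"
    and worst_case: "worst_case_selector M \<theta> Pstar"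
    and equicont: "\<And>r. \<exists>h\<^sub>0>0. \<forall>s\<le>horizon M. equicontinuous_on (states M)
             {(\<lambda>x. (value_fun M s (\<theta> + h *\<^sub>R r) x - value_fun M s \<theta> x) / h) |h.
                0 < \<bar>h\<bar> \<and> \<bar>h\<bar> \<le> h\<^sub>0 \<and> \<theta> + h *\<^sub>R r \<in> params M}"
begin

lemma \<theta>: "\<theta> \<in> params M"
  using interior interior_subset by blast

text \<open>The whole segment must lie in the interior, not merely in the parameter set, so that the
  log-density has a two-sided derivative at each intermediate point.\<close>

lemma interior_radius:
  obtains h1 where "h1 > 0" "\<And>h. \<bar>h\<bar> \<le> h1 \<Longrightarrow> \<theta> + h *\<^sub>R r \<in> interior (params M)"
proof -
  have "open ((\<lambda>h. \<theta> + h *\<^sub>R r) -` interior (params M))"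
    by (intro open_vimage continuous_intros) auto
  moreover have "0 \<in> (\<lambda>h. \<theta> + h *\<^sub>R r) -` interior (params M)" using interior by simp
  ultimately obtain h1 where "h1 > 0" "cball 0 h1 \<subseteq> (\<lambda>h. \<theta> + h *\<^sub>R r) -` interior (params M)"
    using open_contains_cball by blast
  then show ?thesis using that by (auto simp: subset_iff dist_real_def)
qed

text \<open>Stated along the entire segment, since the mean value estimate for the density ratio
  needs the derivative at intermediate points as well as at \<open>s = 0\<close>.\<close>

lemma log_dens_derivative:
  assumes "t < T" "x \<in> X" "a \<in> A" and s: "\<theta> + s *\<^sub>R r \<in> interior (params M)"
  shows "((\<lambda>h. ln (dens M t (\<theta> + h *\<^sub>R r) x a)) has_field_derivative score t (\<theta> + s *\<^sub>R r) x a \<bullet> r) (at s)"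
proof -
  let ?p = "\<theta> + s *\<^sub>R r" and ?F = "\<lambda>\<theta>'. ln (dens M t \<theta>' x a)"
  have "open ((\<lambda>h. ?p + h *\<^sub>R r) -` interior (params M))"
    by (intro open_vimage continuous_intros) auto
  \<comment> \<open>At an interior parameter all small increments are admissible, so the restricted
    filter in \<open>has_gradient_within\<close> is the full punctured neighbourhood.\<close>
  then have "0 \<in> interior {h. ?p + h *\<^sub>R r \<in> params M}"
    using s interior_subset[of "params M"] by (intro interiorI) auto
  then have at: "at 0 within {h. ?p + h *\<^sub>R r \<in> params M} = at 0"
    by (rule at_within_interior)
  have "?p \<in> params M" using s interior_subset by blast
  then have "has_gradient_within ?F (score t ?p x a) ?p (params M)"
    using regular assms(1-3) unfolding regular_policy_class_def by blast
  then have "(\<lambda>h. (?F (?p + h *\<^sub>R r) - ?F ?p) / h) \<midarrow>0\<rightarrow> score t ?p x a \<bullet> r"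
    unfolding has_gradient_within_def at[symmetric] by blast
  then show ?thesis by (simp add: DERIV_def scaleR_left_distrib add.assoc)
qed

definition score_bound :: real where
  "score_bound = (SOME C. \<forall>t<T. \<forall>\<theta>\<in>params M. \<forall>x\<in>X. \<forall>a\<in>A. norm (score t \<theta> x a) \<le> C)"

lemma score_bound:
  assumes "t < T" "\<theta>' \<in> params M" "x \<in> X" "a \<in> A"
  shows "\<bar>score t \<theta>' x a \<bullet> r\<bar> \<le> score_bound * norm r"
proof -
  have "\<exists>C. \<forall>t<T. \<forall>\<theta>\<in>params M. \<forall>x\<in>X. \<forall>a\<in>A. norm (score t \<theta> x a) \<le> C"
    using regular unfolding regular_policy_class_def by blast
  from someI_ex[OF this] have "norm (score t \<theta>' x a) \<le> score_bound"
    unfolding score_bound_def[symmetric] using assms by blast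
  then have "norm (score t \<theta>' x a) * norm r \<le> score_bound * norm r" by (intro mult_right_mono) auto
  then show ?thesis using Cauchy_Schwarz_ineq2[of "score t \<theta>' x a" r] by linarith
qed

abbreviation "ratio r t x a h \<equiv> dens M t (\<theta> + h *\<^sub>R r) x a / dens M t \<theta> x a"

lemma ratio_derivative:
  assumes "t < T" "x \<in> X" "a \<in> A"
  shows "(\<lambda>h. (ratio r t x a h - 1) / h) \<midarrow>0\<rightarrow> score t \<theta> x a \<bullet> r"
proof -
  let ?l = "\<lambda>h. ln (dens M t (\<theta> + h *\<^sub>R r) x a)"
  have l: "(?l has_field_derivative score t (\<theta> + 0 *\<^sub>R r) x a \<bullet> r) (at 0)"
    by (rule log_dens_derivative[OF assms]) (use interior in simp)
  have "((\<lambda>h. exp (?l h - ?l 0)) has_field_derivative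
      exp (?l 0 - ?l 0) * (score t (\<theta> + 0 *\<^sub>R r) x a \<bullet> r - 0)) (at 0)"
    by (intro DERIV_fun_exp DERIV_diff l DERIV_const)
  then have lim: "(\<lambda>h. (exp (?l h - ?l 0) - 1) / h) \<midarrow>0\<rightarrow> score t \<theta> x a \<bullet> r"
    by (simp add: DERIV_def)
  obtain h1 where h1: "h1 > 0" "\<And>h. \<bar>h\<bar> \<le> h1 \<Longrightarrow> \<theta> + h *\<^sub>R r \<in> interior (params M)"
    using interior_radius[of r] by blast
  have "\<forall>\<^sub>F h in at 0. (exp (?l h - ?l 0) - 1) / h = (ratio r t x a h - 1) / h"
    unfolding eventually_at
  proof (intro exI[of _ h1] conjI ballI impI)
    fix h :: real assume "h \<noteq> 0 \<and> dist h 0 < h1"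
    then have "\<theta> + h *\<^sub>R r \<in> params M" using h1(2)[of h] interior_subset by (auto simp: dist_real_def)
    then have "dens M t (\<theta> + h *\<^sub>R r) x a > 0" "dens M t \<theta> x a > 0"
      using dens_pos[OF assms(1) _ assms(2,3)] \<theta> by auto
    then show "(exp (?l h - ?l 0) - 1) / h = (ratio r t x a h - 1) / h" by (simp add: exp_diff)
  qed (rule h1)
  then show ?thesis using lim by (rule Lim_transform_eventually[rotated])
qed

text \<open>Mean value theorem for the log-density, exponentiated. The bounds do not depend on the
  action or on \<open>h\<close>, so they serve as majorants for dominated convergence. The absolute
  value in \<open>c\<close> makes it nonnegative whatever the sign of the chosen
  \<open>score_bound\<close>.\<close>

lemma ratio_bound:
  assumes "t < T" "x \<in> X" "a \<in> A" and h1: "\<And>h. \<bar>h\<bar> \<le> h1 \<Longrightarrow> \<theta> + h *\<^sub>R r \<in> interior (params M)"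
    and h: "\<bar>h\<bar> \<le> h1" "h \<noteq> 0"
  defines "c \<equiv> \<bar>score_bound\<bar> * norm r"
  shows "\<bar>ratio r t x a h\<bar> \<le> exp (c * h1)" and "\<bar>(ratio r t x a h - 1) / h\<bar> \<le> c * exp (c * h1)"
proof -
  let ?l = "\<lambda>h. ln (dens M t (\<theta> + h *\<^sub>R r) x a)"
  have pos: "dens M t (\<theta> + h *\<^sub>R r) x a > 0" "dens M t \<theta> x a > 0"
    using dens_pos[OF assms(1) _ assms(2,3)] \<theta> h1[OF h(1)] interior_subset by blast+
  have c: "c \<ge> 0" by (simp add: c_def)
  have "norm (?l h - ?l 0) \<le> c * norm (h - 0)"
  proof (rule field_differentiable_bound[of "{-h1..h1}"])
    fix z assume "z \<in> {-h1..h1}"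
    then have z: "\<theta> + z *\<^sub>R r \<in> interior (params M)" using h1[of z] by auto
    show "(?l has_field_derivative score t (\<theta> + z *\<^sub>R r) x a \<bullet> r) (at z within {-h1..h1})"
      by (rule has_field_derivative_at_within[OF log_dens_derivative[OF assms(1-3) z]])
    have "score_bound * norm r \<le> c" unfolding c_def by (intro mult_right_mono) auto
    then show "norm (score t (\<theta> + z *\<^sub>R r) x a \<bullet> r) \<le> c"
      using score_bound[OF assms(1) _ assms(2,3), of "\<theta> + z *\<^sub>R r" r] z interior_subset by force
  qed (use h in auto)
  then have w: "\<bar>?l h - ?l 0\<bar> \<le> c * \<bar>h\<bar>" by simp
  also have "\<dots> \<le> c * h1" using h c by (intro mult_left_mono)
  finally have w': "\<bar>?l h - ?l 0\<bar> \<le> c * h1" .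
  have ratio: "ratio r t x a h = exp (?l h - ?l 0)" using pos by (simp add: exp_diff)
  show "\<bar>ratio r t x a h\<bar> \<le> exp (c * h1)" unfolding ratio using w' by simp
  have "\<bar>ratio r t x a h - 1\<bar> \<le> \<bar>?l h - ?l 0\<bar> * exp \<bar>?l h - ?l 0\<bar>"
    unfolding ratio by (rule abs_exp_minus_one_le)
  also have "\<dots> \<le> (c * \<bar>h\<bar>) * exp (c * h1)" using w w' c by (intro mult_mono) auto
  finally show "\<bar>(ratio r t x a h - 1) / h\<bar> \<le> c * exp (c * h1)"
    using h(2) by (simp add: abs_divide divide_le_eq mult_ac)
qed

text \<open>The score is known only through its derivative property, so its measurability in state
  and action comes from being the pointwise limit of measurable ratio quotients along
  \<open>h1 / (n + 1)\<close>.\<close>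

lemma score_measurable:
  assumes t: "t < T"
  shows "(\<lambda>(x, a). score t \<theta> x a \<bullet> r) \<in> borel_measurable (MX \<Otimes>\<^sub>M MA)"
proof -
  obtain h1 where h1: "h1 > 0" "\<And>h. \<bar>h\<bar> \<le> h1 \<Longrightarrow> \<theta> + h *\<^sub>R r \<in> interior (params M)"
    using interior_radius[of r] by blast
  define h where "h n = h1 / real (Suc n)" for n
  have h: "h n \<noteq> 0" "\<bar>h n\<bar> \<le> h1" for n using h1(1) by (auto simp: h_def field_simps)
  have "h \<longlonglongrightarrow> 0" unfolding h_def[abs_def] using tendsto_mult_right_zero[OF LIMSEQ_inverse_real_of_nat, of h1]
    by (simp add: divide_inverse)
  show ?thesis
  proof (rule borel_measurable_LIMSEQ_real)
    fix n
    have "\<theta> + h n *\<^sub>R r \<in> params M" using h1(2)[OF h(2)] interior_subset by blast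
    from dens_measurable[OF t this] dens_measurable[OF t \<theta>]
    have "(\<lambda>u. (ratio r t (fst u) (snd u) (h n) - 1) / h n) \<in> borel_measurable (MX \<Otimes>\<^sub>M MA)"
      unfolding split_beta' by measurable
    then show "(\<lambda>(x, a). (ratio r t x a (h n) - 1) / h n) \<in> borel_measurable (MX \<Otimes>\<^sub>M MA)"
      by (simp add: split_beta')
  next
    fix u assume "u \<in> space (MX \<Otimes>\<^sub>M MA)"
    then have "fst u \<in> X" "snd u \<in> A" by (auto simp: space_pair_measure)
    from ratio_derivative[OF t this, of r, folded LIMSEQ_SEQ_conv, rule_format, of h] h(1) \<open>h \<longlonglongrightarrow> 0\<close>
    have "(\<lambda>n. (ratio r t (fst u) (snd u) (h n) - 1) / h n) \<longlonglongrightarrow> score t \<theta> (fst u) (snd u) \<bullet> r"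
      by simp
    then show "(\<lambda>n. (\<lambda>(x, a). (ratio r t x a (h n) - 1) / h n) u) \<longlonglongrightarrow> (\<lambda>(x, a). score t \<theta> x a \<bullet> r) u"
      by (simp add: split_beta')
  qed
qed

end

section \<open>The policy gradient\<close>

lemma equicontinuous_on_subset: "equicontinuous_on S F \<Longrightarrow> G \<subseteq> F \<Longrightarrow> equicontinuous_on S G"
  unfolding equicontinuous_on_def by (meson subsetD)

context gradient_point
begin

abbreviation "dq r h s n x \<equiv> (value_fun M s (\<theta> + h n *\<^sub>R r) x - value_fun M s \<theta> x) / h n"

section \<open>Differentiating the robust one-step value\<close>

lemma Pstar_kernel: "t < T \<Longrightarrow> Pstar t \<in> MX \<Otimes>\<^sub>M MA \<rightarrow>\<^sub>M prob_algebra MX"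
  using worst_case by (auto simp: worst_case_selector_def transition_kernel_def)

text \<open>The push-forward kernel is a feasible competitor attaining the dual value, and weak
  duality gives the opposite bound. Nothing else about the selector is used later beyond its being a
  kernel.\<close>

lemma Pstar:
  assumes t: "t < T" and u: "u \<in> X \<times> A"
  shows "Pstar t u \<in> ambiguity_set M t (fst u) (snd u)"
    and "(\<integral>y. cont_value M t \<theta> (fst u) (snd u) y \<partial>Pstar t u) = dual_value M t \<theta> (fst u) (snd u)"
proof -
  interpret d: dual_step M score \<Lambda> t \<theta> by (rule dual_step[OF t \<theta>])
  have "is_arg_min (\<lambda>P. \<integral>y. d.cv u y \<partial>P) (\<lambda>P. P \<in> ambiguity_set M t (fst u) (snd u)) (Pstar t (fst u, snd u))"
    using worst_case t u unfolding worst_case_selector_def by auto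
  then have *: "Pstar t u \<in> ambiguity_set M t (fst u) (snd u)"
    "\<And>P. P \<in> ambiguity_set M t (fst u) (snd u) \<Longrightarrow> (\<integral>y. d.cv u y \<partial>Pstar t u) \<le> (\<integral>y. d.cv u y \<partial>P)"
    by (auto simp: is_arg_min_linorder)
  show "Pstar t u \<in> ambiguity_set M t (fst u) (snd u)" by (rule *)
  show "(\<integral>y. d.cv u y \<partial>Pstar t u) = d.G u"
    using *(2)[OF d.worst_kernel(1)[OF u]] d.worst_kernel(2)[OF u] d.dual_value_le[OF u *(1)] by simp
qed

text \<open>Danskin's argument: testing the robust problem at each of the two parameters with the
  minimizer of the other one bounds the difference quotient of the optimal value on both sides.\<close>

lemma danskin_sandwich:
  assumes t: "t < T" and u: "u \<in> X \<times> A" and \<theta>': "\<theta>' \<in> params M" and h: "h \<noteq> 0"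
  defines "\<Delta> \<equiv> \<lambda>y. (value_fun M (Suc t) \<theta>' y - value_fun M (Suc t) \<theta> y) / h"
    and "G \<equiv> \<lambda>\<theta>. dual_value M t \<theta> (fst u) (snd u)"
  obtains P where "P \<in> ambiguity_set M t (fst u) (snd u)"
    "min (\<integral>y. \<Delta> y \<partial>Pstar t u) (\<integral>y. \<Delta> y \<partial>P) \<le> (G \<theta>' - G \<theta>) / h"
    "(G \<theta>' - G \<theta>) / h \<le> max (\<integral>y. \<Delta> y \<partial>Pstar t u) (\<integral>y. \<Delta> y \<partial>P)"
    "(\<integral>y. cont_value M t \<theta> (fst u) (snd u) y \<partial>P) - G \<theta> \<le> \<bar>h\<bar> * \<bar>(\<integral>y. \<Delta> y \<partial>Pstar t u) - (\<integral>y. \<Delta> y \<partial>P)\<bar>"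
proof -
  interpret d: dual_step M score \<Lambda> t \<theta> by (rule dual_step[OF t \<theta>])
  interpret d': dual_step M score \<Lambda> t \<theta>' by (rule dual_step[OF t \<theta>'])
  have \<Delta>: "continuous_on X \<Delta>"
    unfolding \<Delta>_def by (intro continuous_intros d.next_cont d'.next_cont h ballI)
  have split: "(\<integral>y. d'.cv u y \<partial>P) = (\<integral>y. d.cv u y \<partial>P) + h * (\<integral>y. \<Delta> y \<partial>P)"
    if "P \<in> ambiguity_set M t (fst u) (snd u)" for P
  proof -
    have P: "P \<in> probs_on X" using that by (simp add: ambiguity_set_def probs_on_def)
    have "(\<integral>y. d'.cv u y \<partial>P) = (\<integral>y. d.cv u y + h * \<Delta> y \<partial>P)"
      using h by (intro Bochner_Integration.integral_cong) (auto simp: cont_value_def \<Delta>_def)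
    also have "\<dots> = (\<integral>y. d.cv u y \<partial>P) + h * (\<integral>y. \<Delta> y \<partial>P)"
      using integrable_continuous_probs_on[OF X(1) P d.continuous_on_cv[OF u]]
        integrable_continuous_probs_on[OF X(1) P \<Delta>] by simp
    finally show ?thesis .
  qed
  \<comment> \<open>The minimizer at the other parameter. It is feasible at \<theta> too, because
    the ambiguity set depends only on the nominal kernel and the radius.\<close>
  define P where "P = worst_kernel t \<theta>' u"
  have P: "P \<in> ambiguity_set M t (fst u) (snd u)" and GP: "G \<theta>' = (\<integral>y. d'.cv u y \<partial>P)"
    using d'.worst_kernel[OF u] by (simp_all add: P_def G_def)
  note S = Pstar[OF t u]
  let ?I = "\<integral>y. \<Delta> y \<partial>Pstar t u" and ?J = "\<integral>y. \<Delta> y \<partial>P"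
  have up: "G \<theta>' - G \<theta> \<le> h * ?I"
    using d'.dual_value_le[OF u S(1)] split[OF S(1)] S(2) by (simp add: G_def)
  have eq: "G \<theta>' - G \<theta> = ((\<integral>y. d.cv u y \<partial>P) - G \<theta>) + h * ?J"
    using split[OF P] GP by simp
  have low: "0 \<le> (\<integral>y. d.cv u y \<partial>P) - G \<theta>" using d.dual_value_le[OF u P] by (simp add: G_def)
  have "h * (?I - ?J) \<le> \<bar>h\<bar> * \<bar>?I - ?J\<bar>" by (metis abs_ge_self abs_mult)
  then have 3: "(\<integral>y. d.cv u y \<partial>P) - G \<theta> \<le> \<bar>h\<bar> * \<bar>?I - ?J\<bar>"
    using up eq by (simp add: algebra_simps)
  \<comment> \<open>Dividing by \<open>h\<close> reverses the inequalities when \<open>h\<close> is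
    negative, so which law gives the upper bound depends on the sign; \<open>min\<close> and
    \<open>max\<close> cover both cases.\<close>
  have "min ?I ?J \<le> (G \<theta>' - G \<theta>) / h \<and> (G \<theta>' - G \<theta>) / h \<le> max ?I ?J"
  proof (cases "h > 0")
    case True
    then have "?J \<le> (G \<theta>' - G \<theta>) / h" "(G \<theta>' - G \<theta>) / h \<le> ?I"
      using up eq low by (simp_all add: field_simps)
    then show ?thesis by auto
  next
    case False
    then have "h < 0" using h by simp
    then have "?I \<le> (G \<theta>' - G \<theta>) / h" "(G \<theta>' - G \<theta>) / h \<le> ?J"
      using up eq low by (simp_all add: field_simps)
    then show ?thesis by auto
  qed
  with that[OF P] 3 show ?thesis by blast
qed

text \<open>The perturbed minimizers have optimality gap at most
  \<open>2 * b * \<bar>h n\<bar>\<close>, which tends to 0. By stability they and the selector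
  integrate the limit \<open>w\<close> almost like the same push-forward, so both ends of the
  sandwich converge to the integral under the selector.\<close>

lemma danskin:
  assumes t: "t < T" and u: "u \<in> X \<times> A"
    and h: "\<And>n. h n \<noteq> 0" "h \<longlonglongrightarrow> 0" "\<And>n. \<theta> + h n *\<^sub>R r \<in> params M"
    and lim: "uniform_limit X (dq r h (Suc t)) w sequentially" and w: "continuous_on X w"
    and b: "\<And>n y. y \<in> X \<Longrightarrow> \<bar>dq r h (Suc t) n y\<bar> \<le> b"
  defines "q \<equiv> \<lambda>n. (dual_value M t (\<theta> + h n *\<^sub>R r) (fst u) (snd u) - dual_value M t \<theta> (fst u) (snd u)) / h n"
  shows "q \<longlonglongrightarrow> (\<integral>y. w y \<partial>Pstar t u)" and "\<bar>q n\<bar> \<le> b"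
proof -
  interpret d: dual_step M score \<Lambda> t \<theta> by (rule dual_step[OF t \<theta>])
  let ?amb = "ambiguity_set M t (fst u) (snd u)"
  let ?\<Delta> = "dq r h (Suc t)"
  let ?S = "Pstar t u"
  note S = Pstar[OF t u]
  have "\<forall>n. \<exists>P. P \<in> ?amb \<and> min (\<integral>y. ?\<Delta> n y \<partial>?S) (\<integral>y. ?\<Delta> n y \<partial>P) \<le> q n
      \<and> q n \<le> max (\<integral>y. ?\<Delta> n y \<partial>?S) (\<integral>y. ?\<Delta> n y \<partial>P)
      \<and> (\<integral>y. d.cv u y \<partial>P) - d.G u \<le> \<bar>h n\<bar> * \<bar>(\<integral>y. ?\<Delta> n y \<partial>?S) - (\<integral>y. ?\<Delta> n y \<partial>P)\<bar>"
  proof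
    fix n
    show "\<exists>P. P \<in> ?amb \<and> min (\<integral>y. ?\<Delta> n y \<partial>?S) (\<integral>y. ?\<Delta> n y \<partial>P) \<le> q n
      \<and> q n \<le> max (\<integral>y. ?\<Delta> n y \<partial>?S) (\<integral>y. ?\<Delta> n y \<partial>P)
      \<and> (\<integral>y. d.cv u y \<partial>P) - d.G u \<le> \<bar>h n\<bar> * \<bar>(\<integral>y. ?\<Delta> n y \<partial>?S) - (\<integral>y. ?\<Delta> n y \<partial>P)\<bar>"
      unfolding q_def by (rule danskin_sandwich[OF t u h(3)[of n] h(1)[of n]], intro exI conjI; assumption)
  qed
  from choice[OF this] obtain P where
    P': "\<forall>n. P n \<in> ?amb \<and> min (\<integral>y. ?\<Delta> n y \<partial>?S) (\<integral>y. ?\<Delta> n y \<partial>P n) \<le> q n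
      \<and> q n \<le> max (\<integral>y. ?\<Delta> n y \<partial>?S) (\<integral>y. ?\<Delta> n y \<partial>P n)
      \<and> (\<integral>y. d.cv u y \<partial>P n) - d.G u \<le> \<bar>h n\<bar> * \<bar>(\<integral>y. ?\<Delta> n y \<partial>?S) - (\<integral>y. ?\<Delta> n y \<partial>P n)\<bar>" ..
  have P: "P n \<in> ?amb"
    and lo: "min (\<integral>y. ?\<Delta> n y \<partial>?S) (\<integral>y. ?\<Delta> n y \<partial>P n) \<le> q n"
    and up: "q n \<le> max (\<integral>y. ?\<Delta> n y \<partial>?S) (\<integral>y. ?\<Delta> n y \<partial>P n)"
    and ex: "(\<integral>y. d.cv u y \<partial>P n) - d.G u \<le> \<bar>h n\<bar> * \<bar>(\<integral>y. ?\<Delta> n y \<partial>?S) - (\<integral>y. ?\<Delta> n y \<partial>P n)\<bar>" for n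
    using P'[rule_format, of n] by simp_all
  have amb: "P' \<in> probs_on X" if "P' \<in> ?amb" for P'
    using that by (simp add: ambiguity_set_def probs_on_def)
  have cont: "continuous_on X (?\<Delta> n)" for n
    using continuous_on_value_fun[OF h(3), of "Suc t" n] d.next_cont t h(1)
    by (intro continuous_intros) auto
  have I: "\<bar>\<integral>y. ?\<Delta> n y \<partial>P'\<bar> \<le> b" if "P' \<in> ?amb" for n P'
    by (rule integrable_bounded_prob_algebra(2)[OF amb[OF that, unfolded probs_on_def]
          borel_measurable_continuous_on_restrict[OF cont]]) (use b in auto)
  show "\<bar>q n\<bar> \<le> b"
    using lo[of n] up[of n] I[OF S(1), of n] I[OF P, of n n] by linarith
  show "q \<longlonglongrightarrow> (\<integral>y. w y \<partial>?S)"
  proof (rule LIMSEQ_I)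
    fix e :: real assume e: "e > 0"
    \<comment> \<open>\<open>C\<close> is fixed before \<open>n\<close>, so the gap term can be made
      small afterwards. Budget: \<open>e / 4\<close> for uniform convergence, \<open>e / 4\<close>
      for the perturbed minimizer and \<open>e / 8\<close> for the selector, which is less than
      \<open>e\<close>.\<close>
    obtain C where C: "C \<ge> 0" "\<And>P'. P' \<in> ?amb \<Longrightarrow>
        \<bar>(\<integral>y. w y \<partial>P') - (\<integral>x'. w (y_star t \<theta> u x') \<partial>nominal M t u)\<bar> \<le> e / 8 + C * ((\<integral>y. d.cv u y \<partial>P') - d.G u)"
      using d.stability_bound[OF u w, of "e / 8"] e by auto
    have "(\<lambda>n. C * (\<bar>h n\<bar> * (2 * b))) \<longlonglongrightarrow> C * (\<bar>0\<bar> * (2 * b))"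
      by (intro tendsto_intros h(2))
    then have "\<forall>\<^sub>F n in sequentially. C * (\<bar>h n\<bar> * (2 * b)) < e / 8"
      using e by (intro order_tendstoD(2)) auto
    moreover have "\<forall>\<^sub>F n in sequentially. \<forall>y\<in>X. dist (?\<Delta> n y) (w y) < e / 4"
      using uniform_limitD[OF lim, of "e / 4"] e by simp
    ultimately have "\<forall>\<^sub>F n in sequentially. norm (q n - (\<integral>y. w y \<partial>?S)) < e"
    proof eventually_elim
      fix n assume n: "C * (\<bar>h n\<bar> * (2 * b)) < e / 8" "\<forall>y\<in>X. dist (?\<Delta> n y) (w y) < e / 4"
      have close: "\<bar>(\<integral>y. ?\<Delta> n y \<partial>P') - (\<integral>y. w y \<partial>P')\<bar> \<le> e / 4" if "P' \<in> ?amb" for P'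
        using n(2) probs_onD[OF amb[OF that]]
        by (intro abs_integral_diff_le integrable_continuous_probs_on[OF X(1) amb[OF that]] cont w)
           (auto simp: dist_real_def intro: less_imp_le)
      have "\<bar>(\<integral>y. ?\<Delta> n y \<partial>?S) - (\<integral>y. ?\<Delta> n y \<partial>P n)\<bar> \<le> 2 * b"
        using I[OF S(1), of n] I[OF P, of n n] by linarith
      then have "\<bar>h n\<bar> * \<bar>(\<integral>y. ?\<Delta> n y \<partial>?S) - (\<integral>y. ?\<Delta> n y \<partial>P n)\<bar> \<le> \<bar>h n\<bar> * (2 * b)"
        by (intro mult_left_mono) auto
      with ex[of n] have "(\<integral>y. d.cv u y \<partial>P n) - d.G u \<le> \<bar>h n\<bar> * (2 * b)" by linarith
      then have "C * ((\<integral>y. d.cv u y \<partial>P n) - d.G u) \<le> C * (\<bar>h n\<bar> * (2 * b))"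
        using C(1) by (rule mult_left_mono)
      then have "\<bar>(\<integral>y. w y \<partial>P n) - (\<integral>x'. w (y_star t \<theta> u x') \<partial>nominal M t u)\<bar> \<le> e / 4"
        using C(2)[OF P, of n] n(1) by linarith
      \<comment> \<open>The selector attains the dual value, so its gap vanishes and only the fixed
        error remains.\<close>
      moreover have "\<bar>(\<integral>y. w y \<partial>?S) - (\<integral>x'. w (y_star t \<theta> u x') \<partial>nominal M t u)\<bar> \<le> e / 8"
        using C(2)[OF S(1)] S(2) by simp
      ultimately have "\<bar>q n - (\<integral>y. w y \<partial>?S)\<bar> < e"
        using close[OF S(1)] close[OF P, of n] lo[of n] up[of n] e by linarith
      then show "norm (q n - (\<integral>y. w y \<partial>?S)) < e" by simp
    qed
    then show "\<exists>no. \<forall>n\<ge>no. norm (q n - (\<integral>y. w y \<partial>?S)) < e"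
      by (simp add: eventually_sequentially)
  qed
qed

section \<open>Backward recursion for the directional derivative\<close>

definition grad_reward :: "'p \<Rightarrow> nat \<Rightarrow> 'x \<Rightarrow> 'a \<Rightarrow> 'x \<Rightarrow> real" where
  "grad_reward r t x a y = dual_value M t \<theta> x a * (score t \<theta> x a \<bullet> r)"

lemma dual_value_measurable:
  assumes "t < T" "\<theta>' \<in> params M"
  shows "(\<lambda>(x, a). dual_value M t \<theta>' x a) \<in> borel_measurable (MX \<Otimes>\<^sub>M MA)"
proof -
  interpret d: dual_step M score \<Lambda> t \<theta>' by (rule dual_step[OF assms])
  have "(\<lambda>p. d.G (fst p, snd p)) \<in> borel_measurable (MX \<Otimes>\<^sub>M MA)"
  proof (rule measurable_continuous_on_compose[OF d.continuous_on_dual_value])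
    show "(\<lambda>p. (fst p, snd p)) \<in> borel_measurable (MX \<Otimes>\<^sub>M MA)"
      by (intro borel_measurable_Pair measurable_fst_restrict_borel measurable_snd_restrict_borel)
  qed (auto simp: space_pair_measure)
  then show ?thesis by (simp add: split_beta')
qed

lemma dual_value_bounded:
  assumes "t < T" "\<theta>' \<in> params M"
  obtains b where "b \<ge> 0" "\<And>x a. x \<in> X \<Longrightarrow> a \<in> A \<Longrightarrow> \<bar>dual_value M t \<theta>' x a\<bar> \<le> b"
proof -
  interpret d: dual_step M score \<Lambda> t \<theta>' by (rule dual_step[OF assms])
  obtain b where "b \<ge> 0" "\<And>u. u \<in> X \<times> A \<Longrightarrow> \<bar>d.G u\<bar> \<le> b"
    using compact_continuous_bounded[OF compact_Times[OF X(1) A(1)] d.continuous_on_dual_value] by blast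
  then show ?thesis using that[of b] by force
qed

lemma grad_rewards: "\<exists>B. path_rewards MX MA (policy M \<theta>) Pstar 0 T (grad_reward r) (\<lambda>_. 0) B"
proof -
  have "\<exists>b\<ge>0. \<forall>x\<in>X. \<forall>a\<in>A. \<bar>dual_value M t \<theta> x a\<bar> \<le> b" if "t < T" for t
    by (rule dual_value_bounded[OF that \<theta>]) blast
  then obtain b where b: "\<And>t. t < T \<Longrightarrow> b t \<ge> (0::real)"
    "\<And>t x a. t < T \<Longrightarrow> x \<in> X \<Longrightarrow> a \<in> A \<Longrightarrow> \<bar>dual_value M t \<theta> x a\<bar> \<le> b t"
    by metis
  define B where "B = sum b {..<T} * (\<bar>score_bound\<bar> * norm r)"
  have s0: "sum b {..<T} \<ge> 0" using b by (intro sum_nonneg) auto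
  show ?thesis
  proof (intro exI[of _ B], unfold_locales)
    fix t :: nat assume t: "t < T"
    show "policy M \<theta> t \<in> MX \<rightarrow>\<^sub>M prob_algebra MA" by (rule policy_kernel[OF t \<theta>])
    show "Pstar t \<in> MX \<Otimes>\<^sub>M MA \<rightarrow>\<^sub>M prob_algebra MX" by (rule Pstar_kernel[OF t])
    have "(\<lambda>p. (fst p, fst (snd p))) \<in> MX \<Otimes>\<^sub>M MA \<Otimes>\<^sub>M MX \<rightarrow>\<^sub>M MX \<Otimes>\<^sub>M MA" by simp
    from measurable_compose[OF this dual_value_measurable[OF t \<theta>]] measurable_compose[OF this score_measurable[OF t, of r]]
    show "(\<lambda>(x, a, y). grad_reward r t x a y) \<in> borel_measurable (MX \<Otimes>\<^sub>M MA \<Otimes>\<^sub>M MX)"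
      unfolding grad_reward_def split_beta' by simp
    show "\<bar>grad_reward r t x a y\<bar> \<le> B" if "x \<in> space MX" "a \<in> space MA" "y \<in> space MX" for x a y
    proof -
      have "b t \<le> sum b {..<T}" by (rule member_le_sum) (use b t in auto)
      then have "\<bar>dual_value M t \<theta> x a\<bar> \<le> sum b {..<T}" using b(2)[OF t, of x a] that by simp
      moreover have "\<bar>score t \<theta> x a \<bullet> r\<bar> \<le> \<bar>score_bound\<bar> * norm r"
        using score_bound[OF t \<theta>, of x a r] that mult_right_mono[OF abs_ge_self[of score_bound] norm_ge_zero[of r]]
        by simp
      ultimately show ?thesis
        unfolding grad_reward_def B_def abs_mult using s0 by (intro mult_mono) auto
    qed
  qed (auto simp: B_def s0)
qed

definition grad_bound :: "'p \<Rightarrow> real" where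
  "grad_bound r = (SOME B. path_rewards MX MA (policy M \<theta>) Pstar 0 T (grad_reward r) (\<lambda>_. 0) B)"

lemma path_rewards_grad:
  "path_rewards MX MA (policy M \<theta>) Pstar 0 T (grad_reward r) (\<lambda>_. 0) (grad_bound r)"
  using someI_ex[OF grad_rewards[of r]] unfolding grad_bound_def .

text \<open>The candidate derivative of the value function in direction \<open>r\<close>: casting
  the summand of the gradient formula as a running reward makes the one-step recursion for expected
  returns available under the worst-case path law.\<close>

abbreviation "grad r n t x \<equiv> expected_return MX MA (policy M \<theta>) Pstar (grad_reward r) (\<lambda>_. 0) n t x"

text \<open>Under the fixed policy at \<theta> the perturbed value integrates a density ratio times
  the perturbed \<open>G\<close>. The product rule splits its quotient: \<open>danskin\<close>
  treats the increment of \<open>G\<close>, the score treats the increment of the ratio, and both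
  terms have constant majorants.\<close>

lemma gradient_step:
  assumes t: "t < T" and x: "x \<in> X"
    and h: "\<And>n. h n \<noteq> 0" "h \<longlonglongrightarrow> 0" "\<And>n. \<bar>h n\<bar> \<le> h1"
    and h1: "\<And>h. \<bar>h\<bar> \<le> h1 \<Longrightarrow> \<theta> + h *\<^sub>R r \<in> interior (params M)"
    and lim: "uniform_limit X (dq r h (Suc t)) w sequentially" and w: "continuous_on X w"
  shows "(\<lambda>n. dq r h t n x) \<longlonglongrightarrow>
    (\<integral>a. (\<integral>y. grad_reward r t x a y + w y \<partial>Pstar t (x, a)) \<partial>policy M \<theta> t x)"
proof -
  interpret d: dual_step M score \<Lambda> t \<theta> by (rule dual_step[OF t \<theta>])
  have hp: "\<theta> + h n *\<^sub>R r \<in> params M" for n using h1[OF h(3)] interior_subset by blast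
  have cont: "continuous_on X (dq r h (Suc t) n)" for n
    using continuous_on_value_fun[OF hp, of "Suc t" n] d.next_cont t h(1)
    by (intro continuous_intros) auto
  obtain b where b: "\<And>n y. y \<in> X \<Longrightarrow> \<bar>dq r h (Suc t) n y\<bar> \<le> b"
    using uniform_limit_uniformly_bounded[OF X(1) lim w cont] by blast
  let ?\<rho> = "\<lambda>n a. ratio r t x a (h n)"
  let ?G = "\<lambda>\<theta> a. dual_value M t \<theta> x a"
  define q where "q n a = (?G (\<theta> + h n *\<^sub>R r) a - ?G \<theta> a) / h n" for n a
  have q: "(\<lambda>n. q n a) \<longlonglongrightarrow> (\<integral>y. w y \<partial>Pstar t (x, a))" "\<bar>q n a\<bar> \<le> b" if "a \<in> A" for n a
    using danskin[OF t _ h(1,2) hp lim w b, of "(x, a)"] that x unfolding q_def by auto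
  obtain g where g: "g \<ge> 0" "\<And>a. a \<in> A \<Longrightarrow> \<bar>?G \<theta> a\<bar> \<le> g"
    using dual_value_bounded[OF t \<theta>] x by metis
  define c where "c = \<bar>score_bound\<bar> * norm r"
  have \<rho>: "\<bar>?\<rho> n a\<bar> \<le> exp (c * h1)" "\<bar>(?\<rho> n a - 1) / h n\<bar> \<le> c * exp (c * h1)" if "a \<in> A" for n a
    using ratio_bound[OF t x that h1 h(3)[of n] h(1)[of n]] by (simp_all add: c_def)
  have \<rho>lim: "(\<lambda>n. (?\<rho> n a - 1) / h n) \<longlonglongrightarrow> score t \<theta> x a \<bullet> r" if "a \<in> A" for a
    using ratio_derivative[OF t x that, of r, folded LIMSEQ_SEQ_conv, rule_format, of h] h(1,2) by simp
  have \<rho>1: "(\<lambda>n. ?\<rho> n a) \<longlonglongrightarrow> 1" if "a \<in> A" for a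
  proof -
    have "(\<lambda>n. h n * ((?\<rho> n a - 1) / h n) + 1) \<longlonglongrightarrow> 0 * (score t \<theta> x a \<bullet> r) + 1"
      by (intro tendsto_intros h(2) \<rho>lim that)
    then show ?thesis using h(1) by simp
  qed
  note pol = policy_probs[OF t \<theta> x]
  have [measurable_cong]: "sets (policy M \<theta> t x) = sets MA" using probs_onD(2)[OF pol] .
  have Gm: "?G \<theta>' \<in> borel_measurable MA" if "\<theta>' \<in> params M" for \<theta>'
  proof -
    have "Pair x \<in> MA \<rightarrow>\<^sub>M MX \<Otimes>\<^sub>M MA" using x by simp
    from measurable_compose[OF this dual_value_measurable[OF t that]] show ?thesis by simp
  qed
  note [measurable] = Gm[OF \<theta>] Gm[OF hp] dens_section_measurable[OF t \<theta> x] dens_section_measurable[OF t hp x]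
  have qm [measurable]: "q n \<in> borel_measurable MA" for n unfolding q_def by measurable
  \<comment> \<open>Discrete product rule: the increment of \<open>G\<close> is weighted by the
    perturbed ratio, which tends to 1, and the increment of the ratio by the unperturbed
    \<open>G\<close>.\<close>
  define s where "s n a = q n a * ?\<rho> n a + ?G \<theta> a * ((?\<rho> n a - 1) / h n)" for n a
  have [measurable]: "s n \<in> borel_measurable MA" for n unfolding s_def by measurable
  have dq: "dq r h t n x = (\<integral>a. s n a \<partial>policy M \<theta> t x)" for n
  proof -
    obtain g' where g': "g' \<ge> 0" "\<And>a. a \<in> A \<Longrightarrow> \<bar>?G (\<theta> + h n *\<^sub>R r) a\<bar> \<le> g'"
      using dual_value_bounded[OF t hp[of n]] x by metis
    have "integrable (policy M \<theta> t x) (\<lambda>a. ?\<rho> n a * ?G (\<theta> + h n *\<^sub>R r) a)"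
    proof (rule integrable_bounded_probs_on[OF pol])
      show "\<bar>?\<rho> n a * ?G (\<theta> + h n *\<^sub>R r) a\<bar> \<le> exp (c * h1) * g'" if "a \<in> A" for a
        unfolding abs_mult using \<rho>(1)[OF that, of n] g'(2)[OF that] by (intro mult_mono) auto
    qed measurable
    moreover have "integrable (policy M \<theta> t x) (\<lambda>a. ?G \<theta> a)"
      by (rule integrable_bounded_probs_on[OF pol Gm[OF \<theta>] g(2)])
    moreover have "value_fun M t (\<theta> + h n *\<^sub>R r) x
        = (\<integral>a. ?\<rho> n a * ?G (\<theta> + h n *\<^sub>R r) a \<partial>policy M \<theta> t x)"
      unfolding bellman[OF hp t x] by (rule integral_policy[OF t \<theta> x hp x Gm[OF hp]])
    ultimately have "dq r h t n x
        = (\<integral>a. (?\<rho> n a * ?G (\<theta> + h n *\<^sub>R r) a - ?G \<theta> a) / h n \<partial>policy M \<theta> t x)"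
      by (simp add: bellman[OF \<theta> t x])
    also have "\<dots> = (\<integral>a. s n a \<partial>policy M \<theta> t x)"
    proof -
      have "(\<rho> * G' - G0) / h n = (G' - G0) / h n * \<rho> + G0 * ((\<rho> - 1) / h n)" for \<rho> G' G0 :: real
        using h(1)[of n] by (simp add: field_simps)
      then show ?thesis by (simp only: s_def q_def)
    qed
    finally show ?thesis .
  qed
  have wm: "(\<lambda>a. \<integral>y. w y \<partial>Pstar t (x, a)) \<in> borel_measurable MA"
  proof -
    have "Pair x \<in> MA \<rightarrow>\<^sub>M MX \<Otimes>\<^sub>M MA" using x by simp
    from measurable_compose[OF measurable_prob_algebraD[OF measurable_compose[OF this Pstar_kernel[OF t]]]
        integral_measurable_subprob_algebra[OF borel_measurable_continuous_on_restrict[OF w]]]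
    show ?thesis .
  qed
  have sm: "(\<lambda>a. score t \<theta> x a \<bullet> r) \<in> borel_measurable MA"
  proof -
    have "Pair x \<in> MA \<rightarrow>\<^sub>M MX \<Otimes>\<^sub>M MA" using x by simp
    from measurable_compose[OF this score_measurable[OF t]] show ?thesis by simp
  qed
  note [measurable] = wm sm
  interpret pol: prob_space "policy M \<theta> t x" by (rule probs_onD(1)[OF pol])
  have "(\<lambda>n. \<integral>a. s n a \<partial>policy M \<theta> t x) \<longlonglongrightarrow>
      (\<integral>a. (\<integral>y. w y \<partial>Pstar t (x, a)) + ?G \<theta> a * (score t \<theta> x a \<bullet> r) \<partial>policy M \<theta> t x)"
  proof (rule integral_dominated_convergence)
    show "integrable (policy M \<theta> t x) (\<lambda>a. b * exp (c * h1) + g * (c * exp (c * h1)))" by simp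
    show "AE a in policy M \<theta> t x. (\<lambda>n. s n a) \<longlonglongrightarrow>
        (\<integral>y. w y \<partial>Pstar t (x, a)) + ?G \<theta> a * (score t \<theta> x a \<bullet> r)"
    proof (rule AE_I2)
      fix a assume "a \<in> space (policy M \<theta> t x)"
      then have a: "a \<in> A" using probs_onD(3)[OF pol] by simp
      have "(\<lambda>n. s n a) \<longlonglongrightarrow> (\<integral>y. w y \<partial>Pstar t (x, a)) * 1 + ?G \<theta> a * (score t \<theta> x a \<bullet> r)"
        unfolding s_def by (intro tendsto_intros q(1) \<rho>1 \<rho>lim a)
      then show "(\<lambda>n. s n a) \<longlonglongrightarrow> (\<integral>y. w y \<partial>Pstar t (x, a)) + ?G \<theta> a * (score t \<theta> x a \<bullet> r)"
        by simp
    qed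
    show "AE a in policy M \<theta> t x. norm (s n a) \<le> b * exp (c * h1) + g * (c * exp (c * h1))" for n
    proof (rule AE_I2)
      fix a assume "a \<in> space (policy M \<theta> t x)"
      then have a: "a \<in> A" using probs_onD(3)[OF pol] by simp
      have "b \<ge> 0" using q(2)[OF a, of n] by linarith
      then have "\<bar>q n a * ?\<rho> n a\<bar> \<le> b * exp (c * h1)"
        unfolding abs_mult using q(2)[OF a] \<rho>(1)[OF a] by (intro mult_mono) auto
      moreover have "\<bar>?G \<theta> a * ((?\<rho> n a - 1) / h n)\<bar> \<le> g * (c * exp (c * h1))"
        unfolding abs_mult using g(2)[OF a] \<rho>(2)[OF a] g(1) by (intro mult_mono) auto
      ultimately show "norm (s n a) \<le> b * exp (c * h1) + g * (c * exp (c * h1))"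
        unfolding s_def real_norm_def by linarith
    qed
  qed measurable
  moreover have "(\<integral>a. (\<integral>y. w y \<partial>Pstar t (x, a)) + ?G \<theta> a * (score t \<theta> x a \<bullet> r) \<partial>policy M \<theta> t x)
      = (\<integral>a. (\<integral>y. grad_reward r t x a y + w y \<partial>Pstar t (x, a)) \<partial>policy M \<theta> t x)"
  proof (rule Bochner_Integration.integral_cong[OF refl])
    fix a assume "a \<in> space (policy M \<theta> t x)"
    then have a: "a \<in> A" using probs_onD(3)[OF pol] by simp
    have P: "Pstar t (x, a) \<in> probs_on X"
      using Pstar(1)[OF t, of "(x, a)"] x a by (simp add: ambiguity_set_def probs_on_def)
    interpret P: prob_space "Pstar t (x, a)" by (rule probs_onD(1)[OF P])
    show "(\<integral>y. w y \<partial>Pstar t (x, a)) + ?G \<theta> a * (score t \<theta> x a \<bullet> r)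
        = (\<integral>y. grad_reward r t x a y + w y \<partial>Pstar t (x, a))"
      using integrable_continuous_probs_on[OF X(1) P w] by (simp add: grad_reward_def P.prob_space)
  qed
  ultimately show ?thesis unfolding dq by simp
qed

text \<open>The limit from \<open>gradient_step\<close> satisfies the recursion for expected returns
  and is therefore \<open>grad\<close>. Continuity of the limit is carried along because the
  stability estimate inside \<open>danskin\<close> tests laws with continuous functions
  only.\<close>

lemma value_fun_gradient:
  assumes h: "\<And>n. h n \<noteq> 0" "h \<longlonglongrightarrow> 0" "\<And>n. \<bar>h n\<bar> \<le> h1"
    and h1: "\<And>h. \<bar>h\<bar> \<le> h1 \<Longrightarrow> \<theta> + h *\<^sub>R r \<in> interior (params M)"
    and equi: "\<And>s. s \<le> T \<Longrightarrow> equicontinuous_on X (range (dq r h s))"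
    and tn: "t + n = T"
  shows "uniform_limit X (dq r h t) (grad r n t) sequentially" and "continuous_on X (grad r n t)"
proof -
  interpret g: path_rewards MX MA "policy M \<theta>" Pstar 0 T "grad_reward r" "\<lambda>_. 0" "grad_bound r"
    by (rule path_rewards_grad)
  have "uniform_limit X (dq r h t) (grad r n t) sequentially \<and> continuous_on X (grad r n t)"
    using tn
  proof (induction n arbitrary: t)
    case 0
    \<comment> \<open>The terminal reward does not depend on the parameter, so all quotients vanish
      at the horizon.\<close>
    have dq: "dq r h t k x = 0" if "x \<in> X" for x k
      using value_fun_terminal[OF _ that] \<theta> h1[OF h(3)[of k]] interior_subset 0 by force
    have grad: "grad r 0 t x = 0" if "x \<in> X" for x
      using g.expected_return_0[of t x] that 0 by simp
    have "(\<lambda>k. dq r h t k x) \<longlonglongrightarrow> grad r 0 t x" if "x \<in> X" for x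
      by (simp only: dq[OF that] grad[OF that] tendsto_const)
    with equicontinuous_pointwise_imp_uniform_limit[OF X(1) equi, of t "grad r 0 t"] 0 show ?case by simp
  next
    case (Suc n)
    then have t: "t < T" and "Suc t + n = T" by auto
    from Suc.IH[OF this(2)] have IH: "uniform_limit X (dq r h (Suc t)) (grad r n (Suc t)) sequentially"
      "continuous_on X (grad r n (Suc t))" by auto
    have "(\<lambda>k. dq r h t k x) \<longlonglongrightarrow> grad r (Suc n) t x" if "x \<in> X" for x
      using gradient_step[OF t that h h1 IH] g.expected_return_Suc[of t n x] Suc.prems that by simp
    with equicontinuous_pointwise_imp_uniform_limit[OF X(1) equi, of t "grad r (Suc n) t"] t show ?case by simp
  qed
  then show "uniform_limit X (dq r h t) (grad r n t) sequentially" "continuous_on X (grad r n t)" by auto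
qed

section \<open>From value functions to the gradient of the objective\<close>

lemma objective_derivative:
  "(\<lambda>h. (objective M (\<theta> + h *\<^sub>R r) - objective M \<theta>) / h) \<midarrow>0\<rightarrow> (\<integral>x. grad r T 0 x \<partial>init M)"
  \<comment> \<open>The limit is tested along sequences, the form in which dominated convergence and
    the equicontinuity argument are available.\<close>
  unfolding LIMSEQ_SEQ_conv[symmetric]
proof (intro allI impI, elim conjE)
  fix k :: "nat \<Rightarrow> real" assume k: "\<forall>n. k n \<noteq> 0" "k \<longlonglongrightarrow> 0"
  obtain h1 where h1: "h1 > 0" "\<And>h. \<bar>h\<bar> \<le> h1 \<Longrightarrow> \<theta> + h *\<^sub>R r \<in> interior (params M)"
    using interior_radius[of r] by blast
  obtain h0 where h0: "h0 > 0" "\<And>s. s \<le> T \<Longrightarrow> equicontinuous_on X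
      {(\<lambda>x. (value_fun M s (\<theta> + h *\<^sub>R r) x - value_fun M s \<theta> x) / h) |h.
        0 < \<bar>h\<bar> \<and> \<bar>h\<bar> \<le> h0 \<and> \<theta> + h *\<^sub>R r \<in> params M}"
    using equicont[of r] by blast
  obtain N where N: "\<And>n. n \<ge> N \<Longrightarrow> \<bar>k n\<bar> < min h0 h1"
    using LIMSEQ_D[OF k(2), of "min h0 h1"] h0(1) h1(1) by auto
  \<comment> \<open>Dropping the first \<open>N\<close> terms keeps every increment inside both the
    equicontinuity radius \<open>h0\<close> and the interior radius \<open>h1\<close>, and does not
    affect the limit.\<close>
  define h where "h n = k (n + N)" for n
  have h: "h n \<noteq> 0" "h \<longlonglongrightarrow> 0" "\<bar>h n\<bar> \<le> h1" "\<bar>h n\<bar> \<le> h0" for n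
    using k LIMSEQ_ignore_initial_segment[OF k(2), of N] N[of "n + N"] by (auto simp: h_def[abs_def])
  have hp: "\<theta> + h n *\<^sub>R r \<in> params M" for n using h1(2)[OF h(3)] interior_subset by blast
  have equi: "equicontinuous_on X (range (dq r h s))" if "s \<le> T" for s
    by (rule equicontinuous_on_subset[OF h0(2)[OF that]]) (use h hp in auto)
  note lim = value_fun_gradient[OF h(1,2,3) h1(2) equi, of 0 T]
  have init: "init M \<in> probs_on X" using local.init by (simp add: probs_on_def)
  have V: "continuous_on X (value_fun M 0 \<theta>')" if "\<theta>' \<in> params M" for \<theta>'
    by (rule continuous_on_value_fun[OF that]) simp
  have J: "(objective M (\<theta> + h n *\<^sub>R r) - objective M \<theta>) / h n = (\<integral>x. dq r h 0 n x \<partial>init M)" for n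
    using integrable_continuous_probs_on[OF X(1) init V[OF \<theta>]]
      integrable_continuous_probs_on[OF X(1) init V[OF hp[of n]]]
    by (simp add: objective_def)
  have "(\<lambda>n. \<integral>x. dq r h 0 n x \<partial>init M) \<longlonglongrightarrow> (\<integral>x. grad r T 0 x \<partial>init M)"
  proof (rule LIMSEQ_I)
    fix e :: real assume e: "e > 0"
    have "\<forall>\<^sub>F n in sequentially. \<forall>x\<in>X. dist (dq r h 0 n x) (grad r T 0 x) < e / 2"
      using uniform_limitD[OF lim(1), of "e / 2"] e by simp
    then have "\<forall>\<^sub>F n in sequentially. norm ((\<integral>x. dq r h 0 n x \<partial>init M) - (\<integral>x. grad r T 0 x \<partial>init M)) < e"
    proof eventually_elim
      fix n assume n: "\<forall>x\<in>X. dist (dq r h 0 n x) (grad r T 0 x) < e / 2"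
      have "continuous_on X (dq r h 0 n)"
        using V[OF \<theta>] V[OF hp] h(1) by (intro continuous_intros) auto
      moreover have "continuous_on X (grad r T 0)" using lim(2) by simp
      ultimately have "\<bar>(\<integral>x. dq r h 0 n x \<partial>init M) - (\<integral>x. grad r T 0 x \<partial>init M)\<bar> \<le> e / 2"
        using n probs_onD[OF init]
        by (intro abs_integral_diff_le integrable_continuous_probs_on[OF X(1) init])
           (auto simp: dist_real_def intro: less_imp_le)
      then show "norm ((\<integral>x. dq r h 0 n x \<partial>init M) - (\<integral>x. grad r T 0 x \<partial>init M)) < e" using e by simp
    qed
    then show "\<exists>no. \<forall>n\<ge>no. norm ((\<integral>x. dq r h 0 n x \<partial>init M) - (\<integral>x. grad r T 0 x \<partial>init M)) < e"
      by (simp add: eventually_sequentially)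
  qed
  then have "(\<lambda>n. (objective M (\<theta> + h n *\<^sub>R r) - objective M \<theta>) / h n) \<longlonglongrightarrow> (\<integral>x. grad r T 0 x \<partial>init M)"
    unfolding J .
  then show "(\<lambda>n. (objective M (\<theta> + k n *\<^sub>R r) - objective M \<theta>) / k n) \<longlonglongrightarrow> (\<integral>x. grad r T 0 x \<partial>init M)"
    unfolding h_def by (rule LIMSEQ_offset)
qed

abbreviation "grad_sum p \<equiv> \<Sum>t<T. dual_value M t \<theta> (fst p t) (snd p t) *\<^sub>R score t \<theta> (fst p t) (snd p t)"

text \<open>Pairing with a direction turns the vector-valued sum into a scalar path return, so that
  the results on path laws apply to it.\<close>

lemma grad_sum_inner: "grad_sum p \<bullet> r = path_return (grad_reward r) (\<lambda>_. 0) T 0 p"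
  by (simp add: path_return_def grad_reward_def inner_sum_left atLeast0LessThan)

lemma integral_grad_sum: "(\<integral>p. grad_sum p \<partial>path_measure M \<theta> Pstar) \<bullet> r = (\<integral>x. grad r T 0 x \<partial>init M)"
proof -
  let ?PS = "path_space MX MA 0 T" and ?PM = "path_measure M \<theta> Pstar"
  interpret g: path_rewards MX MA "policy M \<theta>" Pstar 0 T "grad_reward i" "\<lambda>_. 0" "grad_bound i" for i
    by (rule path_rewards_grad)
  note law = g.measurable_law[of 0 T, simplified]
  note ret = g.path_return_measurable[of 0 T, simplified]
  have PM: "?PM \<in> space (prob_algebra ?PS)"
    unfolding path_measure_def space_prob_algebra
    using prob_space_bind'[OF init law] sets_bind'[OF init law] by simp
  have int: "integrable ?PM (\<lambda>p. grad_sum p \<bullet> i)" for i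
    unfolding grad_sum_inner
    by (rule integrable_bounded_prob_algebra(1)[OF PM ret])
  \<comment> \<open>The path-law results give integrability only for scalar pairings. Reassembling
    the coordinates yields integrability of the vector, which is needed before the inner product may
    be moved inside the integral.\<close>
  have "integrable ?PM (\<lambda>p. \<Sum>i\<in>Basis. (grad_sum p \<bullet> i) *\<^sub>R i)"
    by (intro Bochner_Integration.integrable_sum integrable_scaleR_left int)
  then have "integrable ?PM grad_sum" by (simp only: euclidean_representation)
  then have "(\<integral>p. grad_sum p \<partial>?PM) \<bullet> r = (\<integral>p. grad_sum p \<bullet> r \<partial>?PM)"
    by (simp only: integral_inner_left)
  also have "\<dots> = (\<integral>x. grad r T 0 x \<partial>init M)"
    unfolding grad_sum_inner path_measure_def expected_return_def
    by (rule integral_bind_prob_algebra[OF init law ret])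
  finally show ?thesis .
qed

lemma has_gradient_objective:
  "has_gradient_within (objective M) (\<integral>p. grad_sum p \<partial>path_measure M \<theta> Pstar) \<theta> UNIV"
  unfolding has_gradient_within_def integral_grad_sum using objective_derivative by simp

end

theorem corollary3p3:
  fixes M :: "('x::euclidean_space, 'a::euclidean_space, 'p::euclidean_space) robust_mdp"
    and score :: "nat \<Rightarrow> 'p \<Rightarrow> 'x \<Rightarrow> 'a \<Rightarrow> 'p"
    and \<Lambda> :: real
    and \<theta> :: 'p
    and Pstar :: "nat \<Rightarrow> 'x \<times> 'a \<Rightarrow> 'x measure"
  assumes model: "robust_control_model M"
    and reward_cont: "\<forall>t<horizon M. continuous_on (states M \<times> actions M \<times> states M)
          (\<lambda>(x, a, y). reward M t x a y)"
    and terminal_cont: "continuous_on (states M) (terminal M)"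
    and nominal_cont: "\<forall>t<horizon M.
          weakly_continuous_on (states M \<times> actions M) (nominal M t) (states M)"
    and regular: "regular_policy_class M score"
    and dual_bound: "\<forall>t<horizon M. \<forall>\<theta>\<in>params M. \<forall>x\<in>states M. \<forall>a\<in>actions M.
          dual_maximizers M {0..} t \<theta> x a = dual_maximizers M {0..\<Lambda>} t \<theta> x a"
    and equicont: "\<forall>\<theta>\<in>interior (params M). \<forall>r. \<exists>h\<^sub>0>0.
          (\<forall>s\<le>horizon M. equicontinuous_on (states M)
             {(\<lambda>x. (value_fun M s (\<theta> + h *\<^sub>R r) x - value_fun M s \<theta> x) / h) |h.
                0 < \<bar>h\<bar> \<and> \<bar>h\<bar> \<le> h\<^sub>0 \<and> \<theta> + h *\<^sub>R r \<in> params M}) \<and>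
          (\<forall>s<horizon M. equicontinuous_on (states M \<times> actions M \<times> {0..\<Lambda>})
             {(\<lambda>(x, a, lam). (dual_fun M s (\<theta> + h *\<^sub>R r) lam x a - dual_fun M s \<theta> lam x a) / h) |h.
                0 < \<bar>h\<bar> \<and> \<bar>h\<bar> \<le> h\<^sub>0 \<and> \<theta> + h *\<^sub>R r \<in> params M})"
    and unique: "\<forall>t<horizon M. \<forall>x\<in>states M. \<forall>a\<in>actions M. \<forall>\<theta>\<in>params M.
          \<exists>lam. dual_maximizers M {0..} t \<theta> x a = {lam} \<and>
            (\<forall>x'\<in>states M. \<exists>ys. inner_minimizers M t \<theta> lam x a x' = {ys})"
    and interior: "\<theta> \<in> interior (params M)"
    and worst_case: "worst_case_selector M \<theta> Pstar"
  shows "has_gradient_within (objective M)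
           (\<integral>(\<omega>, \<alpha>). (\<Sum>t<horizon M. dual_value M t \<theta> (\<omega> t) (\<alpha> t) *\<^sub>R score t \<theta> (\<omega> t) (\<alpha> t))
              \<partial>path_measure M \<theta> Pstar)
           \<theta> UNIV"
proof -
  interpret gradient_point M score \<Lambda> \<theta> Pstar
  proof (intro gradient_point.intro unique_robust_mdp.intro gradient_point_axioms.intro)
    fix t \<theta> x a assume "t < horizon M" "\<theta> \<in> params M" "x \<in> states M" "a \<in> actions M"
    then show "dual_maximizers M {0..} t \<theta> x a = dual_maximizers M {0..\<Lambda>} t \<theta> x a"
      and "\<exists>lam. dual_maximizers M {0..} t \<theta> x a = {lam} \<and>
            (\<forall>x'\<in>states M. \<exists>ys. inner_minimizers M t \<theta> lam x a x' = {ys})"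
      using dual_bound unique by blast+
  next
    fix r
    show "\<exists>h\<^sub>0>0. \<forall>s\<le>horizon M. equicontinuous_on (states M)
             {(\<lambda>x. (value_fun M s (\<theta> + h *\<^sub>R r) x - value_fun M s \<theta> x) / h) |h.
                0 < \<bar>h\<bar> \<and> \<bar>h\<bar> \<le> h\<^sub>0 \<and> \<theta> + h *\<^sub>R r \<in> params M}"
      using equicont[rule_format, OF interior, of r] by blast
  qed (use model reward_cont terminal_cont nominal_cont regular interior worst_case in blast)+
  show ?thesis
    using has_gradient_objective unfolding split_beta' .
qed

end
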